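(* For every computable ordinal $\alpha>0$ and every $k\ge 3$, there is a computable Borel code for a $\Delta^0_\alpha$ coloring $c:(\omega)^k\to 2$ such that every infinite partition $p\in(\omega)^\omega$ homogeneous for $c$ computes $\emptyset^{(\alpha)}$ if $\alpha$ is infinite, or $\emptyset^{(\alpha-1)}$ if $\alpha$ is finite.
   Context: Partitions: $k$ is identified with $\{0,\dots,k-1\}$. For $k\le s\le\omega$, $(s)^k$ is the set of surjections $p:s\to k$ that are ordered: $\min p^{-1}(i)<\min p^{-1}(j)$ whenever $i<j<k$. $(<\omega)^k=\bigcup_{r\in\omega}(r)^k$. For $p\in(\omega)^\omega$, $(p)^k=\{x\circ p:x\in(\omega)^k\}$. For $\sigma\in(<\omega)^k$, $[\sigma]=\{p\in(\omega)^k:\sigma\prec p\}$. A partition $p\in(\omega)^\omega$ is homogeneous for $c:(\omega)^k\to2$ if $c$ is constant on $(p)^k$. Borel codes: let $L$ be a countable set of labels effectively coding the clopen sets $\emptyset$, $(\omega)^k$, $[\sigma]$ and $\overline{[\sigma]}$ for $\sigma\in(<\omega)^k$ (bars denote complements in $(\omega)^k$). A Borel code for a $\mathbf\Sigma^0_0$ or $\mathbf\Pi^0_0$ set is a labeled tree consisting of just a root labeled by an element of $L$, representing that clopen set. For $\alpha\ge1$, a Borel code for a $\mathbf\Sigma^0_\alpha$ set is a labeled tree whose root is labeled $\cup$ and whose subtrees attached at level 1 are each a Borel code for a $\mathbf\Sigma^0_{\beta_n}$ or $\mathbf\Pi^0_{\beta_n}$ set $A_n$ for some $\beta_n<\alpha$;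 it represents $\bigcup_nA_n$. A Borel code for a $\mathbf\Pi^0_\alpha$ set is the same with root labeled $\cap$, representing $\bigcap_nA_n$. For $\alpha\ge1$, a Borel code for a $\mathbf\Delta^0_\alpha$ set is a pair of labeled trees coding the same set, one as a $\mathbf\Sigma^0_\alpha$ set and the other as a $\mathbf\Pi^0_\alpha$ set. A Borel code is computable if it is computable as a labeled subtree (or pair of such) of $\omega^{<\omega}$. A computable Borel code for a $\Delta^0_\alpha$ coloring $c:(\omega)^k\to2$ is a computable Borel code for one of its color classes $R$ as a $\Delta^0_\alpha$ set (the other class being $\overline R$). Jumps: for a computable ordinal $\alpha$, $\emptyset^{(\alpha)}$ denotes the $\alpha$-th iterate of the Turing jump of $\emptyset$, i.e. the set $H_a$ (well defined up to Turing degree) for a notation $a$ of $\alpha$ in Kleene's $\mathcal O$, where $H_1=\emptyset$, $H_{2^a}=H_a'$, $H_{3\cdot5^e}=\{\langle i,j\rangle: i\in H_{\varphi_e(j)}\}$. *)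

theory Defs
  imports Main "HOL-Library.Nat_Bijection"
begin

section \<open>Relative computability\<close>

text \<open>Programs for unary partial functions on the natural numbers, with tuples passed through
  \<open>prod_encode\<close>. The oracle is a total function \<open>g\<close>.\<close>

datatype prog =
    Zero | Succ | Fst | Snd | Oracle
  | Pair prog prog
  | Comp prog prog
  | Rec prog prog
  | Mu prog

inductive run :: "(nat \<Rightarrow> nat) \<Rightarrow> prog \<Rightarrow> nat \<Rightarrow> nat \<Rightarrow> bool" for g where
  "run g Zero x 0"
| "run g Succ x (Suc x)"
| "run g Fst (prod_encode (x, y)) x"
| "run g Snd (prod_encode (x, y)) y"
| "run g Oracle x (g x)"
| "run g c x y \<Longrightarrow> run g d x z \<Longrightarrow> run g (Pair c d) x (prod_encode (y, z))"
| "run g d x y \<Longrightarrow> run g c y z \<Longrightarrow> run g (Comp c d) x z"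
| "run g c x y \<Longrightarrow> run g (Rec c d) (prod_encode (x, 0)) y"
| "run g (Rec c d) (prod_encode (x, n)) y \<Longrightarrow> run g d (prod_encode (x, prod_encode (n, y))) z
    \<Longrightarrow> run g (Rec c d) (prod_encode (x, Suc n)) z"
| "run g c (prod_encode (x, n)) 0 \<Longrightarrow> \<forall>m<n. \<exists>y>0. run g c (prod_encode (x, m)) y
    \<Longrightarrow> run g (Mu c) x n"

primrec prog_index :: "prog \<Rightarrow> nat" where
  "prog_index Zero = 0"
| "prog_index Succ = 1"
| "prog_index Fst = 2"
| "prog_index Snd = 3"
| "prog_index Oracle = 4"
| "prog_index (Pair c d) = 5 + 4 * prod_encode (prog_index c, prog_index d)"
| "prog_index (Comp c d) = 6 + 4 * prod_encode (prog_index c, prog_index d)"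
| "prog_index (Rec c d) = 7 + 4 * prod_encode (prog_index c, prog_index d)"
| "prog_index (Mu c) = 8 + 4 * prog_index c"

text \<open>\<open>phi_rel g e x y\<close>: the \<open>e\<close>-th partial \<open>g\<close>-computable function converges on \<open>x\<close> to \<open>y\<close>.\<close>

definition phi_rel :: "(nat \<Rightarrow> nat) \<Rightarrow> nat \<Rightarrow> nat \<Rightarrow> nat \<Rightarrow> bool" where
  "phi_rel g e x y \<longleftrightarrow> (\<exists>c. prog_index c = e \<and> run g c x y)"

abbreviation phi :: "nat \<Rightarrow> nat \<Rightarrow> nat \<Rightarrow> bool" where
  "phi \<equiv> phi_rel (\<lambda>_. 0)"

definition chi :: "nat set \<Rightarrow> nat \<Rightarrow> nat" where
  "chi A x = (if x \<in> A then 1 else 0)"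

definition computable_from :: "(nat \<Rightarrow> nat) \<Rightarrow> (nat \<Rightarrow> nat) \<Rightarrow> bool" where
  "computable_from g f \<longleftrightarrow> (\<exists>e. \<forall>x. phi_rel g e x (f x))"

definition computable :: "(nat \<Rightarrow> nat) \<Rightarrow> bool" where
  "computable = computable_from (\<lambda>_. 0)"

definition computes_set :: "(nat \<Rightarrow> nat) \<Rightarrow> nat set \<Rightarrow> bool" where
  "computes_set g A \<longleftrightarrow> computable_from g (chi A)"

definition turing_jump :: "nat set \<Rightarrow> nat set" where
  "turing_jump A = {e. \<exists>y. phi_rel (chi A) e e y}"

lemma prog_index_inj: "prog_index c = prog_index d \<Longrightarrow> c = d"
proof (induction c arbitrary: d)
  case (Pair c1 c2)
  then show ?case by (cases d) (simp_all, presburger+)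
next
  case (Comp c1 c2)
  then show ?case by (cases d) (simp_all, presburger+)
next
  case (Rec c1 c2)
  then show ?case by (cases d) (simp_all, presburger+)
next
  case (Mu c)
  then show ?case by (cases d) (simp_all, presburger+)
qed (case_tac d; simp)+

lemma prog_index_surj: "\<exists>c. prog_index c = e"
proof (induction e rule: less_induct)
  case (less e)
  show ?case
  proof (cases "e < 5")
    case True
    then have "e = 0 \<or> e = 1 \<or> e = 2 \<or> e = 3 \<or> e = 4" by auto
    then show ?thesis by (metis prog_index.simps(1-5))
  next
    case False
    define q where "q = (e - 5) div 4"
    obtain a b where q: "q = prod_encode (a, b)" by (metis prod_decode_inverse surj_pair)
    have "a \<le> q" "b \<le> q" "q < e"
      using False le_prod_encode_1 le_prod_encode_2 q by (auto simp: q_def)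
    then obtain c d m where cdm: "prog_index c = a" "prog_index d = b" "prog_index m = q"
      using less.IH by (meson le_less_trans)
    have "e = 5 + 4 * q \<or> e = 6 + 4 * q \<or> e = 7 + 4 * q \<or> e = 8 + 4 * q"
      using False unfolding q_def by presburger
    then have "e = prog_index (Pair c d) \<or> e = prog_index (Comp c d) \<or> e = prog_index (Rec c d)
        \<or> e = prog_index (Mu m)"
      by (simp add: cdm q)
    then show ?thesis by blast
  qed
qed

lemma run_det: "run g c x y \<Longrightarrow> run g c x z \<Longrightarrow> y = z"
proof (induction arbitrary: z rule: run.induct)
  case (6 c x y d z')
  from "6.prems" show ?case by (cases rule: run.cases) (use "6.IH" in auto)
next
  case (7 d x y c z')
  from "7.prems" show ?case by (cases rule: run.cases) (use "7.IH" in auto)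
next
  case (8 c x y d)
  from "8.prems" have "run g c x z" by (cases rule: run.cases) simp_all
  then show ?case by (rule "8.IH")
next
  case (9 c d x n y z')
  from "9.prems" obtain w where
    "run g (Rec c d) (prod_encode (x, n)) w" "run g d (prod_encode (x, prod_encode (n, w))) z"
    by (cases rule: run.cases) simp_all
  then show ?case using "9.IH" by blast
next
  case (10 c x n)
  from "10.prems" have z: "run g c (prod_encode (x, z)) 0"
      "\<forall>m<z. \<exists>y>0. run g c (prod_encode (x, m)) y"
    by (cases rule: run.cases; simp)+
  have "\<not> z < n" using "10.IH"(2) z(1) by fastforce
  moreover have "\<not> n < z" using "10.IH"(1) z(2) by fastforce
  ultimately show ?case by simp
qed (erule run.cases; simp)+

lemma phi_rel_det: "phi_rel g e x y \<Longrightarrow> phi_rel g e x z \<Longrightarrow> y = z"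
  unfolding phi_rel_def using prog_index_inj run_det by metis


section \<open>Ordinal notations and iterated jumps\<close>

inductive kleene_O :: "nat \<Rightarrow> bool" and kleene_less :: "nat \<Rightarrow> nat \<Rightarrow> bool" where
  O_zero: "kleene_O 1"
| O_suc: "kleene_O a \<Longrightarrow> kleene_O (2 ^ a)"
| O_lim: "\<forall>n. phi e n (f n) \<Longrightarrow> \<forall>n. kleene_O (f n) \<Longrightarrow> \<forall>n. kleene_less (f n) (f (Suc n))
    \<Longrightarrow> kleene_O (3 * 5 ^ e)"
| less_suc: "kleene_O a \<Longrightarrow> kleene_less a (2 ^ a)"
| less_lim: "kleene_O (3 * 5 ^ e) \<Longrightarrow> phi e n a \<Longrightarrow> kleene_less a (3 * 5 ^ e)"
| less_trans: "kleene_less a b \<Longrightarrow> kleene_less b c \<Longrightarrow> kleene_less a c"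

text \<open>An ordinal is an element \<open>\<alpha>\<close> of an arbitrary well-ordered type and stands for the order type
  of \<open>{..<\<alpha>}\<close>; every computable ordinal arises in this way from some type.\<close>

definition is_zero :: "'o::wellorder \<Rightarrow> bool" where
  "is_zero \<alpha> \<longleftrightarrow> (\<forall>\<beta>. \<alpha> \<le> \<beta>)"

definition is_suc :: "'o::wellorder \<Rightarrow> 'o \<Rightarrow> bool" where
  "is_suc \<alpha> \<beta> \<longleftrightarrow> \<alpha> < \<beta> \<and> (\<forall>\<gamma>. \<alpha> < \<gamma> \<longrightarrow> \<beta> \<le> \<gamma>)"

definition is_sup :: "(nat \<Rightarrow> 'o::wellorder) \<Rightarrow> 'o \<Rightarrow> bool" where
  "is_sup h \<alpha> \<longleftrightarrow> (\<forall>n. h n \<le> \<alpha>) \<and> (\<forall>\<beta>. (\<forall>n. h n \<le> \<beta>) \<longrightarrow> \<alpha> \<le> \<beta>)"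

text \<open>\<open>notates a \<alpha>\<close>: \<open>a\<close> is in Kleene's O and denotes \<open>\<alpha>\<close>.\<close>

inductive notates :: "nat \<Rightarrow> 'o::wellorder \<Rightarrow> bool" where
  "is_zero \<alpha> \<Longrightarrow> notates 1 \<alpha>"
| "notates a \<alpha> \<Longrightarrow> is_suc \<alpha> \<beta> \<Longrightarrow> notates (2 ^ a) \<beta>"
| "kleene_O (3 * 5 ^ e) \<Longrightarrow> \<forall>n. phi e n (f n) \<Longrightarrow> \<forall>n. notates (f n) (h n) \<Longrightarrow> is_sup h \<alpha>
    \<Longrightarrow> notates (3 * 5 ^ e) \<alpha>"

definition computable_ordinal :: "'o::wellorder \<Rightarrow> bool" where
  "computable_ordinal \<alpha> \<longleftrightarrow> (\<exists>a. notates a \<alpha>)"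

inductive H_rel :: "nat \<Rightarrow> nat set \<Rightarrow> bool" where
  "H_rel 1 {}"
| "kleene_O a \<Longrightarrow> H_rel a X \<Longrightarrow> H_rel (2 ^ a) (turing_jump X)"
| "kleene_O (3 * 5 ^ e) \<Longrightarrow> \<forall>j. phi e j (f j) \<Longrightarrow> \<forall>j. H_rel (f j) (X j)
    \<Longrightarrow> H_rel (3 * 5 ^ e) {prod_encode (i, j) | i j. i \<in> X j}"

definition H_set :: "nat \<Rightarrow> nat set" where
  "H_set a = (THE X. H_rel a X)"

text \<open>Computing the \<open>\<alpha>\<close>-th jump of the empty set. Its Turing degree does not depend on the
  notation (Spector), so all notations of \<open>\<alpha>\<close> are required.\<close>

definition computes_jump :: "(nat \<Rightarrow> nat) \<Rightarrow> 'o::wellorder \<Rightarrow> bool" where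
  "computes_jump g \<alpha> \<longleftrightarrow> (\<forall>a. notates a \<alpha> \<longrightarrow> computes_set g (H_set a))"

lemma kleene_O_pos: "kleene_O a \<Longrightarrow> a > 0"
  by (erule kleene_O.cases) auto

lemma one_neq_pow2: "kleene_O a \<Longrightarrow> 1 \<noteq> (2::nat) ^ a"
  by (metis kleene_O_pos less_irrefl one_less_numeral_iff one_less_power semiring_norm(76))

lemma pow2_neq_lim: "(2::nat) ^ a \<noteq> 3 * 5 ^ e"
proof
  assume eq: "(2::nat) ^ a = 3 * 5 ^ e"
  have "odd (3 * 5 ^ e :: nat)" by simp
  then have "a = 0" using eq by (metis even_power even_numeral gr0I)
  then show False using eq by simp
qed

lemma H_rel_unique: "H_rel a X \<Longrightarrow> H_rel a Y \<Longrightarrow> X = Y"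
proof (induction arbitrary: Y rule: H_rel.induct)
  case 1
  then show ?case
  proof (cases rule: H_rel.cases)
    case (2 a X)
    then show ?thesis using one_neq_pow2 by blast
  next
    case (3 e f X)
    from 3(1) show ?thesis by simp
  qed simp
next
  case (2 a X)
  from "2.prems" show ?case
  proof (cases rule: H_rel.cases)
    case 1
    then show ?thesis using kleene_O_pos[OF "2.hyps"(1)] by simp
  next
    case (2 b Z)
    then show ?thesis using "2.IH" by simp
  next
    case (3 e f Z)
    then show ?thesis using pow2_neq_lim by metis
  qed
next
  case (3 e f X)
  from "3.prems" show ?case
  proof (cases rule: H_rel.cases)
    case 1
    then show ?thesis by simp
  next
    case (2 b Z)
    then show ?thesis using pow2_neq_lim by metis
  next
    case (3 e' f' X')
    have "e' = e" using 3(1) by simp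
    then have "f' j = f j" for j
      using 3(4) "3.hyps"(2) phi_rel_det by blast
    then have "X j = X' j" for j
      using 3(5) "3.IH" by simp
    then show ?thesis using 3(2) by simp
  qed
qed

lemma H_rel_exists: "kleene_O a \<Longrightarrow> \<exists>X. H_rel a X"
proof (induction a rule: kleene_O_kleene_less.inducts(1)[where ?P2.0 = "\<lambda>_ _. True"])
  case (O_lim e f)
  then obtain X where "\<forall>n. H_rel (f n) (X n)" by metis
  moreover have "kleene_O (3 * 5 ^ e)"
    using O_lim by (blast intro: kleene_O_kleene_less.O_lim)
  ultimately show ?case
    using O_lim by (blast intro: H_rel.intros(3))
qed (blast intro: H_rel.intros)+

lemma H_rel_H_set: "kleene_O a \<Longrightarrow> H_rel a (H_set a)"
  unfolding H_set_def by (rule theI') (use H_rel_exists H_rel_unique in blast)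

lemma notates_kleene_O: "notates a \<alpha> \<Longrightarrow> kleene_O a"
proof (induction rule: notates.induct)
  case 1
  show ?case by (rule O_zero)
qed (blast intro: O_suc)+

lemma notates_unique: "notates a \<alpha> \<Longrightarrow> notates a \<beta> \<Longrightarrow> \<alpha> = \<beta>"
proof (induction arbitrary: \<beta> rule: notates.induct)
  case (1 \<alpha>)
  from "1.prems" show ?case
  proof (cases rule: notates.cases)
    case 1
    then show ?thesis using "1.hyps" unfolding is_zero_def by (meson order_antisym)
  next
    case (2 a \<gamma>)
    then show ?thesis using one_neq_pow2 notates_kleene_O by blast
  next
    case (3 e f h)
    from 3(1) show ?thesis by simp
  qed
next
  case (2 a \<alpha> \<alpha>')
  from "2.prems" show ?case
  proof (cases rule: notates.cases)
    case 1
    then show ?thesis using kleene_O_pos[OF notates_kleene_O[OF "2.hyps"(1)]] by simp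
  next
    case (2 b \<gamma>)
    then have "\<alpha> = \<gamma>" using "2.IH" by simp
    then show ?thesis using 2 "2.hyps"(2) unfolding is_suc_def by (meson order_antisym)
  next
    case (3 e f h)
    then show ?thesis using pow2_neq_lim by metis
  qed
next
  case (3 e f h \<alpha>)
  from "3.prems" show ?case
  proof (cases rule: notates.cases)
    case 1
    then show ?thesis by simp
  next
    case (2 b \<gamma>)
    then show ?thesis using pow2_neq_lim by metis
  next
    case (3 e' f' h')
    have "e' = e" using 3(1) by simp
    then have "f' j = f j" for j
      using 3(3) "3.hyps"(2) phi_rel_det by blast
    then have "h j = h' j" for j
      using 3(4) "3.IH" by simp
    then have "h = h'" by blast
    then show ?thesis using 3(5) "3.hyps"(3) unfolding is_sup_def by (meson order_antisym)
  qed
qed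

lemma computable_ordinal_less:
  assumes "computable_ordinal \<alpha>" "\<beta> < \<alpha>"
  shows "computable_ordinal \<beta>"
proof -
  have "\<exists>b. notates b \<beta>" if "notates a \<alpha>" "\<beta> < \<alpha>" for a
    using that
  proof (induction rule: notates.induct)
    case (1 \<alpha>)
    then show ?case unfolding is_zero_def by (meson leD)
  next
    case (2 a \<alpha> \<alpha>')
    then show ?case unfolding is_suc_def by (metis leD linorder_neqE)
  next
    case (3 e f h \<alpha>)
    then obtain n where "\<beta> < h n" unfolding is_sup_def by (meson leD not_le_imp_less)
    then show ?case using "3.IH" by blast
  qed
  then show ?thesis using assms unfolding computable_ordinal_def by blast
qed

section \<open>Partitions\<close>

text \<open>An infinite partition is a function on the natural numbers; a partition in \<open>(r)^k\<close> with
  \<open>r\<close> finite is a list of length \<open>r\<close>.\<close>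

definition ordered_surj :: "nat set \<Rightarrow> nat set \<Rightarrow> (nat \<Rightarrow> nat) \<Rightarrow> bool" where
  "ordered_surj S K p \<longleftrightarrow> p ` S = K \<and>
     (\<forall>i\<in>K. \<forall>j\<in>K. i < j \<longrightarrow> (LEAST n. n \<in> S \<and> p n = i) < (LEAST n. n \<in> S \<and> p n = j))"

definition partitions :: "nat \<Rightarrow> (nat \<Rightarrow> nat) set" where
  "partitions k = {p. ordered_surj UNIV {..<k} p}"

definition inf_partitions :: "(nat \<Rightarrow> nat) set" where
  "inf_partitions = {p. ordered_surj UNIV UNIV p}"

definition fin_partitions :: "nat \<Rightarrow> nat list set" where
  "fin_partitions k = {\<sigma>. ordered_surj {..<length \<sigma>} {..<k} (\<lambda>n. \<sigma> ! n)}"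

definition coarsenings :: "nat \<Rightarrow> (nat \<Rightarrow> nat) \<Rightarrow> (nat \<Rightarrow> nat) set" where
  "coarsenings k p = {x \<circ> p | x. x \<in> partitions k}"

definition cylinder :: "nat \<Rightarrow> nat list \<Rightarrow> (nat \<Rightarrow> nat) set" where
  "cylinder k \<sigma> = {p \<in> partitions k. \<forall>n<length \<sigma>. p n = \<sigma> ! n}"

definition homogeneous :: "nat \<Rightarrow> ((nat \<Rightarrow> nat) \<Rightarrow> bool) \<Rightarrow> (nat \<Rightarrow> nat) \<Rightarrow> bool" where
  "homogeneous k c p \<longleftrightarrow> p \<in> inf_partitions \<and> (\<exists>b. \<forall>x\<in>coarsenings k p. c x = b)"


section \<open>Borel codes\<close>

datatype label =
    Union_Label | Inter_Label
  | Empty_Label | Full_Label | Cyl_Label "nat list" | Co_Cyl_Label "nat list"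

text \<open>\<open>clopen_label k l A\<close>: \<open>l\<close> is a leaf label and codes the clopen set \<open>A\<close>.\<close>

inductive clopen_label :: "nat \<Rightarrow> label \<Rightarrow> (nat \<Rightarrow> nat) set \<Rightarrow> bool" for k where
  "clopen_label k Empty_Label {}"
| "clopen_label k Full_Label (partitions k)"
| "\<sigma> \<in> fin_partitions k \<Longrightarrow> clopen_label k (Cyl_Label \<sigma>) (cylinder k \<sigma>)"
| "\<sigma> \<in> fin_partitions k \<Longrightarrow> clopen_label k (Co_Cyl_Label \<sigma>) (partitions k - cylinder k \<sigma>)"

text \<open>The domain of the map is the tree.\<close>

type_synonym labeled_tree = "nat list \<rightharpoonup> label"

definition subtree :: "labeled_tree \<Rightarrow> nat \<Rightarrow> labeled_tree" where
  "subtree T n = (\<lambda>s. T (n # s))"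

text \<open>\<open>sigma_code k \<alpha> T A\<close> and \<open>pi_code k \<alpha> T A\<close>: the tree \<open>T\<close> is a Borel code for a
  \<open>\<Sigma>\<^sup>0\<^sub>\<alpha>\<close>, respectively \<open>\<Pi>\<^sup>0\<^sub>\<alpha>\<close>, set and represents \<open>A\<close>. Requiring \<open>subtree T n\<close> to be empty
  when \<open>[n]\<close> is not a node makes the domain of \<open>T\<close> closed under initial segments.\<close>

inductive sigma_code :: "nat \<Rightarrow> 'o::wellorder \<Rightarrow> labeled_tree \<Rightarrow> (nat \<Rightarrow> nat) set \<Rightarrow> bool"
  and pi_code :: "nat \<Rightarrow> 'o::wellorder \<Rightarrow> labeled_tree \<Rightarrow> (nat \<Rightarrow> nat) set \<Rightarrow> bool"
  for k where
  sigma_leaf: "is_zero \<alpha> \<Longrightarrow> clopen_label k l A \<Longrightarrow> sigma_code k \<alpha> [[] \<mapsto> l] A"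
| pi_leaf: "is_zero \<alpha> \<Longrightarrow> clopen_label k l A \<Longrightarrow> pi_code k \<alpha> [[] \<mapsto> l] A"
| sigma_node: "\<not> is_zero \<alpha> \<Longrightarrow> T [] = Some Union_Label
    \<Longrightarrow> \<forall>n. [n] \<notin> dom T \<longrightarrow> subtree T n = Map.empty
    \<Longrightarrow> \<forall>n. [n] \<in> dom T \<longrightarrow>
          (\<exists>\<beta><\<alpha>. sigma_code k \<beta> (subtree T n) (A n) \<or> pi_code k \<beta> (subtree T n) (A n))
    \<Longrightarrow> sigma_code k \<alpha> T {x \<in> partitions k. \<exists>n. [n] \<in> dom T \<and> x \<in> A n}"
| pi_node: "\<not> is_zero \<alpha> \<Longrightarrow> T [] = Some Inter_Label
    \<Longrightarrow> \<forall>n. [n] \<notin> dom T \<longrightarrow> subtree T n = Map.empty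
    \<Longrightarrow> \<forall>n. [n] \<in> dom T \<longrightarrow>
          (\<exists>\<beta><\<alpha>. sigma_code k \<beta> (subtree T n) (A n) \<or> pi_code k \<beta> (subtree T n) (A n))
    \<Longrightarrow> pi_code k \<alpha> T {x \<in> partitions k. \<forall>n. [n] \<in> dom T \<longrightarrow> x \<in> A n}"

definition delta_code ::
  "nat \<Rightarrow> 'o::wellorder \<Rightarrow> labeled_tree \<times> labeled_tree \<Rightarrow> (nat \<Rightarrow> nat) set \<Rightarrow> bool" where
  "delta_code k \<alpha> D A \<longleftrightarrow> \<not> is_zero \<alpha> \<and> sigma_code k \<alpha> (fst D) A \<and> pi_code k \<alpha> (snd D) A"

fun label_index :: "label option \<Rightarrow> nat" where
  "label_index None = 0"
| "label_index (Some Union_Label) = 1"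
| "label_index (Some Inter_Label) = 2"
| "label_index (Some Empty_Label) = 3"
| "label_index (Some Full_Label) = 4"
| "label_index (Some (Cyl_Label \<sigma>)) = 5 + 2 * list_encode \<sigma>"
| "label_index (Some (Co_Cyl_Label \<sigma>)) = 6 + 2 * list_encode \<sigma>"

definition computable_tree :: "labeled_tree \<Rightarrow> bool" where
  "computable_tree T \<longleftrightarrow> computable (\<lambda>n. label_index (T (list_decode n)))"

definition color_class :: "nat \<Rightarrow> ((nat \<Rightarrow> nat) \<Rightarrow> bool) \<Rightarrow> bool \<Rightarrow> (nat \<Rightarrow> nat) set" where
  "color_class k c b = {x \<in> partitions k. c x = b}"

definition computable_coloring_code ::
  "nat \<Rightarrow> 'o::wellorder \<Rightarrow> labeled_tree \<times> labeled_tree \<Rightarrow> ((nat \<Rightarrow> nat) \<Rightarrow> bool) \<Rightarrow> bool" where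
  "computable_coloring_code k \<alpha> D c \<longleftrightarrow>
     computable_tree (fst D) \<and> computable_tree (snd D) \<and> (\<exists>b. delta_code k \<alpha> D (color_class k c b))"

end

theory Submission
  imports Defs
begin

text \<open>Let \<open>\<gamma>\<close> be \<open>\<alpha>\<close> or, for finite \<open>\<alpha>\<close>, its predecessor. A function that dominates suitable
  moduli of the jumps below \<open>\<gamma>\<close> computes the \<open>\<gamma>\<close>-th jump. The colour of a partition tells whether
  the least element of its block 2 exceeds the modulus at the least element of its block 1.
  Merging blocks makes this true for some coarsening of any infinite partition, so a homogeneous
  partition has it for all coarsenings, and the sequence of least elements of its blocks yields
  a dominating function.

  To keep the colouring at level \<open>\<alpha>\<close>, membership in a jump is certified by a finite deduction
  whose only open assumptions are negative literals about lower jumps. Then a finite conjunction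
  of negative literals fails if and only if some certificate of one of them has only true
  assumptions, so that unions and intersections alternate along descending ordinals with no
  Boolean combinations in between, and the nodes of the Borel code are just the certificates.

  The theorem asks for the jump along every notation of \<open>\<gamma>\<close>, while the code follows one notation
  \<open>r\<close>. Therefore the literals speak about all numbers \<open>d\<close>, and the deductions contain
  comparisons of the ordinal of \<open>d\<close> with ordinals reached by descending from \<open>r\<close>. This takes the
  place of Spector's theorem that the degree of \<open>H_set a\<close> depends only on the ordinal of \<open>a\<close>.\<close>

section \<open>Closure properties of relative computability\<close>

text \<open>Three blocks are what the colouring needs: block 0 absorbs everything that is to be
  ignored, and then the least elements of blocks 1 and 2 can be any two later block minima of the
  given partition. Domination is enough because a false atom is refuted by refuting all of its
  certificates, possibly infinitely many, and a modulus cuts them down to finitely many. The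
  different treatment of finite \<open>\<alpha>\<close> comes from the level of an atom. An atom at
  a path of ordinal \<open>\<beta>\<close> begins with an existential quantifier even for
  \<open>\<beta> = 0\<close>, so its level is \<open>1 + \<beta>\<close>, which equals
  \<open>\<beta>\<close> exactly if \<open>\<beta>\<close> is infinite. Subtrees of the root of a
  code must have levels below \<open>\<alpha>\<close>. Hence all \<open>\<beta> < \<alpha>\<close>
  are admissible if \<open>\<alpha>\<close> is infinite, but only those with
  \<open>\<beta> + 1 < \<alpha>\<close> if it is finite. The atoms at all
  \<open>\<beta> < \<gamma>\<close> are just what is needed to compute the
  \<open>\<gamma>\<close>-th jump.\<close>

definition pfst :: "nat \<Rightarrow> nat" where "pfst n = fst (prod_decode n)"
definition psnd :: "nat \<Rightarrow> nat" where "psnd n = snd (prod_decode n)"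

abbreviation pr :: "nat \<Rightarrow> nat \<Rightarrow> nat" where "pr a b \<equiv> prod_encode (a, b)"

lemma pfst_pr [simp]: "pfst (pr a b) = a" and psnd_pr [simp]: "psnd (pr a b) = b"
  by (simp_all add: pfst_def psnd_def)

lemma pr_pfst_psnd [simp]: "pr (pfst n) (psnd n) = n"
  by (simp add: pfst_def psnd_def)

lemma prE: obtains a b where "n = pr a b"
  by (metis pr_pfst_psnd)

lemma computable_from_iff: "computable_from g f \<longleftrightarrow> (\<exists>c. \<forall>x. run g c x (f x))"
  unfolding computable_from_def phi_rel_def
  using prog_index_inj by blast

text \<open>\<open>intro comp\<close> applies these rules backwards along the syntax of a term, so
  that most computability proofs only have to unfold a definition.\<close>

named_theorems comp

lemma cf_run: "(\<And>x. run g c x (f x)) \<Longrightarrow> computable_from g f"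
  by (auto simp: computable_from_iff)

lemma cf_id [comp]: "computable_from g (\<lambda>x. x)"
proof (rule cf_run)
  fix x
  show "run g (Pair Fst Snd) x x"
    using run.intros(6)[OF run.intros(3)[of g "pfst x" "psnd x"] run.intros(4)[of g "pfst x" "psnd x"]] by simp
qed

lemma cf_const [comp]: "computable_from g (\<lambda>x. k)"
proof (induction k)
  case 0
  show ?case by (rule cf_run, rule run.intros)
next
  case (Suc k)
  then show ?case unfolding computable_from_iff by (blast intro: run.intros(2,7))
qed

lemma cf_comp: "computable_from g f \<Longrightarrow> computable_from g h \<Longrightarrow> computable_from g (\<lambda>x. f (h x))"
  unfolding computable_from_iff by (blast intro: run.intros(7))

lemma cf_pair [comp]:
  "computable_from g f \<Longrightarrow> computable_from g h \<Longrightarrow> computable_from g (\<lambda>x. pr (f x) (h x))"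
  unfolding computable_from_iff by (blast intro: run.intros(6))

lemma cf_pfst [comp]: "computable_from g f \<Longrightarrow> computable_from g (\<lambda>x. pfst (f x))"
  by (rule cf_comp[of g pfst], rule cf_run[of g Fst])
    (use run.intros(3)[of g "pfst x" "psnd x" for x] in simp)

lemma cf_psnd [comp]: "computable_from g f \<Longrightarrow> computable_from g (\<lambda>x. psnd (f x))"
  by (rule cf_comp[of g psnd], rule cf_run[of g Snd])
    (use run.intros(4)[of g "pfst x" "psnd x" for x] in simp)

lemma cf_Suc [comp]: "computable_from g f \<Longrightarrow> computable_from g (\<lambda>x. Suc (f x))"
  by (rule cf_comp[of g Suc]) (rule cf_run, rule run.intros)

lemma cf_oracle: "computable_from g f \<Longrightarrow> computable_from g (\<lambda>x. g (f x))"
  by (rule cf_comp[of g g]) (rule cf_run, rule run.intros)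

lemma cf_comp2:
  assumes "computable_from g (\<lambda>y. F (pfst y) (psnd y))" "computable_from g a" "computable_from g b"
  shows "computable_from g (\<lambda>x. F (a x) (b x))"
  using cf_comp[OF assms(1) cf_pair[OF assms(2,3)]] by simp

lemma cf_rec [comp]:
  assumes a: "computable_from g a"
    and b: "computable_from g (\<lambda>z. b (pfst z) (pfst (psnd z)) (psnd (psnd z)))"
    and k: "computable_from g k"
  shows "computable_from g (\<lambda>x. rec_nat (a x) (b x) (k x))"
proof -
  obtain ca cb where ca: "\<And>x. run g ca x (a x)"
    and cb: "\<And>z. run g cb z (b (pfst z) (pfst (psnd z)) (psnd (psnd z)))"
    using a b by (auto simp: computable_from_iff)
  have "run g (Rec ca cb) (pr x n) (rec_nat (a x) (b x) n)" for x n
  proof (induction n)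
    case (Suc n)
    show ?case using run.intros(9)[OF Suc] cb[of "pr x (pr n (rec_nat (a x) (b x) n))"] by simp
  qed (simp add: run.intros(8) ca)
  then have "computable_from g (\<lambda>z. rec_nat (a (pfst z)) (b (pfst z)) (psnd z))"
    by (intro cf_run[of g "Rec ca cb"]) (metis pr_pfst_psnd)
  from cf_comp2[OF this cf_id k] show ?thesis .
qed

lemma cf_add [comp]:
  assumes "computable_from g a" "computable_from g b"
  shows "computable_from g (\<lambda>x. a x + b x)"
proof -
  have "n + m = rec_nat n (\<lambda>_ y. Suc y) m" for n m :: nat
    by (induction m) auto
  then have eq: "a x + b x = rec_nat (a x) (\<lambda>_ y. Suc y) (b x)" for x .
  show ?thesis unfolding eq by (intro comp assms cf_comp[OF assms(1)] cf_comp[OF assms(2)])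
qed

lemma cf_pred [comp]:
  assumes "computable_from g a"
  shows "computable_from g (\<lambda>x. a x - Suc 0)"
proof -
  have eq: "a x - Suc 0 = rec_nat 0 (\<lambda>n _. n) (a x)" for x
    by (cases "a x") auto
  show ?thesis unfolding eq by (intro comp assms)
qed

lemma cf_diff [comp]:
  assumes "computable_from g a" "computable_from g b"
  shows "computable_from g (\<lambda>x. a x - b x)"
proof -
  have "n - m = rec_nat n (\<lambda>_ y. y - Suc 0) m" for n m :: nat
    by (induction m) auto
  then have eq: "a x - b x = rec_nat (a x) (\<lambda>_ y. y - Suc 0) (b x)" for x .
  show ?thesis unfolding eq by (intro comp assms cf_comp[OF assms(1)] cf_comp[OF assms(2)])
qed

lemma cf_mult [comp]:
  assumes "computable_from g a" "computable_from g b"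
  shows "computable_from g (\<lambda>x. a x * b x)"
proof -
  have "n * m = rec_nat 0 (\<lambda>_ y. y + n) m" for n m :: nat
    by (induction m) auto
  then have eq: "a x * b x = rec_nat 0 (\<lambda>_ y. y + a x) (b x)" for x .
  show ?thesis unfolding eq by (intro comp assms cf_comp[OF assms(1)] cf_comp[OF assms(2)])
qed

lemma cf_power [comp]:
  assumes "computable_from g a" "computable_from g b"
  shows "computable_from g (\<lambda>x. a x ^ b x)"
proof -
  have "n ^ m = rec_nat 1 (\<lambda>_ y. y * n) m" for n m :: nat
    by (induction m) auto
  then have eq: "a x ^ b x = rec_nat 1 (\<lambda>_ y. y * a x) (b x)" for x .
  show ?thesis unfolding eq by (intro comp assms cf_comp[OF assms(1)] cf_comp[OF assms(2)])
qed

lemma cf_funpow [comp]: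
  assumes "computable_from g F" "computable_from g a" "computable_from g k"
  shows "computable_from g (\<lambda>x. (F ^^ k x) (a x))"
proof -
  have "(F ^^ n) y = rec_nat y (\<lambda>_ z. F z) n" for n y
    by (induction n) auto
  then have eq: "(F ^^ k x) (a x) = rec_nat (a x) (\<lambda>_ z. F z) (k x)" for x .
  show ?thesis unfolding eq by (intro comp assms cf_comp[OF assms(1)])
qed

section \<open>Predicates decidable from an oracle\<close>

definition dec :: "(nat \<Rightarrow> nat) \<Rightarrow> (nat \<Rightarrow> bool) \<Rightarrow> bool" where
  "dec g P \<longleftrightarrow> computable_from g (\<lambda>x. of_bool (P x))"

lemma cf_of_bool [comp]: "dec g P \<Longrightarrow> computable_from g (\<lambda>x. of_bool (P x))"
  by (simp add: dec_def)

lemma decI: "computable_from g f \<Longrightarrow> (\<And>x. of_bool (P x) = f x) \<Longrightarrow> dec g P"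
  by (simp add: dec_def)

lemma dec_const [comp]: "dec g (\<lambda>x. b)"
  unfolding dec_def by (rule comp)

lemma dec_not [comp]: "dec g P \<Longrightarrow> dec g (\<lambda>x. \<not> P x)"
  by (rule decI[of g "\<lambda>x. 1 - of_bool (P x)"]) (intro comp, simp, simp)

lemma dec_conj [comp]: "dec g P \<Longrightarrow> dec g Q \<Longrightarrow> dec g (\<lambda>x. P x \<and> Q x)"
  by (rule decI[of g "\<lambda>x. of_bool (P x) * of_bool (Q x)"]) (intro comp, simp_all)

lemma dec_disj [comp]: "dec g P \<Longrightarrow> dec g Q \<Longrightarrow> dec g (\<lambda>x. P x \<or> Q x)"
  by (rule decI[of g "\<lambda>x. of_bool (\<not> (\<not> P x \<and> \<not> Q x))"]) (intro comp, simp_all)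

lemma dec_imp [comp]: "dec g P \<Longrightarrow> dec g Q \<Longrightarrow> dec g (\<lambda>x. P x \<longrightarrow> Q x)"
  by (rule decI[of g "\<lambda>x. of_bool (\<not> P x \<or> Q x)"]) (intro comp, simp_all)

lemma dec_le [comp]:
  "computable_from g a \<Longrightarrow> computable_from g b \<Longrightarrow> dec g (\<lambda>x. a x \<le> b x)"
  by (rule decI[of g "\<lambda>x. 1 - (a x - b x)"]) (intro comp, simp_all)

lemma dec_less [comp]:
  "computable_from g a \<Longrightarrow> computable_from g b \<Longrightarrow> dec g (\<lambda>x. a x < b x)"
  by (rule decI[of g "\<lambda>x. of_bool (Suc (a x) \<le> b x)"]) (intro comp, simp_all add: Suc_le_eq)

lemma dec_eq [comp]:
  "computable_from g a \<Longrightarrow> computable_from g b \<Longrightarrow> dec g (\<lambda>x. a x = b x)"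
  by (rule decI[of g "\<lambda>x. of_bool (a x \<le> b x \<and> b x \<le> a x)"]) (intro comp, simp_all add: order_eq_iff)

lemma dec_if [comp]:
  "dec g P \<Longrightarrow> dec g Q \<Longrightarrow> dec g R \<Longrightarrow> dec g (\<lambda>x. if P x then Q x else R x)"
  by (rule decI[of g "\<lambda>x. of_bool ((P x \<longrightarrow> Q x) \<and> (\<not> P x \<longrightarrow> R x))"]) (intro comp, simp_all)

lemma cf_if [comp]:
  assumes "dec g P" "computable_from g a" "computable_from g b"
  shows "computable_from g (\<lambda>x. if P x then a x else b x)"
proof -
  have eq: "(if P x then a x else b x) = of_bool (P x) * a x + of_bool (\<not> P x) * b x" for x
    by simp
  show ?thesis unfolding eq by (intro comp assms)
qed

lemma dec_comp: "dec g P \<Longrightarrow> computable_from g a \<Longrightarrow> dec g (\<lambda>x. P (a x))"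
  unfolding dec_def by (rule cf_comp)

lemma dec_comp2:
  "dec g (\<lambda>y. P (pfst y) (psnd y)) \<Longrightarrow> computable_from g a \<Longrightarrow> computable_from g b
    \<Longrightarrow> dec g (\<lambda>x. P (a x) (b x))"
  unfolding dec_def by (rule cf_comp2)

lemma dec_ball [comp]:
  assumes "dec g (\<lambda>y. P (pfst y) (psnd y))" "computable_from g k"
  shows "dec g (\<lambda>x. \<forall>m<k x. P x m)"
proof (rule decI)
  have "of_bool (\<forall>m<n. P x m) = rec_nat (1::nat) (\<lambda>m y. y * of_bool (P x m)) n" for x n
    by (induction n) (auto simp: less_Suc_eq of_bool_def split: if_splits)
  then show "of_bool (\<forall>m<k x. P x m) = rec_nat (1::nat) (\<lambda>m y. y * of_bool (P x m)) (k x)" for x .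
  show "computable_from g (\<lambda>x. rec_nat 1 (\<lambda>m y. y * of_bool (P x m)) (k x))"
    by (intro comp assms dec_comp2[OF assms(1)])
qed

lemma dec_bex [comp]:
  assumes "dec g (\<lambda>y. P (pfst y) (psnd y))" "computable_from g k"
  shows "dec g (\<lambda>x. \<exists>m<k x. P x m)"
  by (rule decI[of g "\<lambda>x. of_bool (\<not> (\<forall>m<k x. \<not> P x m))"]) (intro comp assms, simp)

lemma dec_ball_le [comp]:
  assumes "dec g (\<lambda>y. P (pfst y) (psnd y))" "computable_from g k"
  shows "dec g (\<lambda>x. \<forall>m\<le>k x. P x m)"
  by (rule decI[of g "\<lambda>x. of_bool (\<forall>m<Suc (k x). P x m)"]) (intro comp assms, simp add: less_Suc_eq_le)

lemma dec_bex_le [comp]: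
  assumes "dec g (\<lambda>y. P (pfst y) (psnd y))" "computable_from g k"
  shows "dec g (\<lambda>x. \<exists>m\<le>k x. P x m)"
  by (rule decI[of g "\<lambda>x. of_bool (\<exists>m<Suc (k x). P x m)"]) (intro comp assms, simp add: less_Suc_eq_le)

lemma cf_Least:
  assumes "dec g (\<lambda>y. P (pfst y) (psnd y))" "\<And>x. \<exists>n. P x n"
  shows "computable_from g (\<lambda>x. LEAST n. P x n)"
proof -
  \<comment> \<open>\<open>Mu\<close> stops at the first zero, hence the negation.\<close>
  have "computable_from g (\<lambda>y. of_bool (\<not> P (pfst y) (psnd y)))"
    by (intro comp assms)
  then obtain c where c: "\<And>y. run g c y (of_bool (\<not> P (pfst y) (psnd y)))"
    by (auto simp: computable_from_iff)
  show ?thesis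
  proof (rule cf_run[of g "Mu c"], rule run.intros)
    fix x
    have "P x (LEAST n. P x n)" using assms(2) by (rule LeastI_ex)
    then show "run g c (pr x (LEAST n. P x n)) 0" using c[of "pr x (LEAST n. P x n)"] by simp
    show "\<forall>m<LEAST n. P x n. \<exists>y>0. run g c (pr x m) y"
    proof (intro allI impI exI[of _ 1] conjI)
      fix m assume "m < (LEAST n. P x n)"
      then have "\<not> P x m" by (rule not_less_Least)
      then show "run g c (pr x m) 1" using c[of "pr x m"] by simp
    qed simp
  qed
qed

text \<open>Replacing every call of \<open>Oracle\<close> by \<open>Zero\<close> makes a computation
  with the zero oracle available under any oracle.\<close>

lemma run_zero_oracle: "run (\<lambda>_. 0) c x y \<Longrightarrow> \<exists>c'. \<forall>x y. run (\<lambda>_. 0) c x y \<longrightarrow> run g c' x y"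
proof -
  define sub where "sub = rec_prog Zero Succ Fst Snd Zero (\<lambda>_ _. Pair) (\<lambda>_ _. Comp) (\<lambda>_ _. Rec) (\<lambda>_. Mu)"
  have "run (\<lambda>_. 0) c x y \<Longrightarrow> run g (sub c) x y" for c x y
    by (induction rule: run.induct) (auto simp: sub_def intro: run.intros)
  then show ?thesis by blast
qed

lemma cf_mono: "computable f \<Longrightarrow> computable_from g f"
  unfolding computable_def computable_from_iff by (metis run_zero_oracle)

lemma dec_mono: "dec (\<lambda>_. 0) P \<Longrightarrow> dec g P"
  using cf_mono unfolding dec_def computable_def by blast

section \<open>Coded lists\<close>

text \<open>The cells are those of \<open>list_encode\<close>. Both functions are total and
  \<open>ctl\<close> fixes 0, so iterating \<open>ctl\<close> past the end of a list is
  harmless.\<close>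

definition chd :: "nat \<Rightarrow> nat" where "chd l = pfst (l - 1)"
definition ctl :: "nat \<Rightarrow> nat" where "ctl l = (if l = 0 then 0 else psnd (l - 1))"
definition ccons :: "nat \<Rightarrow> nat \<Rightarrow> nat" where "ccons m i = Suc (pr m i)"

lemma cf_chd [comp]: "computable_from g a \<Longrightarrow> computable_from g (\<lambda>x. chd (a x))"
  unfolding chd_def One_nat_def by (intro comp)

lemma cf_ctl [comp]: "computable_from g a \<Longrightarrow> computable_from g (\<lambda>x. ctl (a x))"
  unfolding ctl_def One_nat_def by (intro comp)

lemma cf_ccons [comp]:
  "computable_from g a \<Longrightarrow> computable_from g b \<Longrightarrow> computable_from g (\<lambda>x. ccons (a x) (b x))"
  unfolding ccons_def by (intro comp)

lemma ccons_simps [simp]: "chd (ccons m i) = m" "ctl (ccons m i) = i" "ccons m i \<noteq> 0"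
    "ccons m i = ccons m' i' \<longleftrightarrow> m = m' \<and> i = i'"
  by (auto simp: chd_def ctl_def ccons_def prod_encode_eq)

lemma ctl_0 [simp]: "ctl 0 = 0" by (simp add: ctl_def)

lemma cconsE: assumes "l \<noteq> 0" obtains m i where "l = ccons m i"
  using assms by (metis ccons_def not0_implies_Suc pr_pfst_psnd)

lemma ccons_less: "i < ccons m i" "m < ccons m i"
  by (auto simp: ccons_def less_Suc_eq_le le_prod_encode_1 le_prod_encode_2)

lemma list_decode_ccons [simp]: "list_decode (ccons m i) = m # list_decode i"
  by (simp add: ccons_def)

lemma ctl_pow_list: "(ctl ^^ n) (list_encode l) = list_encode (drop n l)"
proof (induction n arbitrary: l)
  case (Suc n)
  have "ctl (list_encode l) = list_encode (tl l)"
    by (cases l) (auto simp: ctl_def)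
  then show ?case by (simp add: funpow_Suc_right drop_Suc Suc del: funpow.simps)
qed simp

lemma list_encode_eq_0: "list_encode l = 0 \<longleftrightarrow> l = []"
  by (cases l) auto

lemma length_le_list_encode: "length l \<le> list_encode l"
proof (induction l)
  case (Cons a l)
  then show ?case using le_prod_encode_2[of "list_encode l" a] by simp
qed simp

lemma chd_drop: "n < length l \<Longrightarrow> chd (list_encode (drop n l)) = l ! n"
  by (simp add: chd_def Cons_nth_drop_Suc[symmetric])

definition clen :: "nat \<Rightarrow> nat" where "clen x = length (list_decode x)"

lemma cf_clen [comp]:
  assumes "computable_from g a" shows "computable_from g (\<lambda>x. clen (a x))"
proof -
  have eq: "clen x = (LEAST n. (ctl ^^ n) x = 0)" for x
  proof -
    have "(ctl ^^ n) x = 0 \<longleftrightarrow> clen x \<le> n" for n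
      using ctl_pow_list[of n "list_decode x"] by (simp add: list_encode_eq_0 clen_def)
    then show ?thesis by (intro Least_equality[symmetric]) auto
  qed
  have "computable_from g clen"
    unfolding eq[abs_def]
  proof (rule cf_Least)
    show "\<exists>n. (ctl ^^ n) x = 0" for x
      using ctl_pow_list[of x "list_decode x"] length_le_list_encode[of "list_decode x"]
      by (intro exI[of _ x]) (simp add: list_encode_eq_0)
  qed (intro comp)
  then show ?thesis using assms by (rule cf_comp)
qed

definition cmem :: "nat \<Rightarrow> nat \<Rightarrow> bool" where "cmem f l \<longleftrightarrow> f \<in> set (list_decode l)"

lemma cmem_simps [simp]: "\<not> cmem f 0" "cmem f (ccons m l) \<longleftrightarrow> f = m \<or> cmem f l"
  by (auto simp: cmem_def)

lemma cmem_iff: "cmem f l \<longleftrightarrow> (\<exists>n<clen l. chd ((ctl ^^ n) l) = f)"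
  unfolding cmem_def in_set_conv_nth clen_def
  using chd_drop ctl_pow_list[of _ "list_decode l"] by auto

lemma dec_cmem [comp]:
  assumes "computable_from g a" "computable_from g b"
  shows "dec g (\<lambda>x. cmem (a x) (b x))"
  unfolding cmem_iff by (intro comp assms; (intro cf_comp[OF assms(1)] cf_comp[OF assms(2)])?; intro comp)

lemma cmem_less: "cmem f l \<Longrightarrow> f < l"
proof (induction l rule: less_induct)
  case (less l)
  show ?case
  proof (cases "l = 0")
    case False
    then obtain m i where l: "l = ccons m i" by (rule cconsE)
    with less show ?thesis using ccons_less[of i m] ccons_less(2)[of m i] by fastforce
  qed (use less.prems in simp)
qed

section \<open>Semidecidable predicates\<close>

text \<open>Introduced for \<open>just\<close>, whose rules have existential parameters that nobody
  wants to bound. Semidecidability is enough, since a search witness can be stored next to a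
  derivation.\<close>

definition semi :: "(nat \<Rightarrow> bool) \<Rightarrow> bool" where
  "semi P \<longleftrightarrow> (\<exists>Q. dec (\<lambda>_. 0) Q \<and> (\<forall>x. P x \<longleftrightarrow> (\<exists>w. Q (pr x w))))"

named_theorems semic

lemma semiE:
  assumes "semi P" obtains Q where "dec (\<lambda>_. 0) (\<lambda>y. Q (pfst y) (psnd y))" "P = (\<lambda>x. \<exists>w. Q x w)"
proof -
  obtain Q where Q: "dec (\<lambda>_. 0) Q" "\<forall>x. P x \<longleftrightarrow> (\<exists>w. Q (pr x w))"
    using assms by (auto simp: semi_def)
  show ?thesis by (rule that[of "\<lambda>x w. Q (pr x w)"]) (use Q in \<open>auto simp: fun_eq_iff\<close>)
qed

lemma semiI: "dec (\<lambda>_. 0) (\<lambda>y. Q (pfst y) (psnd y)) \<Longrightarrow> (\<And>x. P x \<longleftrightarrow> (\<exists>w. Q x w)) \<Longrightarrow> semi P"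
  unfolding semi_def by (rule exI[of _ "\<lambda>y. Q (pfst y) (psnd y)"]) auto

lemma semi_dec: "dec (\<lambda>_. 0) P \<Longrightarrow> semi P"
  by (rule semiI[of "\<lambda>x w. P x"]) (rule dec_comp, auto intro: comp)

lemma semi_Ex [semic]:
  assumes "semi (\<lambda>y. P (pfst y) (psnd y))" shows "semi (\<lambda>x. \<exists>n. P x n)"
proof -
  obtain Q where Q: "dec (\<lambda>_. 0) (\<lambda>y. Q (pfst y) (psnd y))"
      "(\<lambda>y. P (pfst y) (psnd y)) = (\<lambda>x. \<exists>w. Q x w)"
    using assms by (rule semiE)
  have P: "P a b \<longleftrightarrow> (\<exists>w. Q (pr a b) w)" for a b
    using fun_cong[OF Q(2), of "pr a b"] by simp
  show ?thesis
  proof (rule semiI)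
    show "(\<exists>n. P x n) \<longleftrightarrow> (\<exists>w. Q (pr x (pfst w)) (psnd w))" for x
      unfolding P by (metis pfst_pr psnd_pr)
  qed (intro dec_comp2[OF Q(1)] comp)
qed

lemma semi_conj [semic]:
  assumes "semi P" "semi P'" shows "semi (\<lambda>x. P x \<and> P' x)"
proof -
  obtain Q where Q: "dec (\<lambda>_. 0) (\<lambda>y. Q (pfst y) (psnd y))" "P = (\<lambda>x. \<exists>w. Q x w)"
    using assms(1) by (rule semiE)
  obtain Q' where Q': "dec (\<lambda>_. 0) (\<lambda>y. Q' (pfst y) (psnd y))" "P' = (\<lambda>x. \<exists>w. Q' x w)"
    using assms(2) by (rule semiE)
  show ?thesis
  proof (rule semiI)
    show "(P x \<and> P' x) \<longleftrightarrow> (\<exists>w. Q x (pfst w) \<and> Q' x (psnd w))" for x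
      unfolding Q(2) Q'(2) by (metis pfst_pr psnd_pr)
  qed (intro comp dec_comp2[OF Q(1)] dec_comp2[OF Q'(1)])
qed

lemma semi_disj [semic]:
  assumes "semi P" "semi P'" shows "semi (\<lambda>x. P x \<or> P' x)"
proof -
  obtain Q where Q: "dec (\<lambda>_. 0) (\<lambda>y. Q (pfst y) (psnd y))" "P = (\<lambda>x. \<exists>w. Q x w)"
    using assms(1) by (rule semiE)
  obtain Q' where Q': "dec (\<lambda>_. 0) (\<lambda>y. Q' (pfst y) (psnd y))" "P' = (\<lambda>x. \<exists>w. Q' x w)"
    using assms(2) by (rule semiE)
  show ?thesis
  proof (rule semiI)
    show "(P x \<or> P' x) \<longleftrightarrow> (\<exists>w. Q x w \<or> Q' x w)" for x
      unfolding Q(2) Q'(2) by blast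
  qed (intro comp dec_comp2[OF Q(1)] dec_comp2[OF Q'(1)])
qed

text \<open>The witnesses of finitely many instances are bounded by their maximum, so a single
  number \<open>w\<close> serves for all of them.\<close>

lemma semi_ball [semic]:
  assumes "semi (\<lambda>y. P (pfst y) (psnd y))" "computable_from (\<lambda>_. 0) k"
  shows "semi (\<lambda>x. \<forall>n<k x. P x n)"
proof -
  obtain Q where Q: "dec (\<lambda>_. 0) (\<lambda>y. Q (pfst y) (psnd y))"
      "(\<lambda>y. P (pfst y) (psnd y)) = (\<lambda>x. \<exists>w. Q x w)"
    using assms(1) by (rule semiE)
  have P: "P a b \<longleftrightarrow> (\<exists>w. Q (pr a b) w)" for a b
    using fun_cong[OF Q(2), of "pr a b"] by simp
  show ?thesis
  proof (rule semiI)
    show "(\<forall>n<k x. P x n) \<longleftrightarrow> (\<exists>w. \<forall>n<k x. \<exists>v\<le>w. Q (pr x n) v)" for x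
    proof
      assume "\<forall>n<k x. P x n"
      then obtain v where v: "\<And>n. n < k x \<Longrightarrow> Q (pr x n) (v n)" unfolding P by metis
      have "\<forall>n<k x. v n \<le> Max (v ` {..<k x})" by simp
      then show "\<exists>w. \<forall>n<k x. \<exists>v\<le>w. Q (pr x n) v" using v by blast
    qed (auto simp: P)
    show "dec (\<lambda>_. 0) (\<lambda>y. \<forall>n<k (pfst y). \<exists>v\<le>psnd y. Q (pr (pfst y) n) v)"
      by (intro comp dec_comp2[OF Q(1)] cf_comp[OF assms(2)])
  qed
qed

lemma semi_comp: "semi P \<Longrightarrow> computable_from (\<lambda>_. 0) a \<Longrightarrow> semi (\<lambda>x. P (a x))"
proof (erule semiE)
  fix Q assume a: "computable_from (\<lambda>_. 0) a" and Q: "dec (\<lambda>_. 0) (\<lambda>y. Q (pfst y) (psnd y))" "P = (\<lambda>x. \<exists>w. Q x w)"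
  show "semi (\<lambda>x. P (a x))"
    by (rule semiI[of "\<lambda>x w. Q (a x) w"]) (use Q in \<open>auto intro!: dec_comp2[OF Q(1)] comp cf_comp[OF a]\<close>)
qed

lemma semi_atomic [semic]:
  "computable_from (\<lambda>_. 0) a \<Longrightarrow> computable_from (\<lambda>_. 0) b \<Longrightarrow> semi (\<lambda>x. a x = b x)"
  "computable_from (\<lambda>_. 0) a \<Longrightarrow> computable_from (\<lambda>_. 0) b \<Longrightarrow> semi (\<lambda>x. a x < b x)"
  "computable_from (\<lambda>_. 0) a \<Longrightarrow> computable_from (\<lambda>_. 0) b \<Longrightarrow> semi (\<lambda>x. a x \<noteq> b x)"
  "computable_from (\<lambda>_. 0) a \<Longrightarrow> computable_from (\<lambda>_. 0) b \<Longrightarrow> semi (\<lambda>x. cmem (a x) (b x))"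
  by (intro semi_dec comp; assumption)+

section \<open>Lists whose entries justify each other\<close>

lemma list_code_induct [case_names zero ccons]:
  assumes "P 0" "\<And>m l. P l \<Longrightarrow> P (ccons m l)" shows "P l"
proof (induction l rule: less_induct)
  case (less l)
  show ?case
  proof (cases "l = 0")
    case False
    then obtain m i where l: "l = ccons m i" by (rule cconsE)
    with less assms(2) ccons_less(1) show ?thesis by blast
  qed (use assms(1) in simp)
qed

lemma clen_simps [simp]: "clen 0 = 0" "clen (ccons m l) = Suc (clen l)"
  by (simp_all add: clen_def)

text \<open>New entries are put in front, so the tail behind an entry is what was available when the
  entry was made. Deductions and evaluation lists both have this shape.\<close>

definition vlist :: "(nat \<Rightarrow> nat \<Rightarrow> bool) \<Rightarrow> nat \<Rightarrow> bool" where
  "vlist J l \<longleftrightarrow> (\<forall>n<clen l. J (chd ((ctl ^^ n) l)) ((ctl ^^ Suc n) l))"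

lemma vlist_0 [simp]: "vlist J 0"
  by (simp add: vlist_def)

lemma vlist_ccons [simp]: "vlist J (ccons m l) \<longleftrightarrow> J m l \<and> vlist J l"
  unfolding vlist_def clen_simps All_less_Suc2
  by (simp add: funpow_Suc_right del: funpow.simps(2))

lemma vlist_append:
  assumes mono: "\<And>f l l'. J f l \<Longrightarrow> (\<And>x. cmem x l \<Longrightarrow> cmem x l') \<Longrightarrow> J f l'"
    and "vlist J l" "vlist J m"
  shows "\<exists>n. vlist J n \<and> (\<forall>x. cmem x n \<longleftrightarrow> cmem x l \<or> cmem x m)"
  using \<open>vlist J l\<close>
proof (induction l rule: list_code_induct)
  case zero
  then show ?case using \<open>vlist J m\<close> by auto
next
  case (ccons f l)
  then obtain n where n: "vlist J n" "\<forall>x. cmem x n \<longleftrightarrow> cmem x l \<or> cmem x m" by auto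
  then have "vlist J (ccons f n)" using ccons.prems by (auto intro: mono)
  then show ?case using n(2) by (intro exI[of _ "ccons f n"]) auto
qed

lemma vlist_induct:
  assumes "vlist J l" "cmem f l"
    and step: "\<And>f m. J f m \<Longrightarrow> (\<And>x. cmem x m \<Longrightarrow> cmem x l) \<Longrightarrow> (\<And>x. cmem x m \<Longrightarrow> Q x) \<Longrightarrow> cmem f l \<Longrightarrow> Q f"
  shows "Q f"
proof -
  have "\<forall>f. cmem f m \<longrightarrow> Q f" if "vlist J m" "\<forall>x. cmem x m \<longrightarrow> cmem x l" for m
    using that
  proof (induction m rule: list_code_induct)
    case (ccons a m)
    then show ?case using step[of a m] by auto
  qed simp
  then show ?thesis using assms(1,2) by blast
qed

lemma dec_vlist [comp]:
  assumes "dec g (\<lambda>y. J (pfst y) (psnd y))" "computable_from g a"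
  shows "dec g (\<lambda>x. vlist J (a x))"
proof -
  have "dec g (vlist J)"
    unfolding vlist_def[abs_def] funpow.simps o_def
    by (intro comp dec_comp2[OF assms(1)])
  then show ?thesis using assms(2) by (rule dec_comp)
qed

lemma semi_vlist:
  assumes "semi (\<lambda>y. J (pfst y) (psnd y))" shows "semi (vlist J)"
proof -
  have *: "semi (\<lambda>y. J (chd ((ctl ^^ psnd y) (pfst y))) (ctl ((ctl ^^ psnd y) (pfst y))))"
  proof -
    have "computable_from (\<lambda>_. 0) (\<lambda>y. pr (chd ((ctl ^^ psnd y) (pfst y))) (ctl ((ctl ^^ psnd y) (pfst y))))"
      by (intro comp)
    from semi_comp[OF assms this] show ?thesis by (simp only: pfst_pr psnd_pr)
  qed
  show ?thesis
    unfolding vlist_def[abs_def] funpow.simps o_def by (intro semic comp *)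
qed

text \<open>The fold becomes an iteration on pairs of the current state and the rest of the list.
  This is what makes the label of a tree computable from the node.\<close>

lemma cf_foldl [comp]:
  assumes F: "computable_from g (\<lambda>y. F (pfst y) (psnd y))"
    and a: "computable_from g a" and l: "computable_from g l"
  shows "computable_from g (\<lambda>x. foldl F (a x) (list_decode (l x)))"
proof -
  define S where "S y = pr (F (pfst y) (chd (psnd y))) (ctl (psnd y))" for y
  have "(S ^^ clen m) (pr s m) = pr (foldl F s (list_decode m)) 0" for s m
    by (induction m arbitrary: s rule: list_code_induct)
      (simp_all add: S_def funpow_Suc_right del: funpow.simps)
  then have eq: "foldl F (a x) (list_decode (l x)) = pfst ((S ^^ clen (l x)) (pr (a x) (l x)))" for x
    by simp
  have "computable_from g S"
    unfolding S_def[abs_def] by (intro comp cf_comp2[OF F])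
  then show ?thesis unfolding eq by (intro comp a l)
qed

section \<open>Ordered partitions\<close>

text \<open>Comparing least elements of blocks amounts to a condition on single positions. It no
  longer mentions \<open>LEAST\<close> and can be checked on a finite list.\<close>

lemma ordered_surj_iff:
  "ordered_surj S K p \<longleftrightarrow> p ` S = K \<and> (\<forall>n\<in>S. \<forall>i\<in>K. i < p n \<longrightarrow> (\<exists>m\<in>S. m < n \<and> p m = i))"
proof -
  have "(\<forall>i\<in>K. \<forall>j\<in>K. i < j \<longrightarrow> (LEAST n. n \<in> S \<and> p n = i) < (LEAST n. n \<in> S \<and> p n = j))
      \<longleftrightarrow> (\<forall>n\<in>S. \<forall>i\<in>K. i < p n \<longrightarrow> (\<exists>m\<in>S. m < n \<and> p m = i))" if K: "p ` S = K"
  proof (intro iffI ballI impI)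
    fix n i
    assume A: "\<forall>i\<in>K. \<forall>j\<in>K. i < j \<longrightarrow> (LEAST n. n \<in> S \<and> p n = i) < (LEAST n. n \<in> S \<and> p n = j)"
      and n: "n \<in> S" "i \<in> K" "i < p n"
    have "(LEAST m. m \<in> S \<and> p m = i) < (LEAST m. m \<in> S \<and> p m = p n)" using A n K by blast
    also have "\<dots> \<le> n" using n by (intro Least_le) simp
    finally have "(LEAST m. m \<in> S \<and> p m = i) < n" .
    moreover have "(LEAST m. m \<in> S \<and> p m = i) \<in> S \<and> p (LEAST m. m \<in> S \<and> p m = i) = i"
      by (rule LeastI_ex) (use n K in blast)
    ultimately show "\<exists>m\<in>S. m < n \<and> p m = i" by blast
  next
    fix i j
    assume A: "\<forall>n\<in>S. \<forall>i\<in>K. i < p n \<longrightarrow> (\<exists>m\<in>S. m < n \<and> p m = i)" and ij: "i \<in> K" "j \<in> K" "i < j"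
    let ?j = "LEAST n. n \<in> S \<and> p n = j"
    have "?j \<in> S \<and> p ?j = j" by (rule LeastI_ex) (use ij K in blast)
    then obtain m where "m \<in> S" "m < ?j" "p m = i" using A ij by metis
    moreover from this have "(LEAST n. n \<in> S \<and> p n = i) \<le> m" by (intro Least_le) simp
    ultimately show "(LEAST n. n \<in> S \<and> p n = i) < ?j" by linarith
  qed
  then show ?thesis unfolding ordered_surj_def by blast
qed

definition mu :: "(nat \<Rightarrow> nat) \<Rightarrow> nat \<Rightarrow> nat" where "mu p i = (LEAST n. p n = i)"

lemma mu_eq: "p n = i \<Longrightarrow> (\<And>m. m < n \<Longrightarrow> p m \<noteq> i) \<Longrightarrow> mu p i = n"
  unfolding mu_def by (rule Least_equality) (simp, metis leI)

lemma mu_props: "i \<in> range p \<Longrightarrow> p (mu p i) = i" "m < mu p i \<Longrightarrow> p m \<noteq> i"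
  unfolding mu_def by (auto intro: LeastI dest: not_less_Least)

lemma inf_partitions_props:
  assumes "p \<in> inf_partitions"
  shows "p (mu p i) = i" "i < p n \<Longrightarrow> mu p i < n" "i < j \<Longrightarrow> mu p i < mu p j" "i \<le> mu p i"
proof -
  have r: "range p = UNIV" and o: "\<And>n i. i < p n \<Longrightarrow> \<exists>m<n. p m = i"
    using assms unfolding inf_partitions_def ordered_surj_iff by auto
  show 1: "p (mu p i) = i" for i by (rule mu_props) (simp add: r)
  show 2: "\<And>i n. i < p n \<Longrightarrow> mu p i < n"
  proof -
    fix i n assume "i < p n"
    then obtain m where "m < n" "p m = i" using o by blast
    moreover from this have "mu p i \<le> m" unfolding mu_def by (intro Least_le) simp
    ultimately show "mu p i < n" by simp
  qed
  show 3: "i < j \<Longrightarrow> mu p i < mu p j" for i j using 2[of i "mu p j"] 1[of j] by simp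
  show "i \<le> mu p i"
  proof (induction i)
    case (Suc i)
    then show ?case using 3[of i "Suc i"] by simp
  qed simp
qed

lemma coarsening_exists:
  assumes p: "p \<in> inf_partitions" and ij: "0 < i" "i < j" and k: "k \<ge> 3"
  shows "\<exists>x\<in>coarsenings k p. mu x 1 = mu p i \<and> mu x 2 = mu p j"
proof -
  note P = inf_partitions_props[OF p]
  \<comment> \<open>Blocks before \<open>i\<close> and between \<open>i\<close> and \<open>j\<close>
    are merged into block 0. From \<open>j\<close> on, the blocks are numbered 2, 3, ... until the
    last number \<open>k - 1\<close>, which takes all the rest; \<open>k \<ge> 3\<close> keeps
    \<open>j\<close> itself at 2.\<close>
  define y where "y t = (if t < i then 0 else if t = i then 1 else if t < j then 0
    else min (t - j + 2) (k - 1))" for t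
  have yi: "y i = 1" "y j = 2" "y 0 = 0" using ij k by (auto simp: y_def)
  have lt: "y t < k" for t using k by (auto simp: y_def min_def)
  have big: "y (j + (v - 2)) = v" if "2 \<le> v" "v < k" for v using that ij by (auto simp: y_def)
  have "y ` UNIV = {..<k}"
  proof
    show "{..<k} \<subseteq> range y"
    proof
      fix v assume "v \<in> {..<k}"
      then consider "v = 0" | "v = 1" | "2 \<le> v" "v < k" by fastforce
      then show "v \<in> range y" by cases (use yi big in \<open>auto intro: range_eqI[OF sym]\<close>)
    qed
  qed (use lt in auto)
  moreover have "\<exists>m<n. y m = v" if "v < y n" for n v
  proof -
    have n: "y n > 0" using that by simp
    consider "v = 0" | "v = 1" | "2 \<le> v" by linarith
    then show ?thesis
    proof cases
      case 1
      have "n \<noteq> 0" using n yi by (metis less_irrefl)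
      then show ?thesis using 1 yi by (intro exI[of _ 0]) simp
    next
      case 2
      then have "i < n" using that ij by (auto simp: y_def split: if_splits)
      then show ?thesis using 2 yi by (intro exI[of _ i]) simp
    next
      case 3
      then have "j + (v - 2) < n" "v < k" using that k by (auto simp: y_def split: if_splits)
      then show ?thesis using 3 big by blast
    qed
  qed
  ultimately have y: "y \<in> partitions k" unfolding partitions_def ordered_surj_iff by auto
  have ne1: "y t \<noteq> 1" if "t < i" for t using that by (simp add: y_def)
  have ne2: "y t \<noteq> 2" if "t < j" for t using that by (simp add: y_def)
  have "mu (y \<circ> p) 1 = mu p i"
  proof (rule mu_eq)
    fix m assume "m < mu p i"
    then have "p m < i" using P(2)[of i m] mu_props(2)[of m p i] by (cases "p m" i rule: linorder_cases) auto
    then show "(y \<circ> p) m \<noteq> 1" using ne1 by simp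
  qed (use P yi in simp)
  moreover have "mu (y \<circ> p) 2 = mu p j"
  proof (rule mu_eq)
    fix m assume "m < mu p j"
    then have "p m < j" using P(2)[of j m] mu_props(2)[of m p j] by (cases "p m" j rule: linorder_cases) auto
    then show "(y \<circ> p) m \<noteq> 2" using ne2 by simp
  qed (use P yi in simp)
  ultimately show ?thesis using y unfolding coarsenings_def by blast
qed

text \<open>\<open>part_at k s a b\<close>: the list coded by \<open>s\<close> is in \<open>(<\<omega>)^k\<close>, and its blocks 1 and 2 have the
  least elements \<open>a\<close> and \<open>b\<close>.\<close>

definition cnth :: "nat \<Rightarrow> nat \<Rightarrow> nat" where "cnth s n = chd ((ctl ^^ n) s)"

lemma cf_cnth [comp]:
  "computable_from g a \<Longrightarrow> computable_from g b \<Longrightarrow> computable_from g (\<lambda>x. cnth (a x) (b x))"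
  unfolding cnth_def by (intro comp)

lemma cnth_nth: "n < clen s \<Longrightarrow> cnth s n = list_decode s ! n"
  using chd_drop[of n "list_decode s"] ctl_pow_list[of n "list_decode s"]
  by (simp add: cnth_def clen_def)

definition part_at :: "nat \<Rightarrow> nat \<Rightarrow> nat \<Rightarrow> nat \<Rightarrow> bool" where
  "part_at k s a b \<longleftrightarrow> (\<forall>n<clen s. cnth s n < k \<and> (\<forall>i<cnth s n. \<exists>m<n. cnth s m = i))
     \<and> (\<forall>i<k. \<exists>n<clen s. cnth s n = i)
     \<and> a < clen s \<and> cnth s a = 1 \<and> (\<forall>n<a. cnth s n \<noteq> 1)
     \<and> b < clen s \<and> cnth s b = 2 \<and> (\<forall>n<b. cnth s n \<noteq> 2)"

lemma dec_part_at [comp]: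
  assumes "computable_from g s" "computable_from g a" "computable_from g b"
  shows "dec g (\<lambda>x. part_at k (s x) (a x) (b x))"
  unfolding part_at_def
  by (intro comp assms cf_comp[OF assms(1)] cf_comp[OF assms(2)] cf_comp[OF assms(3)])

lemma part_at_fin: "part_at k s a b \<Longrightarrow> list_decode s \<in> fin_partitions k"
proof -
  assume *: "part_at k s a b"
  have eq: "list_decode s ! n = cnth s n" if "n < clen s" for n using that by (simp add: cnth_nth)
  have "(!) (list_decode s) ` {..<clen s} = {..<k}"
    using * unfolding part_at_def by (auto simp: eq image_iff)
  moreover have "\<exists>m\<in>{..<clen s}. m < n \<and> list_decode s ! m = i"
    if n: "n < clen s" and i: "i < list_decode s ! n" for n i
  proof -
    obtain m where "m < n" "cnth s m = i" using * i n unfolding part_at_def by (auto simp: eq)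
    then show ?thesis using n eq[of m] by (intro bexI[of _ m]) auto
  qed
  ultimately show ?thesis
    unfolding fin_partitions_def ordered_surj_iff by (auto simp: clen_def[symmetric])
qed

lemma part_at_mu:
  assumes "part_at k s a b" "p \<in> cylinder k (list_decode s)"
  shows "mu p 1 = a" "mu p 2 = b"
proof -
  have e: "p n = cnth s n" if "n < clen s" for n
    using that assms(2) unfolding cylinder_def by (simp add: cnth_nth clen_def)
  show "mu p 1 = a" "mu p 2 = b"
    using assms(1) unfolding part_at_def by (auto intro!: mu_eq simp: e)
qed

lemma part_at_exists:
  assumes p: "p \<in> partitions k" and k: "k \<ge> 3"
  shows "\<exists>s. part_at k s (mu p 1) (mu p 2) \<and> p \<in> cylinder k (list_decode s)"
proof -
  have r: "range p = {..<k}" and o: "\<And>n i. i < k \<Longrightarrow> i < p n \<Longrightarrow> \<exists>m<n. p m = i"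
    using p unfolding partitions_def ordered_surj_iff by auto
  \<comment> \<open>Beyond the least elements of all blocks, so that the initial segment is already
    a finite partition into \<open>k\<close> blocks.\<close>
  define N where "N = Suc (Max (mu p ` {..<k}))"
  have N: "mu p i < N" if "i < k" for i using that unfolding N_def by (simp add: less_Suc_eq_le)
  have P: "p (mu p i) = i" if "i < k" for i by (rule mu_props(1)) (simp add: r that)
  define s where "s = list_encode (map p [0..<N])"
  have len: "clen s = N" by (simp add: s_def clen_def)
  have nth: "cnth s n = p n" if "n < N" for n
    using that cnth_nth[of n s] by (simp add: len) (simp add: s_def)
  have lt: "p n < k" for n using r by blast
  have "part_at k s (mu p 1) (mu p 2)"
    unfolding part_at_def len
  proof (intro conjI allI impI)
    fix n i assume "n < N" "i < cnth s n"
    then obtain m where "m < n" "p m = i" using o[of i n] lt[of n] by (auto simp: nth)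
    with \<open>n < N\<close> show "\<exists>m<n. cnth s m = i" by (intro exI[of _ m]) (simp add: nth)
  next
    fix i assume "i < k"
    then show "\<exists>n<N. cnth s n = i" by (intro exI[of _ "mu p i"]) (simp add: N P nth)
  next
    fix n assume "n < mu p 1"
    moreover have "mu p 1 < N" using N[of 1] k by simp
    ultimately show "cnth s n \<noteq> 1" using nth mu_props(2) by simp
  next
    fix n assume "n < mu p 2"
    moreover have "mu p 2 < N" using N[of 2] k by simp
    ultimately show "cnth s n \<noteq> 2" using nth mu_props(2) by simp
  qed (use N[of 1] N[of 2] P[of 1] P[of 2] k in \<open>simp_all add: nth lt\<close>)
  moreover have "p \<in> cylinder k (list_decode s)"
    using p by (simp add: cylinder_def s_def)
  ultimately show ?thesis by blast
qed

section \<open>Alternating systems\<close>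

text \<open>The interface between jumps and colouring. A \<open>Z\<close> with
  \<open>valid Z\<close> stands for a finite conjunction of negative literals, where
  \<open>neg Z u\<close> means that the atom \<open>u\<close> is denied. \<open>cert u Z\<close>
  says that this conjunction suffices for \<open>u\<close>, and \<open>inv Z u\<close> is evidence
  that \<open>u\<close> is no admissible atom. \<open>bnd u \<delta>\<close> bounds the level of the
  truth value \<open>T u\<close>. Only the relations between codes have to be decidable.\<close>

locale alternating =
  fixes valid :: "nat \<Rightarrow> bool" and neg cert inv :: "nat \<Rightarrow> nat \<Rightarrow> bool" and ok :: "nat \<Rightarrow> bool"
    and bnd :: "nat \<Rightarrow> 'o::wellorder \<Rightarrow> bool" and T :: "nat \<Rightarrow> bool" and \<alpha> :: 'o
  assumes dec_valid0: "dec (\<lambda>_. 0) valid"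
    and dec_neg0: "dec (\<lambda>_. 0) (\<lambda>y. neg (pfst y) (psnd y))"
    and dec_cert0: "dec (\<lambda>_. 0) (\<lambda>y. cert (pfst y) (psnd y))"
    and dec_inv0: "dec (\<lambda>_. 0) (\<lambda>y. inv (pfst y) (psnd y))"
    and neg_le: "neg Z u \<Longrightarrow> u \<le> Z"
    and cert_valid: "cert u Z \<Longrightarrow> valid Z"
    and neg_ok: "valid Z \<Longrightarrow> neg Z u \<Longrightarrow> ok u"
    and empty_ex: "\<exists>Z. valid Z \<and> (\<forall>u. \<not> neg Z u)"
    and union_ex: "valid Z \<Longrightarrow> valid Z' \<Longrightarrow> \<exists>Y. valid Y \<and> (\<forall>u. neg Y u \<longleftrightarrow> neg Z u \<or> neg Z' u)
        \<and> (\<forall>u. inv Z u \<or> inv Z' u \<longrightarrow> inv Y u)"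
    and assume_ex: "ok u \<Longrightarrow> \<exists>Z. valid Z \<and> (\<forall>v. neg Z v \<longleftrightarrow> v = u)"
    and inv_ex: "\<not> ok u \<Longrightarrow> \<exists>Z. valid Z \<and> inv Z u \<and> (\<forall>v. \<not> neg Z v)"
    and inv_ok: "valid Z \<Longrightarrow> inv Z u \<Longrightarrow> \<not> ok u"
    and T_iff: "T u \<longleftrightarrow> (\<exists>Z. cert u Z \<and> (\<forall>v. neg Z v \<longrightarrow> \<not> T v))"
    and bnd_cert: "bnd u \<delta> \<Longrightarrow> cert u Z \<Longrightarrow> neg Z v \<Longrightarrow> \<exists>\<epsilon><\<delta>. bnd v \<epsilon>"
    and bnd_mono: "bnd u \<delta> \<Longrightarrow> \<delta> \<le> \<epsilon> \<Longrightarrow> bnd u \<epsilon>"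
    and bnd_nonzero: "bnd u \<delta> \<Longrightarrow> \<not> is_zero \<delta>"
    and bnd_ok: "ok u \<Longrightarrow> \<exists>\<delta><\<alpha>. bnd u \<delta>"
    and alpha_nonzero: "\<not> is_zero \<alpha>"
begin

lemmas dec_system [comp] =
  dec_comp[OF dec_mono[OF dec_valid0]] dec_comp2[OF dec_mono[OF dec_neg0]]
  dec_comp2[OF dec_mono[OF dec_cert0]] dec_comp2[OF dec_mono[OF dec_inv0]]

section \<open>Borel codes for the truth value of a conjunction\<close>

definition NEG :: "nat \<Rightarrow> bool" where "NEG Z \<longleftrightarrow> (\<forall>u. neg Z u \<longrightarrow> \<not> T u)"
definition hasneg :: "nat \<Rightarrow> bool" where "hasneg Z \<longleftrightarrow> (\<exists>u\<le>Z. neg Z u)"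
definition child :: "nat \<Rightarrow> nat \<Rightarrow> bool" where "child Z Y \<longleftrightarrow> (\<exists>u\<le>Z. neg Z u \<and> cert u Y)"

lemma dec_hasneg [comp]: "computable_from g a \<Longrightarrow> dec g (\<lambda>x. hasneg (a x))"
  by (rule dec_comp[of g hasneg], unfold hasneg_def, intro comp)

lemma dec_child [comp]:
  "computable_from g a \<Longrightarrow> computable_from g b \<Longrightarrow> dec g (\<lambda>x. child (a x) (b x))"
  by (rule dec_comp2[of g child], unfold child_def, intro comp)

lemma hasneg_iff: "hasneg Z \<longleftrightarrow> (\<exists>u. neg Z u)"
  unfolding hasneg_def using neg_le by blast

lemma child_iff: "child Z Y \<longleftrightarrow> (\<exists>u. neg Z u \<and> cert u Y)"
  unfolding child_def using neg_le by blast

lemma T_NEG: "T u \<longleftrightarrow> (\<exists>Z. cert u Z \<and> NEG Z)"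
  unfolding NEG_def by (rule T_iff)

lemma NEG_iff: "NEG Z \<longleftrightarrow> \<not> (\<exists>Y. child Z Y \<and> NEG Y)"
proof -
  have "NEG Z \<longleftrightarrow> (\<forall>u. neg Z u \<longrightarrow> \<not> (\<exists>Y. cert u Y \<and> NEG Y))"
    by (simp only: NEG_def[of Z] T_NEG)
  then show ?thesis by (auto simp: child_iff)
qed

text \<open>By \<open>neg_le\<close> the conjunction is finite, so the levels of its atoms have a
  maximum, which is still below \<open>\<delta>\<close>. \<open>hasneg\<close> makes the set
  nonempty for \<open>Max\<close>.\<close>

lemma common_bound:
  assumes "\<And>v. neg Z v \<Longrightarrow> \<exists>\<epsilon><\<delta>. bnd v \<epsilon>" "hasneg Z"
  shows "\<exists>\<epsilon><\<delta>. \<forall>v. neg Z v \<longrightarrow> bnd v \<epsilon>"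
proof -
  obtain e where e: "\<And>v. neg Z v \<Longrightarrow> e v < \<delta> \<and> bnd v (e v)" using assms(1) by metis
  define N where "N = {v. neg Z v}"
  have N: "finite N" "N \<noteq> {}"
    using assms(2) finite_subset[of N "{..Z}"] neg_le by (auto simp: N_def hasneg_iff)
  have "Max (e ` N) < \<delta>" using N e by (simp add: N_def)
  moreover have "bnd v (Max (e ` N))" if "neg Z v" for v
    using bnd_mono[of v "e v"] e[OF that] N that by (simp add: N_def)
  ultimately show ?thesis by blast
qed

text \<open>States of the tree walk: 0 is outside of the tree, 1 and 2 are leaves for false and true,
  and \<open>3 + pr b Z\<close> is an intersection node for \<open>NEG Z\<close> if \<open>b = 0\<close>, and a union node for its
  negation if \<open>b = 1\<close>. An empty set of negative literals becomes a leaf at once; this keeps the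
  code at its level.\<close>

definition state :: "nat \<Rightarrow> nat \<Rightarrow> nat" where
  "state b Z = (if hasneg Z then 3 + pr b Z else if b = 0 then 2 else 1)"

text \<open>An index that is not a child leads to the neutral leaf: true below an intersection,
  false below a union. So every inner node has all numbers as successors.\<close>

definition step :: "nat \<Rightarrow> nat \<Rightarrow> nat" where
  "step s m = (if s < 3 then 0 else if child (psnd (s - 3)) m then state (1 - pfst (s - 3)) m
     else if pfst (s - 3) = 0 then 2 else 1)"

definition lab :: "label \<Rightarrow> label \<Rightarrow> nat \<Rightarrow> label option" where
  "lab t f s = (if s = 0 then None else if s = 1 then Some f else if s = 2 then Some t
     else if pfst (s - 3) = 0 then Some Inter_Label else Some Union_Label)"

text \<open>The labels of true and false leaves are parameters. A cylinder placed at the true leaves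
  restricts the whole set to this cylinder, with no extra intersection node that would cost a
  level.\<close>

definition tree :: "label \<Rightarrow> label \<Rightarrow> nat \<Rightarrow> labeled_tree" where
  "tree t f s = (\<lambda>l. lab t f (foldl step s l))"

lemma cf_state [comp]:
  "computable_from g a \<Longrightarrow> computable_from g b \<Longrightarrow> computable_from g (\<lambda>x. state (a x) (b x))"
  by (rule cf_comp2[of g state], unfold state_def, intro comp)

lemma cf_step [comp]:
  "computable_from g a \<Longrightarrow> computable_from g b \<Longrightarrow> computable_from g (\<lambda>x. step (a x) (b x))"
  by (rule cf_comp2[of g step], unfold step_def, intro comp)

lemma subtree_tree: "subtree (tree t f s) n = tree t f (step s n)"
  by (simp add: subtree_def tree_def)

lemma foldl_step_0: "foldl step 0 l = 0"
  by (induction l) (simp_all add: step_def)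

lemma tree_leaf: "tree t f 1 = [[] \<mapsto> f]" "tree t f 2 = [[] \<mapsto> t]"
proof -
  have "tree t f s l = None" if "s < 3" "l \<noteq> []" for s l
    using that by (cases l) (auto simp: tree_def step_def foldl_step_0 lab_def)
  then show "tree t f 1 = [[] \<mapsto> f]" "tree t f 2 = [[] \<mapsto> t]"
    by (auto simp: fun_eq_iff tree_def lab_def)
qed

lemma step_node: "step (3 + pr b Z) m = (if child Z m then state (1 - b) m else if b = 0 then 2 else 1)"
  by (simp add: step_def)

lemma step_dom: "[n] \<in> dom (tree t f (3 + pr b Z))"
  by (auto simp: tree_def step_node lab_def state_def)

lemma zero_ex: "\<not> is_zero (\<delta>::'o) \<Longrightarrow> \<exists>\<zeta><\<delta>. is_zero \<zeta>"
  using Least_le[of "\<lambda>_::'o. True"] unfolding is_zero_def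
  by (intro exI[of _ "LEAST _::'o. True"]) (auto simp: not_le intro: le_less_trans)

text \<open>Because of \<open>Sf \<subseteq> St\<close>, unions and intersections of copies of these
  two sets act like disjunctions and conjunctions of truth values, and \<open>NEG_iff\<close>
  becomes the alternation of labels. The levels decrease by \<open>bnd_cert\<close>; an empty
  conjunction is a leaf at level zero.\<close>

lemma tree_codes:
  assumes S: "clopen_label k t St" "clopen_label k f Sf" "Sf \<subseteq> St" "St \<subseteq> partitions k"
    and b: "\<And>v. neg Z v \<Longrightarrow> bnd v \<delta>" "hasneg Z"
  shows "sigma_code k \<delta> (tree t f (3 + pr 1 Z)) (if NEG Z then Sf else St)
       \<and> pi_code k \<delta> (tree t f (3 + pr 0 Z)) (if NEG Z then St else Sf)"
  using b
proof (induction \<delta> arbitrary: Z rule: less_induct)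
  case (less \<delta>)
  have nz: "\<not> is_zero \<delta>" using less.prems bnd_nonzero hasneg_iff by blast
  obtain \<zeta> where \<zeta>: "\<zeta> < \<delta>" "is_zero \<zeta>" using zero_ex[OF nz] by blast
  have sub: "\<exists>\<epsilon><\<delta>. sigma_code k \<epsilon> (tree t f (state 1 n)) (if NEG n then Sf else St)"
       "\<exists>\<epsilon><\<delta>. pi_code k \<epsilon> (tree t f (state 0 n)) (if NEG n then St else Sf)"
    if c: "child Z n" for n
  proof -
    have "(\<exists>\<epsilon><\<delta>. sigma_code k \<epsilon> (tree t f (state 1 n)) (if NEG n then Sf else St)) \<and>
       (\<exists>\<epsilon><\<delta>. pi_code k \<epsilon> (tree t f (state 0 n)) (if NEG n then St else Sf))"
    proof (cases "hasneg n")
      case True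
      have "\<exists>\<epsilon><\<delta>. bnd v \<epsilon>" if "neg n v" for v
        using c that less.prems(1) bnd_cert unfolding child_iff by blast
      then obtain \<epsilon> where "\<epsilon> < \<delta>" "\<forall>v. neg n v \<longrightarrow> bnd v \<epsilon>"
        using common_bound[OF _ True] by blast
      then show ?thesis using less.IH[of \<epsilon> n] True by (auto simp: state_def)
    next
      case False
      then have "NEG n" by (simp add: NEG_def hasneg_iff)
      moreover have "tree t f (state 1 n) = [[] \<mapsto> f]" "tree t f (state 0 n) = [[] \<mapsto> t]"
        using False tree_leaf by (simp_all add: state_def)
      ultimately show ?thesis using \<zeta> S(1,2) by (auto intro: sigma_leaf pi_leaf)
    qed
    then show "\<exists>\<epsilon><\<delta>. sigma_code k \<epsilon> (tree t f (state 1 n)) (if NEG n then Sf else St)"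
       "\<exists>\<epsilon><\<delta>. pi_code k \<epsilon> (tree t f (state 0 n)) (if NEG n then St else Sf)" by auto
  qed
  \<comment> \<open>Non-children contribute the neutral set; by \<open>NEG_iff\<close> some child
    contributes the other one if and only if \<open>NEG Z\<close> fails.\<close>
  have St: "{x \<in> partitions k. \<exists>n. [n] \<in> dom (tree t f (3 + pr 1 Z))
        \<and> x \<in> (if child Z n \<and> NEG n then St else Sf)} = (if NEG Z then Sf else St)"
    using S(3,4) NEG_iff[of Z] step_dom by auto
  have Sf: "{x \<in> partitions k. \<forall>n. [n] \<in> dom (tree t f (3 + pr 0 Z))
        \<longrightarrow> x \<in> (if child Z n \<and> NEG n then Sf else St)} = (if NEG Z then St else Sf)"
    using S(3,4) NEG_iff[of Z] step_dom by (auto split: if_splits)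
  have root: "tree t f (3 + pr 1 Z) [] = Some Union_Label" "tree t f (3 + pr 0 Z) [] = Some Inter_Label"
    by (simp_all add: tree_def lab_def)
  have "sigma_code k \<delta> (tree t f (3 + pr 1 Z)) (if NEG Z then Sf else St)"
    unfolding St[symmetric]
  proof (rule sigma_node[where A = "\<lambda>n. if child Z n \<and> NEG n then St else Sf"],
      fact nz, fact root(1); intro allI impI)
    fix n assume "[n] \<notin> dom (tree t f (3 + pr 1 Z))"
    then show "subtree (tree t f (3 + pr 1 Z)) n = Map.empty" using step_dom by blast
  next
    fix n assume "[n] \<in> dom (tree t f (3 + pr 1 Z))"
    show "\<exists>\<epsilon><\<delta>. sigma_code k \<epsilon> (subtree (tree t f (3 + pr 1 Z)) n) (if child Z n \<and> NEG n then St else Sf)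
        \<or> pi_code k \<epsilon> (subtree (tree t f (3 + pr 1 Z)) n) (if child Z n \<and> NEG n then St else Sf)"
    proof (cases "child Z n")
      case True
      then show ?thesis using sub(2)[OF True] by (auto simp: subtree_tree step_node)
    next
      case False
      then show ?thesis using \<zeta> sigma_leaf[OF \<zeta>(2) S(2)]
        by (auto simp: subtree_tree step_node tree_leaf tree_leaf(1)[unfolded One_nat_def])
    qed
  qed
  moreover have "pi_code k \<delta> (tree t f (3 + pr 0 Z)) (if NEG Z then St else Sf)"
    unfolding Sf[symmetric]
  proof (rule pi_node[where A = "\<lambda>n. if child Z n \<and> NEG n then Sf else St"],
      fact nz, fact root(2); intro allI impI)
    fix n assume "[n] \<notin> dom (tree t f (3 + pr 0 Z))"
    then show "subtree (tree t f (3 + pr 0 Z)) n = Map.empty" using step_dom by blast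
  next
    fix n assume "[n] \<in> dom (tree t f (3 + pr 0 Z))"
    show "\<exists>\<epsilon><\<delta>. sigma_code k \<epsilon> (subtree (tree t f (3 + pr 0 Z)) n) (if child Z n \<and> NEG n then Sf else St)
        \<or> pi_code k \<epsilon> (subtree (tree t f (3 + pr 0 Z)) n) (if child Z n \<and> NEG n then Sf else St)"
    proof (cases "child Z n")
      case True
      then show ?thesis using sub(1)[OF True] by (auto simp: subtree_tree step_node)
    next
      case False
      then show ?thesis using \<zeta> sigma_leaf[OF \<zeta>(2) S(1)]
        by (auto simp: subtree_tree step_node tree_leaf tree_leaf(1)[unfolded One_nat_def])
    qed
  qed
  ultimately show ?case by blast
qed

lemma valid_codes:
  assumes S: "clopen_label k t St" "clopen_label k f Sf" "Sf \<subseteq> St" "St \<subseteq> partitions k"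
    and v: "valid Z"
  shows "\<exists>\<delta><\<alpha>. pi_code k \<delta> (tree t f (state 0 Z)) (if NEG Z then St else Sf)"
    and "\<exists>\<delta><\<alpha>. sigma_code k \<delta> (tree t f (state 1 Z)) (if NEG Z then Sf else St)"
proof -
  have "\<exists>\<delta><\<alpha>. pi_code k \<delta> (tree t f (state 0 Z)) (if NEG Z then St else Sf)
      \<and> sigma_code k \<delta> (tree t f (state 1 Z)) (if NEG Z then Sf else St)"
  proof (cases "hasneg Z")
    case True
    have "\<exists>\<epsilon><\<alpha>. bnd u \<epsilon>" if "neg Z u" for u
      using v that neg_ok bnd_ok by blast
    then obtain \<delta> where \<delta>: "\<delta> < \<alpha>" "\<And>u. neg Z u \<Longrightarrow> bnd u \<delta>" using common_bound[OF _ True] by blast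
    show ?thesis
      using tree_codes[OF S \<delta>(2) True] \<delta>(1) True by (intro exI[of _ \<delta>]) (simp add: state_def)
  next
    case False
    then have "NEG Z" by (simp add: NEG_def hasneg_iff)
    moreover have "tree t f (state 1 Z) = [[] \<mapsto> f]" "tree t f (state 0 Z) = [[] \<mapsto> t]"
      using False by (simp_all add: state_def tree_leaf tree_leaf(1)[unfolded One_nat_def])
    moreover obtain \<zeta> where "\<zeta> < \<alpha>" "is_zero \<zeta>" using zero_ex[OF alpha_nonzero] by blast
    ultimately show ?thesis using S(1,2) by (auto intro: sigma_leaf pi_leaf)
  qed
  then show "\<exists>\<delta><\<alpha>. pi_code k \<delta> (tree t f (state 0 Z)) (if NEG Z then St else Sf)"
    and "\<exists>\<delta><\<alpha>. sigma_code k \<delta> (tree t f (state 1 Z)) (if NEG Z then Sf else St)" by blast+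
qed

section \<open>The colouring\<close>

text \<open>\<open>covers n m Z\<close>: \<open>Z\<close> decides all atoms up to \<open>n\<close>, the positive ones by certificates
  below \<open>m\<close>. A partition whose blocks 1 and 2 have the least elements \<open>n\<close> and \<open>m\<close> is coloured according
  to whether \<open>n\<close> is settled by \<open>m\<close>; as this holds for all large \<open>m\<close>, merging blocks leaves only
  this colour for homogeneous partitions. Both colours are unions of sets \<open>NEG Z\<close>: a \<open>Y\<close> that
  refutes disproves an assumption of every covering \<open>Z \<le> m\<close>.\<close>

definition supports :: "nat \<Rightarrow> nat \<Rightarrow> nat \<Rightarrow> bool" where
  "supports m Y u \<longleftrightarrow> (\<exists>Z\<le>m. cert u Z \<and> (\<forall>v\<le>Z. neg Z v \<longrightarrow> neg Y v))"

definition covers :: "nat \<Rightarrow> nat \<Rightarrow> nat \<Rightarrow> bool" where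
  "covers n m Z \<longleftrightarrow> valid Z \<and> (\<forall>u\<le>n. neg Z u \<or> inv Z u \<or> supports m Z u)"

definition refutes :: "nat \<Rightarrow> nat \<Rightarrow> nat \<Rightarrow> nat \<Rightarrow> bool" where
  "refutes n m w Y \<longleftrightarrow> valid Y \<and> (\<forall>Z\<le>m. covers n m Z \<longrightarrow> (\<exists>u\<le>Z. neg Z u \<and> supports w Y u))"

definition settled :: "nat \<Rightarrow> nat \<Rightarrow> bool" where
  "settled n m \<longleftrightarrow> (\<exists>Z\<le>m. covers n m Z \<and> NEG Z)"

lemma dec_supports [comp]:
  assumes "computable_from g a" "computable_from g b" "computable_from g c"
  shows "dec g (\<lambda>x. supports (a x) (b x) (c x))"
  unfolding supports_def
  by (intro comp assms cf_comp[OF assms(1)] cf_comp[OF assms(2)] cf_comp[OF assms(3)])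

lemma dec_covers [comp]:
  assumes "computable_from g a" "computable_from g b" "computable_from g c"
  shows "dec g (\<lambda>x. covers (a x) (b x) (c x))"
  unfolding covers_def
  by (intro comp assms cf_comp[OF assms(1)] cf_comp[OF assms(2)] cf_comp[OF assms(3)])

lemma dec_refutes [comp]:
  assumes "computable_from g a" "computable_from g b" "computable_from g c" "computable_from g d"
  shows "dec g (\<lambda>x. refutes (a x) (b x) (c x) (d x))"
  unfolding refutes_def
  by (intro comp assms cf_comp[OF assms(1)] cf_comp[OF assms(2)] cf_comp[OF assms(3)] cf_comp[OF assms(4)])

lemma supports_iff: "supports m Y u \<longleftrightarrow> (\<exists>Z\<le>m. cert u Z \<and> (\<forall>v. neg Z v \<longrightarrow> neg Y v))"
  unfolding supports_def using neg_le by blast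

lemma supports_T: "supports m Y u \<Longrightarrow> NEG Y \<Longrightarrow> T u"
proof -
  assume "supports m Y u" "NEG Y"
  then obtain Z where Z: "cert u Z" "\<And>v. neg Z v \<Longrightarrow> neg Y v" by (auto simp: supports_iff)
  have "NEG Z" using Z(2) \<open>NEG Y\<close> by (simp add: NEG_def)
  with Z(1) show "T u" by (auto simp: T_NEG)
qed

lemma Union_ex:
  assumes "finite S" "\<And>s. s \<in> S \<Longrightarrow> valid (F s)"
  shows "\<exists>Y. valid Y \<and> (\<forall>u. neg Y u \<longleftrightarrow> (\<exists>s\<in>S. neg (F s) u)) \<and> (\<forall>s\<in>S. \<forall>u. inv (F s) u \<longrightarrow> inv Y u)"
  using assms
proof (induction S rule: finite_induct)
  case empty
  then show ?case using empty_ex by auto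
next
  case (insert s S)
  then obtain Y where "valid Y" "\<forall>u. neg Y u \<longleftrightarrow> (\<exists>s\<in>S. neg (F s) u)"
     "\<forall>s\<in>S. \<forall>u. inv (F s) u \<longrightarrow> inv Y u" by blast
  moreover have "valid (F s)" using insert.prems by blast
  ultimately obtain X where "valid X" "\<forall>u. neg X u \<longleftrightarrow> neg (F s) u \<or> neg Y u"
     "\<forall>u. inv (F s) u \<or> inv Y u \<longrightarrow> inv X u" using union_ex[of "F s" Y] by blast
  with \<open>\<forall>u. neg Y u \<longleftrightarrow> (\<exists>s\<in>S. neg (F s) u)\<close> \<open>\<forall>s\<in>S. \<forall>u. inv (F s) u \<longrightarrow> inv Y u\<close>
  show ?case by (intro exI[of _ X]) simp
qed

text \<open>Failure of \<open>settled\<close> is a conjunction over the finitely many covering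
  \<open>Z \<le> m\<close>. Each of them fails through a true atom, which has a true certificate.
  Merging these certificates into one \<open>Y\<close> turns the conjunction into a single
  existential statement; the bound \<open>w\<close> on certificates keeps \<open>refutes\<close>
  decidable.\<close>

lemma settled_iff: "\<not> settled n m \<longleftrightarrow> (\<exists>w Y. refutes n m w Y \<and> NEG Y)"
proof
  assume "\<not> settled n m"
  then have "\<exists>u Y. neg Z u \<and> cert u Y \<and> NEG Y" if "Z \<le> m" "covers n m Z" for Z
  proof -
    have "\<not> NEG Z" using that \<open>\<not> settled n m\<close> unfolding settled_def by blast
    then obtain u where "neg Z u" "T u" unfolding NEG_def by blast
    then show ?thesis by (auto simp: T_NEG)
  qed
  then obtain u C where C: "\<And>Z. Z \<le> m \<Longrightarrow> covers n m Z \<Longrightarrow> neg Z (u Z) \<and> cert (u Z) (C Z) \<and> NEG (C Z)"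
    by metis
  define S where "S = {Z. Z \<le> m \<and> covers n m Z}"
  have "finite S" by (rule finite_subset[of _ "{..m}"]) (auto simp: S_def)
  have CV: "valid (C Z)" if "Z \<in> S" for Z
    using C that cert_valid[of "u Z" "C Z"] by (simp add: S_def)
  obtain Y where Y: "valid Y" "\<And>u. neg Y u \<longleftrightarrow> (\<exists>Z\<in>S. neg (C Z) u)"
    using Union_ex[OF \<open>finite S\<close>, of C] CV by auto
  have CS: "neg Z (u Z)" "cert (u Z) (C Z)" "NEG (C Z)" if "Z \<in> S" for Z
    using C that by (simp_all add: S_def)
  have "NEG Y" using CS(3) by (auto simp: NEG_def Y(2))
  moreover have "refutes n m (Max (C ` S)) Y"
    unfolding refutes_def
  proof (intro conjI allI impI, fact)
    fix Z assume Z: "Z \<le> m" "covers n m Z"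
    then have "Z \<in> S" by (simp add: S_def)
    then have "C Z \<le> Max (C ` S)" using \<open>finite S\<close> by simp
    then have "supports (Max (C ` S)) Y (u Z)"
      unfolding supports_iff using CS(2)[OF \<open>Z \<in> S\<close>] Y(2) \<open>Z \<in> S\<close> by (intro exI[of _ "C Z"]) auto
    then show "\<exists>u\<le>Z. neg Z u \<and> supports (Max (C ` S)) Y u" 
      using CS(1)[OF \<open>Z \<in> S\<close>] neg_le[of Z "u Z"] by auto
  qed
  ultimately show "\<exists>w Y. refutes n m w Y \<and> NEG Y" by blast
next
  assume "\<exists>w Y. refutes n m w Y \<and> NEG Y"
  then obtain w Y where Y: "refutes n m w Y" "NEG Y" by blast
  show "\<not> settled n m"
    unfolding settled_def
  proof safe
    fix Z assume "Z \<le> m" "covers n m Z" "NEG Z"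
    then obtain u where "neg Z u" "supports w Y u" using Y(1) unfolding refutes_def by blast
    then show False using supports_T[OF _ Y(2)] \<open>NEG Z\<close> by (auto simp: NEG_def)
  qed
qed

text \<open>Each \<open>u \<le> n\<close> is handled by a true certificate, by assuming that it is
  false, or by evidence that it is no atom. The union of these pieces covers \<open>n\<close> as
  soon as \<open>m\<close> exceeds it and them.\<close>

lemma settled_eventually: "\<exists>m0. \<forall>m\<ge>m0. settled n m"
proof -
  have "\<exists>Z. valid Z \<and> NEG Z \<and> (neg Z u \<or> inv Z u \<or> cert u Z)" for u
  proof (cases "ok u")
    case True
    show ?thesis
    proof (cases "T u")
      case True
      then show ?thesis using cert_valid by (auto simp: T_NEG)
    next
      case False
      then show ?thesis using assume_ex[OF True] by (auto simp: NEG_def)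
    qed
  next
    case False
    then show ?thesis using inv_ex[OF False] by (auto simp: NEG_def)
  qed
  then obtain C where C: "\<And>u. valid (C u)" "\<And>u. NEG (C u)" "\<And>u. neg (C u) u \<or> inv (C u) u \<or> cert u (C u)"
    by metis
  obtain Z where Z: "valid Z" "\<And>v. neg Z v \<longleftrightarrow> (\<exists>u\<in>{..n}. neg (C u) v)"
      "\<And>u v. u \<le> n \<Longrightarrow> inv (C u) v \<Longrightarrow> inv Z v"
    using Union_ex[of "{..n}" C] C(1) by auto
  have "NEG Z" using C(2) by (auto simp: NEG_def Z(2))
  have "settled n m" if m: "m \<ge> max Z (Max (C ` {..n}))" for m
    unfolding settled_def
  proof (intro exI[of _ Z] conjI, use m in simp)
    show "covers n m Z"
      unfolding covers_def
    proof (intro conjI allI impI, fact)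
      fix u assume u: "u \<le> n"
      then have "C u \<le> m" using m by auto
      then have "cert u (C u) \<Longrightarrow> supports m Z u"
        unfolding supports_iff using Z(2) u by (intro exI[of _ "C u"]) auto
      then show "neg Z u \<or> inv Z u \<or> supports m Z u" using C(3)[of u] Z(2,3) u by blast
    qed
  qed fact
  then show ?thesis by blast
qed

section \<open>The colour class as a union and as an intersection\<close>

text \<open>An index of a subtree of the root codes a finite partition \<open>\<sigma>\<close>, the least elements of its
  blocks 1 and 2, a bound and a set of negative literals.\<close>

definition ix_a :: "nat \<Rightarrow> nat" where "ix_a x = pfst (psnd x)"
definition ix_b :: "nat \<Rightarrow> nat" where "ix_b x = pfst (psnd (psnd x))"
definition ix_w :: "nat \<Rightarrow> nat" where "ix_w x = pfst (psnd (psnd (psnd x)))"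
definition ix_Z :: "nat \<Rightarrow> nat" where "ix_Z x = psnd (psnd (psnd (psnd x)))"

lemma cf_ix [comp]:
  assumes "computable_from g a"
  shows "computable_from g (\<lambda>x. ix_a (a x))" "computable_from g (\<lambda>x. ix_b (a x))"
    "computable_from g (\<lambda>x. ix_w (a x))" "computable_from g (\<lambda>x. ix_Z (a x))"
  unfolding ix_a_def ix_b_def ix_w_def ix_Z_def by (intro comp assms)+

text \<open>An index that fails the test yields the empty set, which is neutral in the union;
  \<open>pi_init\<close> falls back on the full set for the same reason.\<close>

definition sigma_init :: "nat \<Rightarrow> nat \<Rightarrow> nat" where
  "sigma_init k x = (if part_at k (pfst x) (ix_a x) (ix_b x) \<and> ix_Z x \<le> ix_b x
     \<and> covers (ix_a x) (ix_b x) (ix_Z x) then state 0 (ix_Z x) else 1)"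

definition pi_init :: "nat \<Rightarrow> nat \<Rightarrow> nat" where
  "pi_init k x = (if part_at k (pfst x) (ix_a x) (ix_b x)
     \<and> refutes (ix_a x) (ix_b x) (ix_w x) (ix_Z x) then state 1 (ix_Z x) else 2)"

definition sigma_tree :: "nat \<Rightarrow> labeled_tree" where
  "sigma_tree k l = (case l of [] \<Rightarrow> Some Union_Label
     | x # s \<Rightarrow> tree (Cyl_Label (list_decode (pfst x))) Empty_Label (sigma_init k x) s)"

text \<open>A subtree whose index passes the test codes the complement of a cylinder if the refuting
  conjunction is true, and everything otherwise. So the intersection removes exactly the cylinders
  on which \<open>settled\<close> fails.\<close>

definition pi_tree :: "nat \<Rightarrow> labeled_tree" where
  "pi_tree k l = (case l of [] \<Rightarrow> Some Inter_Label
     | x # s \<Rightarrow> tree Full_Label (Co_Cyl_Label (list_decode (pfst x))) (pi_init k x) s)"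

definition colour :: "(nat \<Rightarrow> nat) \<Rightarrow> bool" where
  "colour p = settled (mu p 1) (mu p 2)"

lemma label_index_lab: "label_index (lab t f s) = (if s = 0 then 0 else if s = 1 then label_index (Some f)
    else if s = 2 then label_index (Some t) else if pfst (s - 3) = 0 then 2 else 1)"
  by (simp add: lab_def)

lemma list_code_cases: "list_decode n = (if n = 0 then [] else chd n # list_decode (ctl n))"
proof (cases "n = 0")
  case False
  then obtain m i where "n = ccons m i" by (rule cconsE)
  then show ?thesis by simp
qed simp

lemma computable_sigma_tree: "computable_tree (sigma_tree k)"
proof -
  have eq: "label_index (sigma_tree k (list_decode n)) = (if n = 0 then 1 else
      (\<lambda>s. if s = 0 then 0 else if s = 1 then 3 else if s = 2 then 5 + 2 * pfst (chd n)
        else if pfst (s - 3) = 0 then 2 else 1) (foldl step (sigma_init k (chd n)) (list_decode (ctl n))))" for n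
    by (subst list_code_cases) (simp add: sigma_tree_def tree_def label_index_lab)
  show ?thesis
    unfolding computable_tree_def computable_def eq sigma_init_def by (intro comp)
qed

lemma computable_pi_tree: "computable_tree (pi_tree k)"
proof -
  have eq: "label_index (pi_tree k (list_decode n)) = (if n = 0 then 2 else
      (\<lambda>s. if s = 0 then 0 else if s = 1 then 6 + 2 * pfst (chd n) else if s = 2 then 4
        else if pfst (s - 3) = 0 then 2 else 1) (foldl step (pi_init k (chd n)) (list_decode (ctl n))))" for n
    by (subst list_code_cases) (simp add: pi_tree_def tree_def label_index_lab)
  show ?thesis
    unfolding computable_tree_def computable_def eq pi_init_def by (intro comp)
qed

lemma dom_root:
  "[n] \<in> dom (sigma_tree k)" "[n] \<in> dom (pi_tree k)"
  by (auto simp: sigma_tree_def pi_tree_def tree_def lab_def sigma_init_def pi_init_def state_def)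

lemma sigma_class:
  assumes k: "k \<ge> 3"
  shows "sigma_code k \<alpha> (sigma_tree k) (color_class k colour True)"
proof -
  define A where "A x = (if part_at k (pfst x) (ix_a x) (ix_b x) \<and> ix_Z x \<le> ix_b x
     \<and> covers (ix_a x) (ix_b x) (ix_Z x) \<and> NEG (ix_Z x) then cylinder k (list_decode (pfst x)) else {})" for x
  have sub: "subtree (sigma_tree k) x = tree (Cyl_Label (list_decode (pfst x))) Empty_Label (sigma_init k x)" for x
    by (simp add: subtree_def sigma_tree_def)
  obtain \<zeta> where \<zeta>: "\<zeta> < \<alpha>" "is_zero \<zeta>" using zero_ex[OF alpha_nonzero] by blast
  have code: "\<exists>\<beta><\<alpha>. sigma_code k \<beta> (subtree (sigma_tree k) x) (A x) \<or> pi_code k \<beta> (subtree (sigma_tree k) x) (A x)" for x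
  proof (cases "part_at k (pfst x) (ix_a x) (ix_b x) \<and> ix_Z x \<le> ix_b x \<and> covers (ix_a x) (ix_b x) (ix_Z x)")
    case True
    then have "clopen_label k (Cyl_Label (list_decode (pfst x))) (cylinder k (list_decode (pfst x)))"
      using part_at_fin by (blast intro: clopen_label.intros)
    moreover have "clopen_label k Empty_Label {}" by (rule clopen_label.intros)
    moreover have "cylinder k (list_decode (pfst x)) \<subseteq> partitions k" by (auto simp: cylinder_def)
    moreover have "valid (ix_Z x)" using True by (simp add: covers_def)
    ultimately show ?thesis
      using valid_codes(1)[of k "Cyl_Label (list_decode (pfst x))" "cylinder k (list_decode (pfst x))" Empty_Label "{}" "ix_Z x"] True
      by (auto simp: sub A_def sigma_init_def)
  next
    case False
    then have "A x = {}" "sigma_init k x = 1" by (auto simp: A_def sigma_init_def)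
    then show ?thesis
      using \<zeta> sigma_leaf[OF \<zeta>(2) clopen_label.intros(1)] by (auto simp: sub tree_leaf(1)[unfolded One_nat_def])
  qed
  have "sigma_code k \<alpha> (sigma_tree k) {x \<in> partitions k. \<exists>n. [n] \<in> dom (sigma_tree k) \<and> x \<in> A n}"
    by (rule sigma_node) (use alpha_nonzero code dom_root in \<open>auto simp: sigma_tree_def\<close>)
  moreover have "{p \<in> partitions k. \<exists>n. [n] \<in> dom (sigma_tree k) \<and> p \<in> A n} = color_class k colour True"
  proof (intro set_eqI iffI)
    fix p assume "p \<in> {p \<in> partitions k. \<exists>n. [n] \<in> dom (sigma_tree k) \<and> p \<in> A n}"
    then obtain x where p: "p \<in> partitions k" "part_at k (pfst x) (ix_a x) (ix_b x)" "ix_Z x \<le> ix_b x"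
       "covers (ix_a x) (ix_b x) (ix_Z x)" "NEG (ix_Z x)" "p \<in> cylinder k (list_decode (pfst x))"
      by (auto simp: A_def split: if_splits)
    then show "p \<in> color_class k colour True"
      using part_at_mu[OF p(2) p(6)] by (auto simp: color_class_def colour_def settled_def)
  next
    fix p assume "p \<in> color_class k colour True"
    then obtain Z where p: "p \<in> partitions k" and Z: "Z \<le> mu p 2" "covers (mu p 1) (mu p 2) Z" "NEG Z"
      by (auto simp: color_class_def colour_def settled_def)
    obtain s where s: "part_at k s (mu p 1) (mu p 2)" "p \<in> cylinder k (list_decode s)"
      using part_at_exists[OF p k] by blast
    have "p \<in> A (pr s (pr (mu p 1) (pr (mu p 2) (pr 0 Z))))"
      using s Z by (simp add: A_def ix_a_def ix_b_def ix_w_def ix_Z_def)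
    then show "p \<in> {p \<in> partitions k. \<exists>n. [n] \<in> dom (sigma_tree k) \<and> p \<in> A n}"
      using p dom_root by blast
  qed
  ultimately show ?thesis by simp
qed

lemma pi_class:
  assumes k: "k \<ge> 3"
  shows "pi_code k \<alpha> (pi_tree k) (color_class k colour True)"
proof -
  define A where "A x = (if part_at k (pfst x) (ix_a x) (ix_b x)
     \<and> refutes (ix_a x) (ix_b x) (ix_w x) (ix_Z x) \<and> NEG (ix_Z x)
     then partitions k - cylinder k (list_decode (pfst x)) else partitions k)" for x
  have sub: "subtree (pi_tree k) x = tree Full_Label (Co_Cyl_Label (list_decode (pfst x))) (pi_init k x)" for x
    by (simp add: subtree_def pi_tree_def)
  obtain \<zeta> where \<zeta>: "\<zeta> < \<alpha>" "is_zero \<zeta>" using zero_ex[OF alpha_nonzero] by blast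
  have code: "\<exists>\<beta><\<alpha>. sigma_code k \<beta> (subtree (pi_tree k) x) (A x) \<or> pi_code k \<beta> (subtree (pi_tree k) x) (A x)" for x
  proof (cases "part_at k (pfst x) (ix_a x) (ix_b x) \<and> refutes (ix_a x) (ix_b x) (ix_w x) (ix_Z x)")
    case True
    then have "clopen_label k (Co_Cyl_Label (list_decode (pfst x))) (partitions k - cylinder k (list_decode (pfst x)))"
      using part_at_fin by (blast intro: clopen_label.intros)
    moreover have "clopen_label k Full_Label (partitions k)" by (rule clopen_label.intros)
    moreover have "valid (ix_Z x)" using True by (simp add: refutes_def)
    ultimately show ?thesis
      using valid_codes(2)[of k Full_Label "partitions k" "Co_Cyl_Label (list_decode (pfst x))"
          "partitions k - cylinder k (list_decode (pfst x))" "ix_Z x"] True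
      by (auto simp: sub A_def pi_init_def)
  next
    case False
    then have "A x = partitions k" "pi_init k x = 2" by (auto simp: A_def pi_init_def)
    then show ?thesis
      using \<zeta> sigma_leaf[OF \<zeta>(2) clopen_label.intros(2)] by (auto simp: sub tree_leaf)
  qed
  have "pi_code k \<alpha> (pi_tree k) {x \<in> partitions k. \<forall>n. [n] \<in> dom (pi_tree k) \<longrightarrow> x \<in> A n}"
    by (rule pi_node) (use alpha_nonzero code dom_root in \<open>auto simp: pi_tree_def\<close>)
  moreover have "{p \<in> partitions k. \<forall>n. [n] \<in> dom (pi_tree k) \<longrightarrow> p \<in> A n} = color_class k colour True"
  proof (intro set_eqI iffI)
    fix p assume pA: "p \<in> {p \<in> partitions k. \<forall>n. [n] \<in> dom (pi_tree k) \<longrightarrow> p \<in> A n}"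
    then have p: "p \<in> partitions k" by simp
    obtain s where s: "part_at k s (mu p 1) (mu p 2)" "p \<in> cylinder k (list_decode s)"
      using part_at_exists[OF p k] by blast
    have "settled (mu p 1) (mu p 2)"
    proof (rule ccontr)
      assume "\<not> settled (mu p 1) (mu p 2)"
      then obtain w Y where "refutes (mu p 1) (mu p 2) w Y" "NEG Y" unfolding settled_iff by blast
      then have "p \<notin> A (pr s (pr (mu p 1) (pr (mu p 2) (pr w Y))))"
        using s by (simp add: A_def ix_a_def ix_b_def ix_w_def ix_Z_def)
      then show False using pA dom_root by blast
    qed
    then show "p \<in> color_class k colour True" using p by (simp add: color_class_def colour_def)
  next
    fix p assume "p \<in> color_class k colour True"
    then have p: "p \<in> partitions k" "settled (mu p 1) (mu p 2)" by (simp_all add: color_class_def colour_def)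
    have "p \<in> A x" for x
    proof (cases "p \<in> cylinder k (list_decode (pfst x)) \<and> part_at k (pfst x) (ix_a x) (ix_b x)")
      case True
      then have "\<not> (refutes (ix_a x) (ix_b x) (ix_w x) (ix_Z x) \<and> NEG (ix_Z x))"
        using part_at_mu[of k "pfst x" "ix_a x" "ix_b x" p] p(2) settled_iff[of "ix_a x" "ix_b x"] by auto
      then show ?thesis using p by (auto simp: A_def)
    next
      case False
      then show ?thesis using p by (auto simp: A_def)
    qed
    then show "p \<in> {p \<in> partitions k. \<forall>n. [n] \<in> dom (pi_tree k) \<longrightarrow> p \<in> A n}" using p by blast
  qed
  ultimately show ?thesis by simp
qed

lemma colouring_code:
  assumes "k \<ge> 3"
  shows "computable_coloring_code k \<alpha> (sigma_tree k, pi_tree k) colour"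
  unfolding computable_coloring_code_def delta_code_def
  using sigma_class[OF assms] pi_class[OF assms] computable_sigma_tree computable_pi_tree alpha_nonzero
  by auto

section \<open>From a homogeneous partition to truth values\<close>

lemma homogeneous_settled:
  assumes "k \<ge> 3" "p \<in> inf_partitions" "homogeneous k colour p" "0 < i" "i < j"
  shows "settled (mu p i) (mu p j)"
proof -
  obtain b where b: "\<And>x. x \<in> coarsenings k p \<Longrightarrow> colour x = b"
    using assms(3) unfolding homogeneous_def by blast
  have *: "settled (mu p i) (mu p j) = b" if ij: "0 < i" "i < j" for i j
  proof -
    obtain x where "x \<in> coarsenings k p" "mu x 1 = mu p i" "mu x 2 = mu p j"
      using coarsening_exists[OF assms(2) ij assms(1)] by blast
    then show ?thesis using b[of x] by (simp add: colour_def)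
  qed
  \<comment> \<open>The common colour is read off from block 1 and a block that starts late
    enough.\<close>
  obtain m0 where m0: "\<And>m. m \<ge> m0 \<Longrightarrow> settled (mu p 1) m" using settled_eventually by blast
  have "mu p (m0 + 2) \<ge> m0" using inf_partitions_props(4)[OF assms(2), of "m0 + 2"] by simp
  then have b using m0 *[of 1 "m0 + 2"] by simp
  then show ?thesis using * assms by simp
qed

text \<open>Evaluation lists: an entry \<open>pr u (Suc Z)\<close> claims that \<open>u\<close> is true because of its
  certificate \<open>Z\<close>, and \<open>pr u 0\<close> claims that \<open>u\<close> is false, because all of its certificates up to
  the modulus \<open>h u\<close> are refuted earlier in the list.\<close>

definition entry :: "(nat \<Rightarrow> nat) \<Rightarrow> nat \<Rightarrow> nat \<Rightarrow> bool" where
  "entry h e l \<longleftrightarrow> (if psnd e = 0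
     then \<forall>Z\<le>h (pfst e). cert (pfst e) Z \<longrightarrow> (\<exists>v\<le>Z. neg Z v \<and> (\<exists>z<l. cmem (pr v (Suc z)) l))
     else cert (pfst e) (psnd e - 1) \<and> (\<forall>v\<le>psnd e - 1. neg (psnd e - 1) v \<longrightarrow> cmem (pr v 0) l))"

lemma cmem_entry_less: "cmem (pr v (Suc z)) l \<Longrightarrow> z < l"
  using cmem_less[of "pr v (Suc z)" l] le_prod_encode_2[of "Suc z" v] by simp

lemma entry_0: "entry h (pr u 0) l \<longleftrightarrow>
    (\<forall>Z\<le>h u. cert u Z \<longrightarrow> (\<exists>v. neg Z v \<and> (\<exists>z. cmem (pr v (Suc z)) l)))"
  unfolding entry_def using cmem_entry_less neg_le by simp blast

lemma entry_Suc: "entry h (pr u (Suc Z)) l \<longleftrightarrow> cert u Z \<and> (\<forall>v. neg Z v \<longrightarrow> cmem (pr v 0) l)"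
  unfolding entry_def using neg_le by auto

lemma entry_mono:
  assumes "entry h e l" "\<And>x. cmem x l \<Longrightarrow> cmem x l'" shows "entry h e l'"
proof -
  obtain u z where e: "e = pr u z" by (rule prE)
  show ?thesis
    using assms unfolding e by (cases z) (simp_all add: entry_0 entry_Suc, blast)
qed

lemma dec_entry:
  assumes "computable_from g h"
  shows "dec g (\<lambda>y. entry h (pfst y) (psnd y))"
  unfolding entry_def by (intro comp cf_comp[OF assms])

text \<open>The modulus justifies the negative claims. If \<open>u\<close> were true, a true
  covering \<open>Z\<close> would support \<open>u\<close> by a certificate
  \<open>C \<le> h u\<close> with false assumptions only, whereas the entry for \<open>u\<close>
  relies on an earlier claim that some assumption of \<open>C\<close> is true.\<close>

lemma entry_sound:
  assumes h: "\<And>u. \<exists>n\<ge>u. settled n (h u)" and l: "vlist (entry h) l" "cmem e l" and ok: "ok (pfst e)"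
  shows "T (pfst e) \<longleftrightarrow> psnd e > 0"
proof -
  have "ok (pfst e) \<longrightarrow> (T (pfst e) \<longleftrightarrow> psnd e > 0)"
    using l
  proof (rule vlist_induct)
    fix e m
    assume J: "entry h e m" and IH: "\<And>x. cmem x m \<Longrightarrow> ok (pfst x) \<longrightarrow> T (pfst x) = (0 < psnd x)"
    show "ok (pfst e) \<longrightarrow> T (pfst e) = (0 < psnd e)"
    proof
      obtain u z where e: "e = pr u z" by (rule prE)
      assume "ok (pfst e)"
      then have u: "ok u" by (simp add: e)
      show "T (pfst e) = (0 < psnd e)"
      proof (cases z)
        case 0
        have "\<not> T u"
        proof
          assume "T u"
          obtain n Z where n: "n \<ge> u" "covers n (h u) Z" "NEG Z"
            using h[of u] unfolding settled_def by blast
          then have "valid Z" "neg Z u \<or> inv Z u \<or> supports (h u) Z u" by (auto simp: covers_def)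
          moreover have "\<not> neg Z u" using n(3) \<open>T u\<close> by (auto simp: NEG_def)
          moreover have "\<not> inv Z u" using inv_ok \<open>valid Z\<close> u by blast
          ultimately obtain C where C: "C \<le> h u" "cert u C" "\<And>v. neg C v \<Longrightarrow> neg Z v"
            by (auto simp: supports_iff)
          obtain v z' where v: "neg C v" "cmem (pr v (Suc z')) m"
            using J C(1,2) unfolding e 0 entry_0 by blast
          have "ok v" using neg_ok[OF cert_valid[OF C(2)] v(1)] .
          then have "T v" using IH[OF v(2)] by simp
          then show False using n(3) C(3)[OF v(1)] by (auto simp: NEG_def)
        qed
        then show ?thesis by (simp add: e 0)
      next
        case (Suc Z)
        have C: "cert u Z" "\<And>v. neg Z v \<Longrightarrow> cmem (pr v 0) m" using J unfolding e Suc entry_Suc by auto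
        have "NEG Z"
          unfolding NEG_def using IH[OF C(2)] neg_ok[OF cert_valid[OF C(1)]] by simp
        then have "T u" using C(1) by (auto simp: T_NEG)
        then show ?thesis by (simp add: e Suc)
      qed
    qed
  qed
  then show ?thesis using ok by simp
qed

lemma entry_union:
  assumes "finite S" "\<And>s. s \<in> S \<Longrightarrow> \<exists>l. vlist (entry h) l \<and> cmem (E s) l"
  shows "\<exists>l. vlist (entry h) l \<and> (\<forall>s\<in>S. cmem (E s) l)"
  using assms
proof (induction S rule: finite_induct)
  case (insert s S)
  then obtain l m where l: "vlist (entry h) l" "\<forall>s\<in>S. cmem (E s) l" and m: "vlist (entry h) m" "cmem (E s) m"
    by (metis insertCI)
  have "\<exists>n. vlist (entry h) n \<and> (\<forall>x. cmem x n \<longleftrightarrow> cmem x l \<or> cmem x m)"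
    by (rule vlist_append[OF _ l(1) m(1)]) (rule entry_mono)
  then show ?case using l m by blast
qed (auto intro: exI[of _ 0])

text \<open>By induction on the level: a true atom is entered after the false atoms assumed by one
  true certificate, a false atom after one true assumption of each certificate up to
  \<open>h u\<close>. In either case finitely many lists have to be merged.\<close>

lemma entry_complete:
  assumes "bnd u \<delta>"
  shows "\<exists>l z. vlist (entry h) l \<and> cmem (pr u z) l \<and> (z > 0 \<longleftrightarrow> T u)"
  using assms
proof (induction \<delta> arbitrary: u rule: less_induct)
  case (less \<delta>)
  have sub: "\<exists>l z. vlist (entry h) l \<and> cmem (pr v z) l \<and> (z > 0 \<longleftrightarrow> T v)" if "cert u Z" "neg Z v" for Z v
    using less.IH bnd_cert[OF less.prems that] by blast
  show ?case
  proof (cases "T u")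
    case True
    then obtain Z where Z: "cert u Z" "NEG Z" by (auto simp: T_NEG)
    have fin: "finite {v. neg Z v}" by (rule finite_subset[of _ "{..Z}"]) (auto dest: neg_le)
    have "\<exists>l. vlist (entry h) l \<and> cmem (pr v 0) l" if "v \<in> {v. neg Z v}" for v
    proof -
      have "neg Z v" using that by simp
      then obtain l z where "vlist (entry h) l" "cmem (pr v z) l" "z > 0 \<longleftrightarrow> T v" using sub[OF Z(1)] by blast
      moreover have "\<not> T v" using Z(2) \<open>neg Z v\<close> by (auto simp: NEG_def)
      ultimately show ?thesis by auto
    qed
    from entry_union[OF fin this, of "\<lambda>v. v"] obtain l where
      l: "vlist (entry h) l" "\<forall>v\<in>{v. neg Z v}. cmem (pr v 0) l" by blast
    then have "vlist (entry h) (ccons (pr u (Suc Z)) l)" using Z(1) by (simp add: entry_Suc)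
    then show ?thesis using True by (intro exI[of _ "ccons (pr u (Suc Z)) l"] exI[of _ "Suc Z"]) simp
  next
    case False
    define S where "S = {Z. Z \<le> h u \<and> cert u Z}"
    have fin: "finite S" by (rule finite_subset[of _ "{..h u}"]) (auto simp: S_def)
    have "\<exists>e l v z. neg Z v \<and> e = pr v (Suc z) \<and> vlist (entry h) l \<and> cmem e l" if "Z \<in> S" for Z
    proof -
      have Z: "cert u Z" using that by (simp add: S_def)
      then have "\<not> NEG Z" using False by (auto simp: T_NEG)
      then obtain v where v: "neg Z v" "T v" by (auto simp: NEG_def)
      obtain l z where lz: "vlist (entry h) l" "cmem (pr v z) l" "z > 0" using sub[OF Z v(1)] v(2) by blast
      then obtain z' where "z = Suc z'" by (cases z) auto
      then show ?thesis using lz v by blast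
    qed
    then obtain E where E: "\<And>Z. Z \<in> S \<Longrightarrow> (\<exists>v z. neg Z v \<and> E Z = pr v (Suc z)) \<and> (\<exists>l. vlist (entry h) l \<and> cmem (E Z) l)"
      by metis
    have E1: "\<exists>v z. neg Z v \<and> E Z = pr v (Suc z)" if "Z \<in> S" for Z using E[OF that] by simp
    have E2: "\<exists>l. vlist (entry h) l \<and> cmem (E Z) l" if "Z \<in> S" for Z using E[OF that] by simp
    obtain l where l: "vlist (entry h) l" "\<And>Z. Z \<in> S \<Longrightarrow> cmem (E Z) l"
      using entry_union[OF fin, of h E] E2 by blast
    have "\<exists>v. neg Z v \<and> (\<exists>z. cmem (pr v (Suc z)) l)" if "Z \<le> h u" "cert u Z" for Z
    proof -
      have "Z \<in> S" using that by (simp add: S_def)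
      then obtain v z where "neg Z v" "E Z = pr v (Suc z)" using E1 by blast
      then show ?thesis using l(2)[OF \<open>Z \<in> S\<close>] by metis
    qed
    then have "vlist (entry h) (ccons (pr u 0) l)" using l(1) by (simp add: entry_0)
    then show ?thesis using False by (intro exI[of _ "ccons (pr u 0) l"] exI[of _ 0]) simp
  qed
qed

lemma settled_computes:
  assumes h: "computable_from g h" "\<And>u. \<exists>n\<ge>u. settled n (h u)"
  shows "\<exists>t. computable_from g t \<and> (\<forall>u. ok u \<longrightarrow> t u = of_bool (T u))"
proof -
  \<comment> \<open>The last disjunct lets the search stop at a \<open>u\<close> that is no
    admissible atom, where the value of \<open>t\<close> does not matter.\<close>
  define Q where "Q u w \<longleftrightarrow> vlist (entry h) (pfst w) \<and>
     (cmem (pr u 0) (pfst w) \<or> (\<exists>z<pfst w. cmem (pr u (Suc z)) (pfst w)))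
     \<or> valid (psnd w) \<and> inv (psnd w) u" for u w
  have Q: "\<exists>w. Q u w" for u
  proof (cases "ok u")
    case True
    then obtain \<delta> where "bnd u \<delta>" using bnd_ok by blast
    then obtain l z where l: "vlist (entry h) l" "cmem (pr u z) l" using entry_complete by blast
    then have "cmem (pr u 0) l \<or> (\<exists>z<l. cmem (pr u (Suc z)) l)"
      using cmem_entry_less by (cases z) auto
    then show ?thesis using l by (intro exI[of _ "pr l 0"]) (simp add: Q_def)
  next
    case False
    then obtain Z where "valid Z" "inv Z u" using inv_ex by blast
    then show ?thesis by (intro exI[of _ "pr 0 Z"]) (simp add: Q_def)
  qed
  define t where "t u = (of_bool (\<exists>z<pfst (LEAST w. Q u w). cmem (pr u (Suc z)) (pfst (LEAST w. Q u w))) :: nat)" for u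
  have "dec g (\<lambda>y. Q (pfst y) (psnd y))"
    unfolding Q_def by (intro comp dec_vlist dec_entry h)
  then have L: "computable_from g (\<lambda>u. LEAST w. Q u w)" using Q by (rule cf_Least)
  have "computable_from g t"
    unfolding t_def[abs_def] by (intro comp cf_comp[OF L])
  moreover have "t u = of_bool (T u)" if u: "ok u" for u
  proof -
    define w where "w = (LEAST w. Q u w)"
    have "Q u w" unfolding w_def using Q by (rule LeastI_ex)
    then have w: "vlist (entry h) (pfst w)" "cmem (pr u 0) (pfst w) \<or> (\<exists>z<pfst w. cmem (pr u (Suc z)) (pfst w))"
      using inv_ok u unfolding Q_def by blast+
    have "(\<exists>z<pfst w. cmem (pr u (Suc z)) (pfst w)) \<longleftrightarrow> T u"
      using entry_sound[OF h(2) w(1), of "pr u 0"] entry_sound[OF h(2) w(1), of "pr u (Suc z)" for z] w(2) u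
      by auto
    then show ?thesis by (simp add: t_def w_def[symmetric])
  qed
  ultimately show ?thesis by blast
qed

theorem homogeneous_computes:
  assumes "k \<ge> 3" "p \<in> inf_partitions" "homogeneous k colour p"
  shows "\<exists>t. computable_from p t \<and> (\<forall>u. ok u \<longrightarrow> t u = of_bool (T u))"
proof (rule settled_computes)
  have "computable_from p (\<lambda>i. LEAST n. p n = i)"
  proof (rule cf_Least)
    show "dec p (\<lambda>y. p (psnd y) = pfst y)" by (intro comp cf_oracle)
    show "\<exists>n. p n = i" for i using inf_partitions_props(1)[OF assms(2)] by blast
  qed
  \<comment> \<open>The modulus at \<open>u\<close> uses the blocks \<open>u + 1\<close> and
    \<open>u + 2\<close>, since block 0 is excluded; the first of them starts at \<open>u\<close> or
    later.\<close>
  from cf_comp[OF this, of "\<lambda>u. u + 2"] show "computable_from p (\<lambda>u. mu p (u + 2))"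
    unfolding mu_def by (simp add: cf_add cf_id cf_const del: add_2_eq_Suc')
  show "\<exists>n\<ge>u. settled n (mu p (u + 2))" for u
    using homogeneous_settled[OF assms, of "u + 1" "u + 2"] inf_partitions_props(4)[OF assms(2), of "u + 1"]
    by (intro exI[of _ "mu p (u + 1)"]) simp
qed

end

section \<open>A deduction system for the jump hierarchy\<close>

text \<open>Facts about a fixed notation \<open>r\<close>. A path \<open>i\<close> codes a descent from \<open>r\<close> through smaller
  notations, with the last step first. Writing \<open>|i|\<close> for the ordinal it leads to:
  \<open>fB i b\<close> says that \<open>i\<close> leads to \<open>b\<close> (0 after a step below the notation 1);
  \<open>fA i d q v\<close> that \<open>v\<close> is the value of \<open>chi (H_set d)\<close> at \<open>q\<close>, as can be verified below \<open>i\<close>;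
  \<open>fR i d c x y\<close> that program \<open>c\<close> with this oracle maps \<open>x\<close> to \<open>y\<close>; \<open>fL i d\<close> that \<open>d\<close> denotes
  an ordinal below \<open>|i|\<close>; \<open>fP u\<close> and \<open>fN u\<close> that the atom \<open>u\<close> is true, respectively false.
  The atoms at \<open>i\<close> are: \<open>q\<close> is in the jump of \<open>H_set d\<close> (\<open>aJ\<close>), the \<open>j\<close>-th value of the
  function with index \<open>e\<close> denotes an ordinal below \<open>|i|\<close> (\<open>aC\<close>), and, where \<open>|i|\<close> is a successor,
  some value of this function does not denote an ordinal below its predecessor (\<open>aD\<close>).\<close>

definition fB where "fB i b = pr 0 (pr i b)"
definition fR where "fR i d c x y = pr 1 (pr i (pr d (pr c (pr x y))))"
definition fA where "fA i d q v = pr 2 (pr i (pr d (pr q v)))"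
definition fL where "fL i d = pr 3 (pr i d)"
definition fP where "fP u = pr 4 u"
definition fN where "fN u = pr 5 u"

lemmas fact_defs = fB_def fR_def fA_def fL_def fP_def fN_def

lemma fact_eq [simp]:
  "fB i b = fB i' b' \<longleftrightarrow> i = i' \<and> b = b'"
  "fR i d c x y = fR i' d' c' x' y' \<longleftrightarrow> i = i' \<and> d = d' \<and> c = c' \<and> x = x' \<and> y = y'"
  "fA i d q v = fA i' d' q' v' \<longleftrightarrow> i = i' \<and> d = d' \<and> q = q' \<and> v = v'"
  "fL i d = fL i' d' \<longleftrightarrow> i = i' \<and> d = d'" "fP u = fP u' \<longleftrightarrow> u = u'" "fN u = fN u' \<longleftrightarrow> u = u'"
  by (auto simp: fact_defs prod_encode_eq)

lemma fact_neq [simp]: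
  "fB i b \<noteq> fR i' d' c' x' y'" "fB i b \<noteq> fA i' d' q' v'" "fB i b \<noteq> fL i' d'" "fB i b \<noteq> fP u'" "fB i b \<noteq> fN u'"
  "fR i d c x y \<noteq> fB i' b'" "fR i d c x y \<noteq> fA i' d' q' v'" "fR i d c x y \<noteq> fL i' d'" "fR i d c x y \<noteq> fP u'" "fR i d c x y \<noteq> fN u'"
  "fA i d q v \<noteq> fB i' b'" "fA i d q v \<noteq> fR i' d' c' x' y'" "fA i d q v \<noteq> fL i' d'" "fA i d q v \<noteq> fP u'" "fA i d q v \<noteq> fN u'"
  "fL i d \<noteq> fB i' b'" "fL i d \<noteq> fR i' d' c' x' y'" "fL i d \<noteq> fA i' d' q' v'" "fL i d \<noteq> fP u'" "fL i d \<noteq> fN u'"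
  "fP u \<noteq> fB i' b'" "fP u \<noteq> fR i' d' c' x' y'" "fP u \<noteq> fA i' d' q' v'" "fP u \<noteq> fL i' d'" "fP u \<noteq> fN u'"
  "fN u \<noteq> fB i' b'" "fN u \<noteq> fR i' d' c' x' y'" "fN u \<noteq> fA i' d' q' v'" "fN u \<noteq> fL i' d'" "fN u \<noteq> fP u'"
  by (auto simp: fact_defs prod_encode_eq)

definition aJ where "aJ i d q = pr i (pr 0 (pr d q))"
definition aC where "aC i e j = pr i (pr 1 (pr e j))"
definition aD where "aD i e = pr i (pr 2 e)"

lemmas atom_defs = aJ_def aC_def aD_def

lemma atom_eq [simp]:
  "aJ i d q = aJ i' d' q' \<longleftrightarrow> i = i' \<and> d = d' \<and> q = q'" "aJ i d q \<noteq> aC i' e' j'" "aJ i d q \<noteq> aD i' e'"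
  "aC i e j = aC i' e' j' \<longleftrightarrow> i = i' \<and> e = e' \<and> j = j'" "aC i e j \<noteq> aJ i' d' q'" "aC i e j \<noteq> aD i' e'"
  "aD i e = aD i' e' \<longleftrightarrow> i = i' \<and> e = e'" "aD i e \<noteq> aC i' e' j'" "aD i e \<noteq> aJ i' d' q'"
  by (auto simp: atom_defs prod_encode_eq)

definition path :: "nat \<Rightarrow> nat" where "path u = pfst u"

lemma path_simps [simp]: "path (aJ i d q) = i" "path (aC i e j) = i" "path (aD i e) = i"
  by (simp_all add: path_def atom_defs)

definition cPair where "cPair a b = 5 + 4 * pr a b"
definition cComp where "cComp a b = 6 + 4 * pr a b"
definition cRec where "cRec a b = 7 + 4 * pr a b"
definition cMu where "cMu a = 8 + 4 * (a::nat)"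

lemmas code_defs = cPair_def cComp_def cRec_def cMu_def

lemma code_eq [simp]:
  "cPair a b = cPair a' b' \<longleftrightarrow> a = a' \<and> b = b'" "cComp a b = cComp a' b' \<longleftrightarrow> a = a' \<and> b = b'"
  "cRec a b = cRec a' b' \<longleftrightarrow> a = a' \<and> b = b'" "cMu a = cMu a' \<longleftrightarrow> a = a'"
  by (auto simp: code_defs prod_encode_eq)

lemma code_neq [simp]:
  "cPair a b \<noteq> cComp a' b'" "cPair a b \<noteq> cRec a' b'" "cPair a b \<noteq> cMu a'"
  "cComp a b \<noteq> cPair a' b'" "cComp a b \<noteq> cRec a' b'" "cComp a b \<noteq> cMu a'"
  "cRec a b \<noteq> cPair a' b'" "cRec a b \<noteq> cComp a' b'" "cRec a b \<noteq> cMu a'"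
  "cMu a \<noteq> cPair a' b'" "cMu a \<noteq> cComp a' b'" "cMu a \<noteq> cRec a' b'"
  unfolding code_defs by presburger+

lemma code_small [simp]:
  assumes "n < 5"
  shows "cPair a b \<noteq> n" "cComp a b \<noteq> n" "cRec a b \<noteq> n" "cMu a \<noteq> n"
    "n \<noteq> cPair a b" "n \<noteq> cComp a b" "n \<noteq> cRec a b" "n \<noteq> cMu a"
  using assms by (auto simp: code_defs)

inductive just :: "nat \<Rightarrow> nat \<Rightarrow> nat \<Rightarrow> bool" for r l where
  "just r l (fB 0 r)"
| "cmem (fB i (2 ^ b)) l \<Longrightarrow> 0 < b \<Longrightarrow> just r l (fB (ccons m i) b)"
| "cmem (fB i (3 * 5 ^ e)) l \<Longrightarrow> cmem (fR 0 1 e m b) l \<Longrightarrow> just r l (fB (ccons m i) b)"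
| "cmem (fB i b) l \<Longrightarrow> b < 2 \<Longrightarrow> just r l (fB (ccons m i) 0)"

| "just r l (fR i d 0 x 0)"
| "just r l (fR i d 1 x (Suc x))"
| "just r l (fR i d 2 (pr x y) x)"
| "just r l (fR i d 3 (pr x y) y)"
| "cmem (fA i d x y) l \<Longrightarrow> just r l (fR i d 4 x y)"
| "cmem (fR i d a x y) l \<Longrightarrow> cmem (fR i d b x z) l \<Longrightarrow> just r l (fR i d (cPair a b) x (pr y z))"
| "cmem (fR i d b x y) l \<Longrightarrow> cmem (fR i d a y z) l \<Longrightarrow> just r l (fR i d (cComp a b) x z)"
| "cmem (fR i d a x y) l \<Longrightarrow> just r l (fR i d (cRec a b) (pr x 0) y)"
| "cmem (fR i d (cRec a b) (pr x n) y) l \<Longrightarrow> cmem (fR i d b (pr x (pr n y)) z) l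
    \<Longrightarrow> just r l (fR i d (cRec a b) (pr x (Suc n)) z)"
| "cmem (fR i d a (pr x n) 0) l \<Longrightarrow> (\<forall>m<n. \<exists>y. cmem (fR i d a (pr x m) (Suc y)) l)
    \<Longrightarrow> just r l (fR i d (cMu a) x n)"

| "just r l (fA i 1 q 0)"
| "0 < b \<Longrightarrow> cmem (fB i (2 ^ b)) l \<Longrightarrow> 0 < d \<Longrightarrow> cmem (fP (aJ (ccons 0 i) d q)) l \<Longrightarrow> just r l (fA i (2 ^ d) q 1)"
| "0 < b \<Longrightarrow> cmem (fB i (2 ^ b)) l \<Longrightarrow> 0 < d \<Longrightarrow> cmem (fN (aJ (ccons 0 i) d q)) l \<Longrightarrow> just r l (fA i (2 ^ d) q 0)"
| "0 < b \<Longrightarrow> cmem (fB i (2 ^ b)) l \<Longrightarrow> cmem (fA (ccons 0 i) (3 * 5 ^ e) q v) l \<Longrightarrow> just r l (fA i (3 * 5 ^ e) q v)"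
| "cmem (fB i (3 * 5 ^ b)) l \<Longrightarrow> cmem (fR 0 1 e j d) l \<Longrightarrow> cmem (fL (ccons m i) d) l
    \<Longrightarrow> cmem (fA (ccons m i) d q v) l \<Longrightarrow> just r l (fA i (3 * 5 ^ e) (pr q j) v)"
| "cmem (fB i (3 * 5 ^ b)) l \<Longrightarrow> 0 < d \<Longrightarrow> cmem (fL (ccons m i) (2 ^ d)) l
    \<Longrightarrow> cmem (fA (ccons m i) (2 ^ d) q v) l \<Longrightarrow> just r l (fA i (2 ^ d) q v)"

| "cmem (fB i b) l \<Longrightarrow> 1 < b \<Longrightarrow> just r l (fL i 1)"
| "0 < b \<Longrightarrow> cmem (fB i (2 ^ b)) l \<Longrightarrow> 0 < d \<Longrightarrow> cmem (fL (ccons 0 i) d) l \<Longrightarrow> just r l (fL i (2 ^ d))"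
| "0 < b \<Longrightarrow> cmem (fB i (2 ^ (2 ^ b))) l \<Longrightarrow> cmem (fL (ccons 0 i) (3 * 5 ^ e)) l \<Longrightarrow> just r l (fL i (3 * 5 ^ e))"
| "cmem (fB i (2 ^ (3 * 5 ^ b))) l \<Longrightarrow> cmem (fN (aD i e)) l \<Longrightarrow> just r l (fL i (3 * 5 ^ e))"
| "cmem (fB i (3 * 5 ^ b)) l \<Longrightarrow> cmem (fL (ccons m i) d) l \<Longrightarrow> just r l (fL i d)"

| "cmem (fR i d q q y) l \<Longrightarrow> just r l (fP (aJ i d q))"
| "cmem (fB i (3 * 5 ^ b)) l \<Longrightarrow> cmem (fR 0 1 e j d) l \<Longrightarrow> cmem (fL i d) l \<Longrightarrow> just r l (fP (aC i e j))"
| "cmem (fB i (2 ^ (3 * 5 ^ b))) l \<Longrightarrow> cmem (fN (aC (ccons 0 i) e j)) l \<Longrightarrow> just r l (fP (aD i e))"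
| "path u \<noteq> 0 \<Longrightarrow> cmem (fB (path u) b) l \<Longrightarrow> 0 < b \<Longrightarrow> just r l (fN u)"

lemma just_mono:
  assumes "just r l f" "\<And>x. cmem x l \<Longrightarrow> cmem x l'"
  shows "just r l' f"
  using assms(1)
proof (cases rule: just.cases)
qed (hypsubst, (rule just.intros; blast intro: assms(2)))+

lemma semi_just: "semi (\<lambda>y. just r (psnd y) (pfst y))"
  unfolding just.simps fact_defs atom_defs path_def code_defs
  by (intro semic comp)

section \<open>Notations\<close>

lemma lim_neq_1 [simp]: "3 * 5 ^ e \<noteq> (1::nat)" "3 * 5 ^ e \<noteq> Suc 0" "Suc 0 \<noteq> 3 * 5 ^ e"
proof -
  have "3 * 5 ^ e > (1::nat)" using one_le_power[of "5::nat" e] by linarith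
  then show "3 * 5 ^ e \<noteq> (1::nat)" "3 * 5 ^ e \<noteq> Suc 0" "Suc 0 \<noteq> 3 * 5 ^ e" by simp_all
qed

lemma pow2_neq_lim_simps [simp]: "(2::nat) ^ a \<noteq> 3 * 5 ^ e" "3 * 5 ^ e \<noteq> (2::nat) ^ a"
  using pow2_neq_lim[of a e] by auto

lemma notates_pos: "notates a \<alpha> \<Longrightarrow> 0 < a"
  by (blast dest: notates_kleene_O kleene_O_pos)

lemma notates_1:
  assumes "notates 1 \<alpha>" shows "is_zero \<alpha>"
  using assms
proof (cases rule: notates.cases)
  case (2 a \<beta>)
  then show ?thesis using one_neq_pow2[OF notates_kleene_O[of a \<beta>]] by simp
next
  case (3 e f h)
  then show ?thesis by simp
qed

lemma notates_pow:
  assumes "notates (2 ^ a) \<beta>" "0 < a"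
  shows "\<exists>\<alpha>. notates a \<alpha> \<and> is_suc \<alpha> \<beta>"
  using assms(1)
proof (cases rule: notates.cases)
  case 1
  then show ?thesis using assms(2) by simp
next
  case (2 b \<alpha>)
  then show ?thesis by auto
next
  case (3 e f h)
  then show ?thesis by simp
qed

lemma notates_lim:
  assumes "notates (3 * 5 ^ e) \<alpha>"
  shows "\<exists>f h. kleene_O (3 * 5 ^ e) \<and> (\<forall>n. phi e n (f n)) \<and> (\<forall>n. notates (f n) (h n)) \<and> is_sup h \<alpha>"
  using assms
proof (cases rule: notates.cases)
  case (3 e' f h)
  then show ?thesis by (intro exI[of _ f] exI[of _ h]) simp
qed simp_all

lemma notates_cases:
  assumes "notates a \<alpha>"
  obtains "a = 1" | b where "0 < b" "a = 2 ^ b" | e where "a = 3 * 5 ^ e"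
  using assms by (cases rule: notates.cases) (auto dest: notates_pos)

text \<open>The limit clause of \<open>notates\<close> only speaks of a supremum. That the values
  lie strictly below it comes from \<open>kleene_less (f n) (f (Suc n))\<close>, hence the joint
  induction on both relations of Kleene's O.\<close>

lemma kleene_less_notates_aux:
  shows "kleene_O a \<Longrightarrow> \<forall>e \<gamma> n c. a = 3 * 5 ^ e \<longrightarrow> notates a (\<gamma>::'o::wellorder) \<longrightarrow> phi e n c
      \<longrightarrow> (\<exists>\<delta><\<gamma>. notates c \<delta>)"
    and "kleene_less a b \<Longrightarrow> \<forall>\<beta>::'o. notates b \<beta> \<longrightarrow> (\<exists>\<alpha><\<beta>. notates a \<alpha>)"
proof (induction rule: kleene_O_kleene_less.inducts)
  case (O_lim e f)
  show ?case
  proof (intro allI impI)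
    fix e' \<gamma> n c
    assume e': "3 * 5 ^ e = (3 * 5 ^ e' :: nat)" and \<gamma>: "notates (3 * 5 ^ e) (\<gamma>::'o)" and "phi e' n c"
    then have c: "c = f n" using O_lim by (auto dest: phi_rel_det)
    obtain g h where g: "\<And>n. phi e n (g n)" "\<And>n. notates (g n) (h n)" "is_sup h \<gamma>"
      using notates_lim[OF \<gamma>] by auto
    have "g n = f n" for n using g(1) O_lim by (blast intro: phi_rel_det)
    then have "notates (f (Suc n)) (h (Suc n))" using g(2) by metis
    then obtain \<delta> where "\<delta> < h (Suc n)" "notates (f n) \<delta>" using O_lim by blast
    moreover have "h (Suc n) \<le> \<gamma>" using g(3) by (simp add: is_sup_def)
    ultimately show "\<exists>\<delta><\<gamma>. notates c \<delta>" unfolding c by (blast intro: less_le_trans)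
  qed
next
  case (less_suc a)
  then show ?case using notates_pow kleene_O_pos unfolding is_suc_def by blast
next
  case (less_trans a b c)
  then show ?case by (blast intro: order.strict_trans)
qed auto

lemma notates_phi_less:
  assumes "notates (3 * 5 ^ e) \<gamma>" "phi e n c"
  shows "\<exists>\<delta><\<gamma>. notates c \<delta>"
  using kleene_less_notates_aux(1)[OF notates_kleene_O[OF assms(1)]] assms by blast

lemma notates_phi_total: "notates (3 * 5 ^ e) \<gamma> \<Longrightarrow> \<exists>c. phi e n c"
  by (blast dest: notates_lim)

lemma notates_phi_cofinal:
  assumes "notates (3 * 5 ^ e) \<gamma>" "\<beta> < \<gamma>"
  shows "\<exists>n c \<delta>. phi e n c \<and> notates c \<delta> \<and> \<beta> < \<delta>"
proof -
  obtain f h where "\<And>n. phi e n (f n)" "\<And>n. notates (f n) (h n)"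
    "is_sup h \<gamma>" using notates_lim[OF assms(1)] by auto
  moreover from this(3) assms(2) obtain n where "\<beta> < h n" unfolding is_sup_def by (meson leD leI)
  ultimately show ?thesis by blast
qed

lemma notates_lim_nonzero: "notates (3 * 5 ^ e) \<gamma> \<Longrightarrow> \<not> is_zero \<gamma>"
  using notates_phi_total notates_phi_less unfolding is_zero_def by (meson leD)

text \<open>A predecessor would be exceeded by some value of the sequence, which is itself below the
  limit.\<close>

lemma notates_lim_not_suc: "notates (3 * 5 ^ e) \<gamma> \<Longrightarrow> \<not> is_suc \<beta> \<gamma>"
proof
  assume l: "notates (3 * 5 ^ e) \<gamma>" and s: "is_suc \<beta> \<gamma>"
  then obtain n c \<delta> where "phi e n c" "notates c \<delta>" "\<beta> < \<delta>"
    using notates_phi_cofinal unfolding is_suc_def by blast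
  moreover from this(1,2) have "\<delta> < \<gamma>" using notates_phi_less[OF l] notates_unique by blast
  ultimately show False using s unfolding is_suc_def by (meson leD)
qed

lemma is_suc_less: "is_suc \<alpha> \<beta> \<Longrightarrow> \<delta> < \<beta> \<longleftrightarrow> \<delta> \<le> \<alpha>"
  unfolding is_suc_def by (meson leD leI le_less_trans)

lemma is_suc_mono: "is_suc \<alpha> \<beta> \<Longrightarrow> is_suc \<alpha>' \<beta>' \<Longrightarrow> \<beta>' \<le> \<beta> \<longleftrightarrow> \<alpha>' \<le> \<alpha>"
  unfolding is_suc_def by (meson leD leI le_less_trans less_le_trans)

lemma H_set_1: "H_set 1 = {}"
  by (rule H_rel_unique[OF H_rel_H_set[OF O_zero] H_rel.intros(1)])

lemma H_set_pow: "kleene_O a \<Longrightarrow> H_set (2 ^ a) = turing_jump (H_set a)"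
  by (rule H_rel_unique[OF H_rel_H_set[OF O_suc] H_rel.intros(2)[OF _ H_rel_H_set]])

lemma H_set_lim:
  assumes "notates (3 * 5 ^ e) \<gamma>" "phi e j d"
  shows "chi (H_set (3 * 5 ^ e)) (pr q j) = chi (H_set d) q"
proof -
  obtain f h where f: "kleene_O (3 * 5 ^ e)" "\<And>n. phi e n (f n)" "\<And>n. notates (f n) (h n)"
    "is_sup h \<gamma>" using notates_lim[OF assms(1)] by auto
  have "H_rel (3 * 5 ^ e) {pr i j | i j. i \<in> H_set (f j)}"
    using f H_rel_H_set notates_kleene_O by (intro H_rel.intros(3)[of e f]) blast+
  then have "H_set (3 * 5 ^ e) = {pr i j | i j. i \<in> H_set (f j)}"
    using H_rel_unique H_rel_H_set[OF f(1)] by blast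
  moreover have "d = f j" using f(2) assms(2) by (blast intro: phi_rel_det)
  ultimately show ?thesis by (auto simp: chi_def prod_encode_eq)
qed

section \<open>Descending paths\<close>

text \<open>With the last step in front, \<open>i\<close> is a proper tail of \<open>j\<close>: the
  descent \<open>j\<close> continues the descent \<open>i\<close>.\<close>

definition ext :: "nat \<Rightarrow> nat \<Rightarrow> bool" where
  "ext j i \<longleftrightarrow> (\<exists>n<clen j. (ctl ^^ Suc n) j = i)"

lemma ext_0 [simp]: "\<not> ext 0 i"
  by (simp add: ext_def)

lemma ext_ccons [simp]: "ext (ccons m j) i \<longleftrightarrow> j = i \<or> ext j i"
proof -
  have "(ctl ^^ Suc n) (ccons m j) = (ctl ^^ n) j" for n
    by (simp add: funpow_Suc_right del: funpow.simps)
  then show ?thesis unfolding ext_def clen_simps Ex_less_Suc2 by simp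
qed

lemma ext_trans: "ext k j \<Longrightarrow> ext j i \<Longrightarrow> ext k i"
  by (induction k rule: list_code_induct) auto

lemma dec_ext [comp]:
  assumes "computable_from g a" "computable_from g b"
  shows "dec g (\<lambda>x. ext (a x) (b x))"
proof (rule dec_comp2[OF _ assms])
  show "dec g (\<lambda>y. ext (pfst y) (psnd y))" unfolding ext_def by (intro comp)
qed

locale jump_system =
  fixes r :: nat and \<gamma> :: "'o::wellorder"
  assumes r: "notates r \<gamma>"
begin

text \<open>Every number is made a path: the step from a successor ignores \<open>m\<close>, and
  below 1 the path stays at 0. So \<open>leads\<close> is a total function, and a derivation of
  \<open>fB i 0\<close> is evidence that \<open>i\<close> has left the notations.\<close>

inductive leads :: "nat \<Rightarrow> nat \<Rightarrow> bool" where
  "leads 0 r"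
| "leads i (2 ^ b) \<Longrightarrow> 0 < b \<Longrightarrow> leads (ccons m i) b"
| "leads i (3 * 5 ^ e) \<Longrightarrow> phi e m b \<Longrightarrow> leads (ccons m i) b"
| "leads i b \<Longrightarrow> b < 2 \<Longrightarrow> leads (ccons m i) 0"

lemma leads_ccons: "leads (ccons m i) c \<longleftrightarrow> (\<exists>b. leads i b \<and>
    (0 < c \<and> b = 2 ^ c \<or> (\<exists>e. b = 3 * 5 ^ e \<and> phi e m c) \<or> b < 2 \<and> c = 0))"
  by (subst leads.simps) auto

lemma leads_0: "leads 0 b \<longleftrightarrow> b = r"
  by (subst leads.simps) auto

lemma leads_notates: "leads i b \<Longrightarrow> b = 0 \<or> (\<exists>\<beta>::'o. notates b \<beta> \<and> \<beta> \<le> \<gamma>)"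
proof (induction rule: leads.induct)
  case 1
  show ?case using r by blast
next
  case (2 i b m)
  then obtain \<beta> :: 'o where "notates (2 ^ b) \<beta>" "\<beta> \<le> \<gamma>" by auto
  then show ?case using notates_pow[OF _ 2(2)] unfolding is_suc_def by (meson less_imp_le order.trans)
next
  case (3 i e m b)
  then obtain \<beta> :: 'o where "notates (3 * 5 ^ e) \<beta>" "\<beta> \<le> \<gamma>" by auto
  then show ?case using notates_phi_less[OF _ 3(2)] by (meson less_imp_le order.trans)
qed auto

lemma leads_det: "leads i b \<Longrightarrow> leads i c \<Longrightarrow> b = c"
proof (induction arbitrary: c rule: leads.induct)
  case (2 i b m)
  from 2(4) obtain b' where b': "leads i b'" "0 < c \<and> b' = 2 ^ c \<or> (\<exists>e. b' = 3 * 5 ^ e \<and> phi e m c) \<or> b' < 2 \<and> c = 0"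
    unfolding leads_ccons by blast
  have "b' = 2 ^ b" using 2(3)[OF b'(1)] by simp
  moreover have "(2::nat) ^ b \<ge> 2" using \<open>0 < b\<close> by (cases b) auto
  ultimately show ?case using b'(2) by auto
next
  case (3 i e m b)
  from 3(4) obtain b' where b': "leads i b'" "0 < c \<and> b' = 2 ^ c \<or> (\<exists>e. b' = 3 * 5 ^ e \<and> phi e m c) \<or> b' < 2 \<and> c = 0"
    unfolding leads_ccons by blast
  have "b' = 3 * 5 ^ e" using 3(3)[OF b'(1)] by simp
  moreover have "(3::nat) * 5 ^ e \<ge> 2" using one_le_power[of "5::nat" e] by linarith
  ultimately show ?case using b'(2) 3(2) by (auto dest: phi_rel_det)
next
  case (4 i b m)
  from 4(4) obtain b' where b': "leads i b'" "0 < c \<and> b' = 2 ^ c \<or> (\<exists>e. b' = 3 * 5 ^ e \<and> phi e m c) \<or> b' < 2 \<and> c = 0"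
    unfolding leads_ccons by blast
  have "b' < 2" using 4(2,3) b'(1) by blast
  moreover have "(3::nat) * 5 ^ e \<ge> 2" for e using one_le_power[of "5::nat" e] by linarith
  moreover have "(2::nat) ^ c \<ge> 2" if "0 < c" using that by (cases c) auto
  ultimately show ?case using b'(2) by (metis not_le)
qed (simp add: leads_0)

lemma leads_total: "\<exists>b. leads i b"
proof (induction i rule: list_code_induct)
  case zero
  show ?case using leads_0 by blast
next
  case (ccons m i)
  then obtain b where b: "leads i b" by blast
  show ?case
  proof (cases "b < 2")
    case False
    then obtain \<beta> :: 'o where \<beta>: "notates b \<beta>" using leads_notates[OF b] by auto
    then show ?thesis
    proof (cases rule: notates_cases)
      case (3 e)
      then show ?thesis using b notates_phi_total \<beta> leads.intros(3) by blast
    qed (use b False leads.intros(2) in auto)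
  qed (use b leads.intros(4) in blast)
qed

definition good :: "nat \<Rightarrow> bool" where "good i \<longleftrightarrow> (\<exists>b>0. leads i b)"
definition rk :: "nat \<Rightarrow> 'o" where "rk i = (THE \<beta>. \<exists>b. leads i b \<and> notates b \<beta>)"

lemma rk_eq: "leads i b \<Longrightarrow> notates b \<beta> \<Longrightarrow> rk i = \<beta>"
  unfolding rk_def by (rule the_equality) (auto dest: leads_det notates_unique)

lemma rk_notates: "leads i b \<Longrightarrow> 0 < b \<Longrightarrow> notates b (rk i)"
  using leads_notates rk_eq by (metis less_irrefl)

lemma good_pow: "leads i (2 ^ b) \<Longrightarrow> 0 < b \<Longrightarrow> leads (ccons m i) b \<and> good (ccons m i) \<and> is_suc (rk (ccons m i)) (rk i)"
proof -
  assume b: "leads i (2 ^ b)" "0 < b"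
  then have l: "leads (ccons m i) b" by (rule leads.intros)
  obtain \<beta> where "notates b \<beta>" "is_suc \<beta> (rk i)"
    using notates_pow[OF rk_notates[OF b(1)] b(2)] by auto
  then show ?thesis using l b(2) rk_eq[OF l] unfolding good_def by blast
qed

lemma good_lim:
  assumes "leads i (3 * 5 ^ e)" "phi e m b"
  shows "leads (ccons m i) b" "good (ccons m i)" "notates b (rk (ccons m i))" "rk (ccons m i) < rk i"
proof -
  show l: "leads (ccons m i) b" using assms by (rule leads.intros)
  obtain \<beta> where \<beta>: "notates b \<beta>" "\<beta> < rk i"
    using notates_phi_less[OF rk_notates[OF assms(1)] assms(2)] by auto
  then show "notates b (rk (ccons m i))" "rk (ccons m i) < rk i" using rk_eq[OF l] by auto
  show "good (ccons m i)" using l notates_pos[OF \<beta>(1)] unfolding good_def by blast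
qed

lemma good_ccons: "good (ccons m i) \<Longrightarrow> good i \<and> rk (ccons m i) < rk i"
proof -
  assume "good (ccons m i)"
  then obtain c b where c: "0 < c" "leads i b" "b = 2 ^ c \<or> (\<exists>e. b = 3 * 5 ^ e \<and> phi e m c)"
    unfolding good_def leads_ccons by auto
  then show ?thesis
  proof (elim disjE exE conjE)
    assume "b = 2 ^ c"
    moreover have "good i" using c(2) \<open>b = 2 ^ c\<close> unfolding good_def by (intro exI[of _ b]) simp
    ultimately show ?thesis using c good_pow[of i c m] by (auto simp: is_suc_def)
  next
    fix e assume "b = 3 * 5 ^ e" "phi e m c"
    moreover have "good i" using c(2) \<open>b = 3 * 5 ^ e\<close> unfolding good_def by (intro exI[of _ b]) simp
    ultimately show ?thesis using c good_lim(4)[of i e m c] by auto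
  qed
qed

lemma good_ext: "ext j i \<Longrightarrow> good j \<Longrightarrow> good i \<and> rk j < rk i"
proof (induction j rule: list_code_induct)
  case (ccons m j)
  then show ?case using good_ccons[of m j] by (auto intro: less_trans)
qed simp

lemma rk_0: "rk 0 = \<gamma>" "good 0"
  using rk_eq[of 0 r] r notates_pos[OF r] unfolding good_def leads_0 by auto

lemma ext_root: "i \<noteq> 0 \<Longrightarrow> ext i 0"
proof (induction i rule: list_code_induct)
  case (ccons m i)
  then show ?case by (cases "i = 0") auto
qed simp

lemma rk_less: "good i \<Longrightarrow> i \<noteq> 0 \<Longrightarrow> rk i < \<gamma>"
  using good_ext[OF ext_root] rk_0 by auto

end

section \<open>Derivations and their assumptions\<close>

definition derivation :: "nat \<Rightarrow> nat \<Rightarrow> bool" where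
  "derivation r = vlist (\<lambda>f l. just r l f)"

lemma derivation_simps [simp]:
  "derivation r 0" "derivation r (ccons f l) \<longleftrightarrow> just r l f \<and> derivation r l"
  by (simp_all add: derivation_def)

lemma derivation_just:
  assumes "derivation r l" "cmem f l" shows "just r l f"
  using assms unfolding derivation_def by (rule vlist_induct) (blast intro: just_mono)

lemma derivation_induct:
  assumes "derivation r l" "cmem f l"
    and "\<And>f m. just r m f \<Longrightarrow> (\<And>x. cmem x m \<Longrightarrow> cmem x l) \<Longrightarrow> (\<And>x. cmem x m \<Longrightarrow> Q x) \<Longrightarrow> cmem f l \<Longrightarrow> Q f"
  shows "Q f"
  using assms(1,2) unfolding derivation_def by (rule vlist_induct) (rule assms(3))

lemma derivation_append:
  assumes "derivation r l" "derivation r m"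
  shows "\<exists>n. derivation r n \<and> (\<forall>x. cmem x n \<longleftrightarrow> cmem x l \<or> cmem x m)"
  using assms unfolding derivation_def by (rule vlist_append[rotated]) (rule just_mono)

definition derivable :: "nat \<Rightarrow> nat set \<Rightarrow> nat \<Rightarrow> bool" where
  "derivable r X f \<longleftrightarrow> (\<exists>l. derivation r l \<and> cmem f l \<and> (\<forall>v. cmem (fN v) l \<longrightarrow> v \<in> X))"

lemma derivable_mono: "derivable r X f \<Longrightarrow> X \<subseteq> Y \<Longrightarrow> derivable r Y f"
  unfolding derivable_def by blast

lemma derivable_finite:
  assumes "finite S" "\<And>s. s \<in> S \<Longrightarrow> derivable r X s"
  shows "\<exists>l. derivation r l \<and> (\<forall>s\<in>S. cmem s l) \<and> (\<forall>v. cmem (fN v) l \<longrightarrow> v \<in> X)"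
  using assms
proof (induction S rule: finite_induct)
  case (insert s S)
  then obtain l where l: "derivation r l" "\<forall>s\<in>S. cmem s l" "\<forall>v. cmem (fN v) l \<longrightarrow> v \<in> X" by auto
  obtain m where m: "derivation r m" "cmem s m" "\<forall>v. cmem (fN v) m \<longrightarrow> v \<in> X"
    using insert.prems unfolding derivable_def by blast
  obtain n where "derivation r n" "\<forall>x. cmem x n \<longleftrightarrow> cmem x l \<or> cmem x m"
    using derivation_append[OF l(1) m(1)] by blast
  then show ?case using l m by (intro exI[of _ n]) auto
qed (auto intro: exI[of _ 0])

lemma derivable_just:
  assumes "finite S" "\<And>s. s \<in> S \<Longrightarrow> derivable r X s" "\<And>l. (\<And>s. s \<in> S \<Longrightarrow> cmem s l) \<Longrightarrow> just r l f"
    and "\<And>v. f = fN v \<Longrightarrow> v \<in> X"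
  shows "derivable r X f"
proof -
  obtain l where l: "derivation r l" "\<forall>s\<in>S. cmem s l" "\<forall>v. cmem (fN v) l \<longrightarrow> v \<in> X"
    using derivable_finite[OF assms(1,2)] by blast
  then have "derivation r (ccons f l)" using assms(3) by simp
  moreover have "\<forall>v. cmem (fN v) (ccons f l) \<longrightarrow> v \<in> X" using l(3) assms(4) by auto
  ultimately show ?thesis unfolding derivable_def by (intro exI[of _ "ccons f l"]) simp
qed

lemma derivable_0:
  "(\<And>l. just r l f) \<Longrightarrow> (\<And>v. f \<noteq> fN v) \<Longrightarrow> derivable r X f"
  by (rule derivable_just[of "{}"]) auto

lemma derivable_1:
  "derivable r X a \<Longrightarrow> (\<And>l. cmem a l \<Longrightarrow> just r l f) \<Longrightarrow> (\<And>v. f \<noteq> fN v) \<Longrightarrow> derivable r X f"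
  by (rule derivable_just[of "{a}"]) auto

lemma derivable_2:
  "derivable r X a \<Longrightarrow> derivable r X b \<Longrightarrow> (\<And>l. cmem a l \<Longrightarrow> cmem b l \<Longrightarrow> just r l f)
    \<Longrightarrow> (\<And>v. f \<noteq> fN v) \<Longrightarrow> derivable r X f"
  by (rule derivable_just[of "{a, b}"]) auto

lemma derivable_3:
  "derivable r X a \<Longrightarrow> derivable r X b \<Longrightarrow> derivable r X c
    \<Longrightarrow> (\<And>l. cmem a l \<Longrightarrow> cmem b l \<Longrightarrow> cmem c l \<Longrightarrow> just r l f) \<Longrightarrow> (\<And>v. f \<noteq> fN v) \<Longrightarrow> derivable r X f"
  by (rule derivable_just[of "{a, b, c}"]) auto

lemma derivable_4:
  "derivable r X a \<Longrightarrow> derivable r X b \<Longrightarrow> derivable r X c \<Longrightarrow> derivable r X d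
    \<Longrightarrow> (\<And>l. cmem a l \<Longrightarrow> cmem b l \<Longrightarrow> cmem c l \<Longrightarrow> cmem d l \<Longrightarrow> just r l f)
    \<Longrightarrow> (\<And>v. f \<noteq> fN v) \<Longrightarrow> derivable r X f"
  by (rule derivable_just[of "{a, b, c, d}"]) auto

lemma prog_index_codes [simp]:
  "prog_index (prog.Pair c d) = cPair (prog_index c) (prog_index d)"
  "prog_index (Comp c d) = cComp (prog_index c) (prog_index d)"
  "prog_index (Rec c d) = cRec (prog_index c) (prog_index d)"
  "prog_index (Mu c) = cMu (prog_index c)"
  by (simp_all add: code_defs)

declare prog_index.simps(6-9) [simp del]

lemma prog_index_conv [simp]:
  "prog_index c = 0 \<longleftrightarrow> c = Zero" "prog_index c = Suc 0 \<longleftrightarrow> c = Succ" "prog_index c = 2 \<longleftrightarrow> c = Fst"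
  "prog_index c = 3 \<longleftrightarrow> c = Snd" "prog_index c = 4 \<longleftrightarrow> c = Oracle"
  by (metis One_nat_def prog_index.simps(1-5) prog_index_inj)+

lemma prog_index_cD:
  "prog_index c = cPair a b \<Longrightarrow> \<exists>c' d'. c = prog.Pair c' d' \<and> prog_index c' = a \<and> prog_index d' = b"
  "prog_index c = cComp a b \<Longrightarrow> \<exists>c' d'. c = Comp c' d' \<and> prog_index c' = a \<and> prog_index d' = b"
  "prog_index c = cRec a b \<Longrightarrow> \<exists>c' d'. c = Rec c' d' \<and> prog_index c' = a \<and> prog_index d' = b"
  "prog_index c = cMu a \<Longrightarrow> \<exists>c'. c = Mu c' \<and> prog_index c' = a"
  by (cases c; simp)+

text \<open>The computation is copied step by step; it asks the oracle finitely often, so the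
  derivations of the answers can be merged into one list.\<close>

lemma run_derivable:
  assumes "run g c x y" and A: "\<And>x. derivable r X (fA i d x (g x))"
  shows "derivable r X (fR i d (prog_index c) x y)"
  using assms(1)
proof (induction rule: run.induct)
  case (5 x)
  show ?case using A[of x] by (rule derivable_1) (auto intro: just.intros)
next
  case (6 c x y d z)
  from 6(3,4) show ?case by (rule derivable_2) (auto intro: just.intros)
next
  case (7 d x y c z)
  from 7(3,4) show ?case by (rule derivable_2) (auto intro: just.intros)
next
  case (8 c x y d)
  from 8(2) show ?case by (rule derivable_1) (auto intro: just.intros)
next
  case (9 c d x n y z)
  from 9(3,4) show ?case by (rule derivable_2) (auto intro: just.intros)
next
  case (10 c x n)
  then obtain y where y: "\<And>m. m < n \<Longrightarrow> 0 < y m \<and> derivable r X (fR i d (prog_index c) (pr x m) (y m))"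
    by metis
  show ?case
  proof (rule derivable_just)
    let ?S = "insert (fR i d (prog_index c) (pr x n) 0) ((\<lambda>m. fR i d (prog_index c) (pr x m) (y m)) ` {..<n})"
    show "finite ?S" by simp
    show "derivable r X s" if "s \<in> ?S" for s using that 10(2) y by auto
    fix l assume S: "\<And>s. s \<in> ?S \<Longrightarrow> cmem s l"
    have "\<exists>z. cmem (fR i d (prog_index c) (pr x m) (Suc z)) l" if mn: "m < n" for m
    proof -
      have "cmem (fR i d (prog_index c) (pr x m) (y m)) l" using S mn by blast
      moreover obtain z where "y m = Suc z" using y[OF mn] by (cases "y m") auto
      ultimately show ?thesis by auto
    qed
    then show "just r l (fR i d (prog_index (Mu c)) x n)" using S by (auto intro: just.intros)
  qed simp
qed (rule derivable_0; auto intro: just.intros just.intros(6)[unfolded One_nat_def])+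

lemma derivation_run:
  assumes D: "derivation r l" and A: "\<And>x y. cmem (fA i d x y) l \<Longrightarrow> y = g x"
    and "cmem (fR i d (prog_index c) x y) l"
  shows "run g c x y"
proof -
  have "\<forall>c x y. f = fR i d (prog_index c) x y \<longrightarrow> run g c x y" if "cmem f l" for f
    using D that
  proof (rule derivation_induct, intro allI impI)
    fix f m c x y
    assume J: "just r m f" and ml: "\<And>x. cmem x m \<Longrightarrow> cmem x l" and f: "f = fR i d (prog_index c) x y"
      and "\<And>f. cmem f m \<Longrightarrow> \<forall>c x y. f = fR i d (prog_index c) x y \<longrightarrow> run g c x y"
    then have IH: "run g c x y" if "cmem (fR i d (prog_index c) x y) m" for c x y
      using that by blast
    from J show "run g c x y" unfolding f
    proof (cases rule: just.cases)
      case 9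
      then show ?thesis using A[OF ml] by (auto intro: run.intros)
    next
      case (13 i' d' a b x' n y' z)
      then obtain c1 c2 where c: "c = Rec c1 c2" "prog_index c1 = a" "prog_index c2 = b"
        using prog_index_cD(3) by (metis fact_eq(2))
      then have "run g (Rec c1 c2) (pr x' n) y'" "run g c2 (pr x' (pr n y')) z"
        using 13 by (auto intro: IH)
      then show ?thesis using 13 c by (auto intro: run.intros(9))
    next
      case (14 i' d' a x' n)
      then obtain c' where c': "c = Mu c'" "prog_index c' = a" using prog_index_cD(4) by (metis fact_eq(2))
      have "\<exists>y>0. run g c' (pr x k) y" if "k < y" for k
        using 14 c' that IH by (metis fact_eq(2) zero_less_Suc)
      then show ?thesis using 14 c' IH by (auto intro!: run.intros(10))
    qed (auto dest!: prog_index_cD intro: run.intros IH)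
  qed
  then show ?thesis using assms(3) by blast
qed

lemma is_suc_le: "is_suc \<alpha> \<beta> \<Longrightarrow> \<beta> \<le> \<delta> \<longleftrightarrow> \<alpha> < \<delta>"
  unfolding is_suc_def by (meson less_le_trans)

lemma notates_gt1_nonzero:
  assumes "notates b \<beta>" "1 < b" shows "\<not> is_zero \<beta>"
  using assms(1)
proof (cases rule: notates_cases)
  case (2 c)
  then obtain \<alpha> where "is_suc \<alpha> \<beta>" using notates_pow assms(1) by blast
  then show ?thesis unfolding is_suc_def is_zero_def by (meson leD)
next
  case (3 e)
  then show ?thesis using notates_lim_nonzero assms(1) by blast
qed (use assms in simp)

lemma is_zero_less: "is_zero \<delta> \<Longrightarrow> \<not> is_zero \<beta> \<Longrightarrow> \<delta> < \<beta>"
  unfolding is_zero_def by (meson leI order.trans)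

lemma is_zero_not_less: "is_zero \<beta> \<Longrightarrow> \<not> \<delta> < \<beta>"
  unfolding is_zero_def by (simp add: not_less)

lemma is_zero_le: "is_zero \<beta> \<Longrightarrow> \<delta> \<le> \<beta> \<Longrightarrow> is_zero \<delta>"
  unfolding is_zero_def using order.trans by blast

lemma one_neq_pow2_simps [simp]: "0 < d \<Longrightarrow> Suc 0 \<noteq> 2 ^ d" "0 < d \<Longrightarrow> 2 ^ d \<noteq> Suc 0"
  using one_less_power[of "2::nat" d] by auto

text \<open>The only clause that yields \<open>fA i 1\<close> gives the value 0, so
  \<open>fR i 1\<close> describes computations with the zero oracle for every
  \<open>i\<close>.\<close>

lemma derivation_phi:
  assumes "derivation r l" "cmem (fR i 1 e x y) l" shows "phi e x y"
proof -
  have "y = 0" if "cmem (fA i 1 x y) l" for x y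
    using derivation_just[OF assms(1) that] by (cases rule: just.cases) auto
  moreover obtain c where "prog_index c = e" using prog_index_surj by blast
  ultimately show ?thesis
    using derivation_run[OF assms(1), of i 1 "\<lambda>_. 0" c x y] assms(2) unfolding phi_rel_def by blast
qed

lemma phi_derivable:
  assumes "phi e x y" shows "derivable r X (fR i 1 e x y)"
proof -
  obtain c where c: "prog_index c = e" "run (\<lambda>_. 0) c x y" using assms unfolding phi_rel_def by blast
  have "derivable r X (fA i 1 x 0)" for x by (rule derivable_0, rule just.intros) simp
  from run_derivable[OF c(2) this] show ?thesis using c(1) by simp
qed

text \<open>The condition \<open>1 + \<beta> \<le> \<delta>\<close>: an atom \<open>aJ i d q\<close> with \<open>|i| = \<beta>\<close> is \<open>\<Sigma>\<^sup>0\<close> at level \<open>1 + \<beta>\<close>.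
  The left side itself need not exist in the type.\<close>

definition succ_le :: "'o::wellorder \<Rightarrow> 'o \<Rightarrow> bool" where
  "succ_le \<beta> \<delta> \<longleftrightarrow> \<beta> < \<delta> \<or> \<beta> = \<delta> \<and> infinite {..<\<delta>}"

lemma succ_le_mono: "succ_le \<beta> \<delta> \<Longrightarrow> \<delta> \<le> \<epsilon> \<Longrightarrow> succ_le \<beta> \<epsilon>"
  unfolding succ_le_def by (metis le_less le_less_trans)

lemma succ_le_nonzero: "succ_le \<beta> \<delta> \<Longrightarrow> \<not> is_zero \<delta>"
proof
  assume "succ_le \<beta> \<delta>" "is_zero \<delta>"
  moreover from this(2) have "{..<\<delta>} = {}" unfolding is_zero_def by (auto dest: leD)
  ultimately show False unfolding succ_le_def by (auto simp: is_zero_def not_less)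
qed

text \<open>An infinite \<open>\<beta>\<close> can serve as its own level; above a finite
  \<open>\<beta>\<close> the infinite \<open>\<alpha>\<close> leaves room for a larger one.\<close>

lemma succ_le_infinite:
  fixes \<alpha> :: "'o::wellorder"
  assumes "infinite {..<\<alpha>}" "\<beta> < \<alpha>" shows "\<exists>\<delta><\<alpha>. succ_le \<beta> \<delta>"
proof (cases "infinite {..<\<beta>}")
  case True
  then show ?thesis using assms unfolding succ_le_def by blast
next
  case False
  have "{..\<beta>} = insert \<beta> {..<\<beta>}" by auto
  then have "finite {..\<beta>}" using False by simp
  then have "\<not> {..<\<alpha>} \<subseteq> {..\<beta>}" using assms(1) finite_subset by blast
  then show ?thesis unfolding succ_le_def by (auto simp: not_le)
qed

lemma succ_le_step:
  assumes "succ_le \<beta> \<delta>" "\<beta>' < \<beta>" shows "\<exists>\<epsilon><\<delta>. succ_le \<beta>' \<epsilon>"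
  using assms succ_le_infinite[of \<delta> \<beta>'] unfolding succ_le_def by blast

section \<open>Truth of atoms\<close>

context jump_system
begin

lemma derivation_leads:
  assumes l: "derivation r l" and "cmem (fB i b) l" shows "leads i b"
proof -
  have "\<forall>i b. f = fB i b \<longrightarrow> leads i b" if "cmem f l" for f
    using l that
  proof (rule derivation_induct, intro allI impI)
    fix f m i b
    assume J: "just r m f" and ml: "\<And>x. cmem x m \<Longrightarrow> cmem x l" and f: "f = fB i b"
      and IH: "\<And>f. cmem f m \<Longrightarrow> \<forall>i b. f = fB i b \<longrightarrow> leads i b"
    from J show "leads i b" unfolding f
    proof (cases rule: just.cases)
      case (3 i e m' b)
      have "leads i (3 * 5 ^ e)" using IH[OF 3(2)] by blast
      moreover have "phi e m' b" using derivation_phi[OF l ml] 3 by blast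
      ultimately show ?thesis using 3(1) by (auto intro: leads.intros(3))
    qed (use IH in \<open>auto intro: leads.intros\<close>)
  qed
  then show ?thesis using assms(2) by blast
qed

lemma leads_derivable: "leads i b \<Longrightarrow> derivable r X (fB i b)"
proof (induction rule: leads.induct)
  case 1
  show ?case by (rule derivable_0) (auto intro: just.intros)
next
  case (2 i b m)
  show ?case using 2(3) by (rule derivable_1) (use 2(2) in \<open>auto intro: just.intros\<close>)
next
  case (3 i e m b)
  show ?case using 3(3) phi_derivable[OF 3(2)] by (rule derivable_2) (auto intro: just.intros)
next
  case (4 i b m)
  show ?case using 4(3) by (rule derivable_1) (use 4(2) in \<open>auto intro: just.intros\<close>)
qed

text \<open>Fixes one decidable relation behind the semidecidable \<open>derivation\<close>. A code
  \<open>Z\<close> is then a pair of a witness and a derivation, and its validity is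
  decidable.\<close>

definition witness :: "nat \<Rightarrow> nat \<Rightarrow> bool" where
  "witness = (SOME Q. dec (\<lambda>_. 0) (\<lambda>y. Q (pfst y) (psnd y)) \<and> derivation r = (\<lambda>l. \<exists>w. Q l w))"

lemma witness: "dec (\<lambda>_. 0) (\<lambda>y. witness (pfst y) (psnd y))" "derivation r l \<longleftrightarrow> (\<exists>w. witness l w)"
proof -
  have "semi (derivation r)"
    unfolding derivation_def by (rule semi_vlist[of "\<lambda>f l. just r l f"]) (rule semi_just)
  then have "\<exists>Q. dec (\<lambda>_. 0) (\<lambda>y. Q (pfst y) (psnd y)) \<and> derivation r = (\<lambda>l. \<exists>w. Q l w)"
    by (blast elim: semiE)
  from someI_ex[OF this, folded witness_def]
  show "dec (\<lambda>_. 0) (\<lambda>y. witness (pfst y) (psnd y))" "derivation r l \<longleftrightarrow> (\<exists>w. witness l w)" by auto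
qed

definition valid where "valid Z \<longleftrightarrow> witness (psnd Z) (pfst Z)"
definition neg where "neg Z u \<longleftrightarrow> cmem (fN u) (psnd Z)"
definition inv where "inv Z u \<longleftrightarrow> path u = 0 \<or> cmem (fB (path u) 0) (psnd Z)"
text \<open>Assumptions must sit at proper continuations of the path of \<open>u\<close>. This makes
  truth a well-founded recursion and lowers the level.\<close>

definition cert where "cert u Z \<longleftrightarrow> valid Z \<and> cmem (fP u) (psnd Z) \<and> (\<forall>v<psnd Z. neg Z v \<longrightarrow> ext (path v) (path u))"
text \<open>Atoms at the path 0 would have the ordinal \<open>\<gamma>\<close>, for which there is
  no level below \<open>\<alpha>\<close>.\<close>

definition ok where "ok u \<longleftrightarrow> path u \<noteq> 0 \<and> good (path u)"
definition below where "below = {(v, u). ok v \<and> ext (path v) (path u)}"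
definition T where "T = wfrec below (\<lambda>T u. \<exists>Z. cert u Z \<and> (\<forall>v. neg Z v \<longrightarrow> \<not> T v))"
definition bnd where "bnd u \<delta> \<longleftrightarrow> ok u \<and> succ_le (rk (path u)) (\<delta>::'o)"

lemma valid_derivation: "valid Z \<Longrightarrow> derivation r (psnd Z)"
  unfolding valid_def using witness(2) by blast

lemma derivation_valid: "derivation r l \<Longrightarrow> \<exists>w. valid (pr w l)"
  unfolding valid_def using witness(2) by simp

lemma derivation_ok:
  assumes "derivation r l" "cmem (fN u) l" shows "ok u"
  using derivation_just[OF assms]
proof (cases rule: just.cases)
  case (29 u' b)
  then show ?thesis using derivation_leads[OF assms(1)] unfolding ok_def good_def by auto
qed auto

lemma cmem_fN_less: "cmem (fN u) l \<Longrightarrow> u < l"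
  using cmem_less[of "fN u" l] le_prod_encode_2[of u 5] by (simp add: fN_def)

lemma cert_iff: "cert u Z \<longleftrightarrow> valid Z \<and> cmem (fP u) (psnd Z) \<and> (\<forall>v. neg Z v \<longrightarrow> ext (path v) (path u))"
  unfolding cert_def neg_def using cmem_fN_less by blast

lemma cert_below: "cert u Z \<Longrightarrow> neg Z v \<Longrightarrow> (v, u) \<in> below"
  unfolding cert_iff below_def using derivation_ok valid_derivation unfolding neg_def by blast

lemma wf_below: "wf below"
proof (rule wf_subset)
  show "wf (inv_image {(x::'o, y). x < y} (\<lambda>u. rk (path u)))" by (intro wf_inv_image wf)
  show "below \<subseteq> inv_image {(x, y). x < y} (\<lambda>u. rk (path u))"
    using good_ext by (auto simp: below_def ok_def)
qed

lemma T_iff: "T u \<longleftrightarrow> (\<exists>Z. cert u Z \<and> (\<forall>v. neg Z v \<longrightarrow> \<not> T v))"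
proof -
  have "T u \<longleftrightarrow> (\<exists>Z. cert u Z \<and> (\<forall>v. neg Z v \<longrightarrow> \<not> cut T below u v))"
    by (subst def_wfrec[OF T_def[THEN eq_reflection] wf_below]) (rule refl)
  then show ?thesis using cert_below by (auto simp: cut_def)
qed

definition true_list where "true_list l \<longleftrightarrow> derivation r l \<and> (\<forall>v. cmem (fN v) l \<longrightarrow> \<not> T v)"

definition false_below :: "nat \<Rightarrow> nat set" where
  "false_below i = {v. ok v \<and> \<not> T v \<and> ext (path v) i}"
text \<open>A comparison at a path may deny \<open>aD\<close> at this very path, whereas
  certificates may only look further down. The two fit together by \<open>false_upto_below\<close>:
  comparisons at \<open>ccons m i\<close> serve facts at \<open>i\<close>.\<close>

definition false_upto :: "nat \<Rightarrow> nat set" where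
  "false_upto i = {v. ok v \<and> \<not> T v \<and> (path v = i \<or> ext (path v) i)}"

lemma false_upto_below: "false_upto (ccons m i) \<subseteq> false_below i"
  unfolding false_upto_def false_below_def using ext_trans[of _ "ccons m i" i] by auto

lemma false_below_mono: "false_below (ccons m i) \<subseteq> false_below i"
  unfolding false_below_def using ext_trans[of _ "ccons m i" i] by auto

lemma false_below_upto: "false_below i \<subseteq> false_upto i"
  unfolding false_upto_def false_below_def by auto

lemma T_true_list: "T u \<Longrightarrow> \<exists>l. true_list l \<and> cmem (fP u) l"
  using T_iff[of u] valid_derivation unfolding cert_iff neg_def true_list_def by blast

lemma T_derivable:
  assumes "derivable r (false_below (path u)) (fP u)" shows "T u"
proof -
  obtain l where l: "derivation r l" "cmem (fP u) l" "\<And>v. cmem (fN v) l \<Longrightarrow> v \<in> false_below (path u)"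
    using assms unfolding derivable_def by blast
  obtain w where "valid (pr w l)" using derivation_valid[OF l(1)] by blast
  then have "cert u (pr w l)" using l(2,3) by (auto simp: cert_iff neg_def false_below_def)
  moreover have "\<not> T v" if "neg (pr w l) v" for v using l(3)[of v] that by (simp add: neg_def false_below_def)
  ultimately show ?thesis unfolding T_iff[of u] by blast
qed

lemma fN_derivable:
  assumes "v \<in> X" "ok v" shows "derivable r X (fN v)"
proof -
  obtain b where b: "leads (path v) b" "0 < b" using assms(2) unfolding ok_def good_def by blast
  show ?thesis
  proof (rule derivable_just[of "{fB (path v) b}"])
    show "just r l (fN v)" if "\<And>s. s \<in> {fB (path v) b} \<Longrightarrow> cmem s l" for l
      using that b(2) assms(2) unfolding ok_def by (auto intro: just.intros)
  qed (use leads_derivable[OF b(1)] assms in auto)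
qed

lemma true_list_leads: "true_list l \<Longrightarrow> cmem (fB i b) l \<Longrightarrow> leads i b"
  unfolding true_list_def using derivation_leads by blast

lemma true_list_phi: "true_list l \<Longrightarrow> cmem (fR i 1 e x y) l \<Longrightarrow> phi e x y"
  unfolding true_list_def using derivation_phi by blast

lemma true_list_just: "true_list l \<Longrightarrow> cmem f l \<Longrightarrow> just r l f"
  unfolding true_list_def using derivation_just by blast

text \<open>Soundness and completeness of \<open>fL\<close>, by induction on the ordinal of the path
  and for every notation \<open>d\<close>. The path must not be 0, as \<open>aD i e\<close> has to
  be an admissible atom. Only a limit against the successor of a limit is delicate.\<close>

lemma L_claim:
  assumes "good i" "i \<noteq> 0" "notates d \<delta>"
  shows "(\<forall>l. true_list l \<longrightarrow> cmem (fL i d) l \<longrightarrow> \<delta> < rk i)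
       \<and> (\<delta> < rk i \<longrightarrow> derivable r (false_upto i) (fL i d))"
  using assms
proof (induction "rk i" arbitrary: i d \<delta> rule: less_induct)
  case less
  obtain b where b: "0 < b" "leads i b" using less.prems(1) unfolding good_def by blast
  have nb: "notates b (rk i)" using rk_notates b by blast
  have IHs: "\<epsilon> < rk (ccons m i)"
    if "good (ccons m i)" "notates c \<epsilon>" "true_list l" "cmem (fL (ccons m i) c) l" for m c \<epsilon> l
    using less.hyps[of "ccons m i" c \<epsilon>] good_ccons[OF that(1)] that by simp
  have IHc: "derivable r (false_upto (ccons m i)) (fL (ccons m i) c)"
    if "good (ccons m i)" "notates c \<epsilon>" "\<epsilon> < rk (ccons m i)" for m c \<epsilon>
    using less.hyps[of "ccons m i" c \<epsilon>] good_ccons[OF that(1)] that by simp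
  have sound: "\<delta> < rk i" if l: "true_list l" "cmem (fL i d) l" for l
    using true_list_just[OF l]
  proof (cases rule: just.cases)
    case (21 i' b')
    then have "leads i b'" "1 < b'" "d = 1" using true_list_leads[OF l(1)] by simp_all
    then have "1 < b" "notates 1 \<delta>" using leads_det[OF b(2)] less.prems(3) by blast+
    then show ?thesis using is_zero_less notates_1 notates_gt1_nonzero[OF nb] by blast
  next
    case (22 b' i' d')
    then have "leads i (2 ^ b')" "0 < b'" using true_list_leads[OF l(1)] by auto
    note g = good_pow[OF this, of 0]
    have "notates (2 ^ d') \<delta>" "0 < d'" using less.prems(3) 22 by simp_all
    then obtain \<delta>' where \<delta>': "notates d' \<delta>'" "is_suc \<delta>' \<delta>" using notates_pow by blast
    have "\<delta>' < rk (ccons 0 i)" using IHs[of 0 d' \<delta>' l] g \<delta>' l 22 by auto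
    then have "\<delta> \<le> rk (ccons 0 i)" using is_suc_le[OF \<delta>'(2)] by simp
    then show ?thesis using is_suc_less g by blast
  next
    case (23 b' i' e)
    then have "leads i (2 ^ (2 ^ b'))" "0 < (2::nat) ^ b'" using true_list_leads[OF l(1)] by auto
    note g = good_pow[OF this, of 0]
    have "\<delta> < rk (ccons 0 i)" using IHs[of 0 d \<delta> l] g less.prems l 23 by auto
    then show ?thesis using good_ccons[of 0 i] g by auto
  next
    case (24 i' b' e)
    then have j: "leads i (2 ^ (3 * 5 ^ b'))" "0 < (3::nat) * 5 ^ b'" "\<not> T (aD i e)" and d: "d = 3 * 5 ^ e"
      using true_list_leads[OF l(1)] l(1) unfolding true_list_def by auto
    note g = good_pow[OF j(1,2), of 0]
    show ?thesis
    proof (rule ccontr)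
      assume "\<not> \<delta> < rk i"
      then have "rk (ccons 0 i) < \<delta>" using g by (auto simp: is_suc_def)
      \<comment> \<open>Some value of the sequence exceeds the predecessor of \<open>rk i\<close>.
        Its \<open>aC\<close> is false, and denying it proves \<open>aD i e\<close>, which
        \<open>l\<close> assumes to be false.\<close>
      then obtain n c \<epsilon> where n: "phi e n c" "notates c \<epsilon>" "rk (ccons 0 i) < \<epsilon>"
        using notates_phi_cofinal less.prems(3) d by blast
      have "\<not> T (aC (ccons 0 i) e n)"
      proof
        assume "T (aC (ccons 0 i) e n)"
        then obtain m where m: "true_list m" "cmem (fP (aC (ccons 0 i) e n)) m" using T_true_list by blast
        from true_list_just[OF m] obtain c' where "cmem (fR 0 1 e n c') m" "cmem (fL (ccons 0 i) c') m"
          by (cases rule: just.cases) auto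
        moreover from this(1) have "c' = c" using true_list_phi[OF m(1)] n(1) by (blast dest: phi_rel_det)
        ultimately show False using IHs[of 0 c \<epsilon> m] g n m(1) by auto
      qed
      moreover have "ok (aC (ccons 0 i) e n)" using g by (simp add: ok_def)
      ultimately have "derivable r (false_below i) (fN (aC (ccons 0 i) e n))"
        by (intro fN_derivable) (auto simp: false_below_def)
      with leads_derivable[OF j(1)] have "derivable r (false_below i) (fP (aD i e))"
        by (rule derivable_2) (auto intro: just.intros)
      then show False using T_derivable[of "aD i e"] j(3) by simp
    qed
  next
    case (25 i' b' m d')
    then have j: "leads i (3 * 5 ^ b')" using true_list_leads[OF l(1)] by auto
    then obtain c where c: "phi b' m c" using notates_phi_total rk_notates by fastforce
    note g = good_lim[OF j c]
    have "\<delta> < rk (ccons m i)" using IHs[of m d \<delta> l] g less.prems l 25 by auto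
    then show ?thesis using g by auto
  qed auto
  moreover have complete: "derivable r (false_upto i) (fL i d)" if lt: "\<delta> < rk i"
    using nb
  proof (cases rule: notates_cases)
    case 1
    then have "is_zero (rk i)" using notates_1 nb by simp
    then show ?thesis using lt is_zero_not_less by blast
  next
    case (2 b')
    have j: "leads i (2 ^ b')" using b 2 by simp
    note g = good_pow[OF j \<open>0 < b'\<close>, of 0]
    have le: "\<delta> \<le> rk (ccons 0 i)" using lt g is_suc_less by blast
    from less.prems(3) show ?thesis
    proof (cases rule: notates_cases)
      case 1
      have lt: "1 < (2::nat) ^ b'" using \<open>0 < b'\<close> by (intro one_less_power) simp_all
      show ?thesis
        unfolding 1 by (rule derivable_1[OF leads_derivable[OF j]], rule just.intros(21)[OF _ lt]) simp_all
    next
      case (2 d')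
      obtain \<delta>' where \<delta>': "notates d' \<delta>'" "is_suc \<delta>' \<delta>" using notates_pow less.prems(3) 2 by blast
      then have "derivable r (false_upto (ccons 0 i)) (fL (ccons 0 i) d')"
        using IHc[of 0 d' \<delta>'] g le is_suc_le by blast
      then have "derivable r (false_upto i) (fL (ccons 0 i) d')"
        by (rule derivable_mono) (use false_upto_below false_below_upto in blast)
      with leads_derivable[OF j] show ?thesis
        unfolding 2 by (rule derivable_2) (use \<open>0 < b'\<close> \<open>0 < d'\<close> in \<open>auto intro: just.intros\<close>)
    next
      case (3 e)
      have nb': "notates b' (rk (ccons 0 i))" using rk_notates g \<open>0 < b'\<close> by blast
      then show ?thesis
      proof (cases rule: notates_cases)
        case 1
        then have "is_zero (rk (ccons 0 i))" using nb' notates_1 by simp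
        then have "is_zero \<delta>" using le by (rule is_zero_le)
        then show ?thesis using notates_lim_nonzero less.prems(3) 3 by blast
      next
        case (2 c)
        \<comment> \<open>Here \<open>rk (ccons 0 i)\<close> is a successor and
          \<open>\<delta>\<close> a limit, so the inequality between them is strict.\<close>
        then have "\<delta> \<noteq> rk (ccons 0 i)" using notates_pow nb' notates_lim_not_suc less.prems(3) 3 by blast
        then have "derivable r (false_upto (ccons 0 i)) (fL (ccons 0 i) d)"
          using IHc[of 0 d \<delta>] g le less.prems(3) by auto
        then have "derivable r (false_upto i) (fL (ccons 0 i) d)"
          by (rule derivable_mono) (use false_upto_below false_below_upto in blast)
        with leads_derivable[OF j] show ?thesis
          unfolding 2 3 by (rule derivable_2) (use 2 in \<open>auto intro: just.intros\<close>)
      next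
        case (3 b'')
        have d: "d = 3 * 5 ^ e" by fact
        have jl: "leads (ccons 0 i) (3 * 5 ^ b'')" using g 3 by simp
        \<comment> \<open>Each value of the sequence for \<open>\<delta>\<close> is below
          \<open>\<delta>\<close>, hence below some member of the sequence for the limit
          \<open>rk (ccons 0 i)\<close>. The comparison with this member takes place two steps below
          \<open>i\<close>.\<close>
        have C: "T (aC (ccons 0 i) e n)" for n
        proof -
          obtain c where c: "phi e n c" using notates_phi_total less.prems(3) d by blast
          obtain \<epsilon> where \<epsilon>: "notates c \<epsilon>" "\<epsilon> < \<delta>" using notates_phi_less less.prems(3) c d by blast
          then have "\<epsilon> < rk (ccons 0 i)" using le by simp
          then obtain m c' \<zeta> where m: "phi b'' m c'" "notates c' \<zeta>" "\<epsilon> < \<zeta>"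
            using notates_phi_cofinal nb' 3 by blast
          note gm = good_lim[OF jl m(1)]
          have "rk (ccons m (ccons 0 i)) = \<zeta>" using gm(3) m(2) notates_unique by blast
          moreover have "rk (ccons m (ccons 0 i)) < rk i" using gm(4) g good_ccons[of 0 i] by auto
          ultimately have "derivable r (false_upto (ccons m (ccons 0 i))) (fL (ccons m (ccons 0 i)) c)"
            using less.hyps[of "ccons m (ccons 0 i)" c \<epsilon>] gm(2) \<epsilon>(1) m(3) by auto
          then have "derivable r (false_below (ccons 0 i)) (fL (ccons m (ccons 0 i)) c)"
            by (rule derivable_mono) (rule false_upto_below)
          with leads_derivable[OF jl] have "derivable r (false_below (ccons 0 i)) (fL (ccons 0 i) c)"
            by (rule derivable_2) (auto intro: just.intros)
          from leads_derivable[OF jl] phi_derivable[OF c] this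
          have "derivable r (false_below (ccons 0 i)) (fP (aC (ccons 0 i) e n))"
            by (rule derivable_3) (auto intro: just.intros)
          then show ?thesis using T_derivable[of "aC (ccons 0 i) e n"] by simp
        qed
        have "\<not> T (aD i e)"
        proof
          assume "T (aD i e)"
          then obtain m where m: "true_list m" "cmem (fP (aD i e)) m" using T_true_list by blast
          from true_list_just[OF m] obtain n where "cmem (fN (aC (ccons 0 i) e n)) m"
            by (cases rule: just.cases) auto
          then show False using C m(1) unfolding true_list_def by blast
        qed
        moreover have "ok (aD i e)" using less.prems by (simp add: ok_def)
        ultimately have "derivable r (false_upto i) (fN (aD i e))"
          by (intro fN_derivable) (auto simp: false_upto_def)
        with leads_derivable[OF j] show ?thesis
          unfolding d 3 by (rule derivable_2) (auto intro: just.intros)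
      qed
    qed
  next
    case (3 e)
    have j: "leads i (3 * 5 ^ e)" using b 3 by simp
    obtain m c \<epsilon> where m: "phi e m c" "notates c \<epsilon>" "\<delta> < \<epsilon>"
      using notates_phi_cofinal nb 3 lt by blast
    note g = good_lim[OF j m(1)]
    have "rk (ccons m i) = \<epsilon>" using g(3) m(2) notates_unique by blast
    then have "derivable r (false_upto (ccons m i)) (fL (ccons m i) d)"
      using IHc[of m d \<delta>] g m less.prems(3) by auto
    then have "derivable r (false_upto i) (fL (ccons m i) d)"
      by (rule derivable_mono) (use false_upto_below false_below_upto in blast)
    with leads_derivable[OF j] show ?thesis by (rule derivable_2) (auto intro: just.intros)
  qed
  ultimately show ?case by blast
qed

lemma chi_zero: "chi {} = (\<lambda>_. 0)"
  by (simp add: chi_def fun_eq_iff)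

text \<open>A jump is queried one step further down, so all assumptions sit at proper continuations
  of \<open>i\<close>; therefore even \<open>i = 0\<close> is allowed, and there
  \<open>H_set a\<close> itself is evaluated. At a limit, the induction hypothesis applies only
  below a member of the sequence, which \<open>L_claim\<close> guarantees from a derived
  comparison.\<close>

lemma A_claim:
  assumes "good i" "notates d \<delta>" "\<delta> \<le> rk i"
  shows "(\<forall>l q v. true_list l \<longrightarrow> cmem (fA i d q v) l \<longrightarrow> v = chi (H_set d) q)
       \<and> (\<forall>q. derivable r (false_below i) (fA i d q (chi (H_set d) q)))"
  using assms
proof (induction "rk i" arbitrary: i d \<delta> rule: less_induct)
  case less
  obtain b where b: "0 < b" "leads i b" using less.prems(1) unfolding good_def by blast
  have nb: "notates b (rk i)" using rk_notates b by blast
  have IHs: "v = chi (H_set c) q"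
    if "good (ccons m i)" "notates c \<epsilon>" "\<epsilon> \<le> rk (ccons m i)" "true_list l" "cmem (fA (ccons m i) c q v) l" for m c \<epsilon> l q v
    using less.hyps[of "ccons m i" c \<epsilon>] good_ccons[OF that(1)] that by blast
  have IHc: "derivable r (false_below (ccons m i)) (fA (ccons m i) c q (chi (H_set c) q))"
    if "good (ccons m i)" "notates c \<epsilon>" "\<epsilon> \<le> rk (ccons m i)" for m c \<epsilon> q
    using less.hyps[of "ccons m i" c \<epsilon>] good_ccons[OF that(1)] that by blast
  have Js: "q \<in> H_set (2 ^ c)"
    if j: "good (ccons m i)" "notates c \<epsilon>" "\<epsilon> \<le> rk (ccons m i)" "true_list l" "cmem (fP (aJ (ccons m i) c q)) l" for m c \<epsilon> l q
  proof -
    from true_list_just[OF j(4,5)] obtain y where y: "cmem (fR (ccons m i) c q q y) l"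
      by (cases rule: just.cases) auto
    obtain p where p: "prog_index p = q" using prog_index_surj by blast
    have D: "derivation r l" using j(4) unfolding true_list_def by blast
    have "run (chi (H_set c)) p q y"
      using derivation_run[OF D, of "ccons m i" c "chi (H_set c)" p q y] IHs[OF j(1-4)] y p by simp
    then have "q \<in> turing_jump (H_set c)" using p unfolding turing_jump_def phi_rel_def by blast
    then show ?thesis using H_set_pow[OF notates_kleene_O[OF j(2)]] by simp
  qed
  have Jc: "derivable r (false_below (ccons m i)) (fP (aJ (ccons m i) c q))"
    if j: "good (ccons m i)" "notates c \<epsilon>" "\<epsilon> \<le> rk (ccons m i)" "q \<in> H_set (2 ^ c)" for m c \<epsilon> q
  proof -
    have "q \<in> turing_jump (H_set c)" using H_set_pow[OF notates_kleene_O[OF j(2)]] j(4) by simp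
    then obtain y p where p: "prog_index p = q" "run (chi (H_set c)) p q y"
      unfolding turing_jump_def phi_rel_def by blast
    have "derivable r (false_below (ccons m i)) (fR (ccons m i) c q q y)"
      using run_derivable[OF p(2) IHc[OF j(1-3)]] p(1) by simp
    then show ?thesis by (rule derivable_1) (auto intro: just.intros)
  qed
  have JT: "T (aJ (ccons m i) c q) \<longleftrightarrow> q \<in> H_set (2 ^ c)"
    if j: "good (ccons m i)" "notates c \<epsilon>" "\<epsilon> \<le> rk (ccons m i)" for m c \<epsilon> q
    using Js[OF j] Jc[OF j] T_true_list[of "aJ (ccons m i) c q"] T_derivable[of "aJ (ccons m i) c q"]
    unfolding path_simps by blast
  have sound: "v = chi (H_set d) q" if l: "true_list l" "cmem (fA i d q v) l" for l q v
    using true_list_just[OF l]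
  proof (cases rule: just.cases)
    case 15
    then show ?thesis using H_set_1 by (simp add: chi_zero)
  next
    case (16 b' i' d' q')
    then have j: "leads i (2 ^ b')" "0 < b'" and d: "notates (2 ^ d') \<delta>" "0 < d'" "d = 2 ^ d'" "v = 1"
      and P: "cmem (fP (aJ (ccons 0 i) d' q)) l"
      using true_list_leads[OF l(1)] less.prems(2) by simp_all
    note g = good_pow[OF j, of 0]
    obtain \<delta>' where \<delta>': "notates d' \<delta>'" "is_suc \<delta>' \<delta>" using notates_pow[OF d(1,2)] by blast
    have "\<delta>' \<le> rk (ccons 0 i)" using is_suc_mono \<delta>'(2) g less.prems(3) by blast
    then have "q \<in> H_set (2 ^ d')" using Js[of 0 d' \<delta>' l q] g \<delta>'(1) l(1) P by blast
    then show ?thesis using d by (simp add: chi_def)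
  next
    case (17 b' i' d' q')
    then have j: "leads i (2 ^ b')" "0 < b'" and d: "notates (2 ^ d') \<delta>" "0 < d'" "d = 2 ^ d'" "v = 0"
      and P: "cmem (fN (aJ (ccons 0 i) d' q)) l"
      using true_list_leads[OF l(1)] less.prems(2) by simp_all
    note g = good_pow[OF j, of 0]
    obtain \<delta>' where \<delta>': "notates d' \<delta>'" "is_suc \<delta>' \<delta>" using notates_pow[OF d(1,2)] by blast
    have "\<delta>' \<le> rk (ccons 0 i)" using is_suc_mono \<delta>'(2) g less.prems(3) by blast
    moreover have "\<not> T (aJ (ccons 0 i) d' q)" using P l(1) unfolding true_list_def by blast
    ultimately have "q \<notin> H_set (2 ^ d')" using JT[of 0 d' \<delta>' q] g \<delta>'(1) by blast
    then show ?thesis using d by (simp add: chi_def)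
  next
    case (18 b' i' e q' v')
    then have j: "leads i (2 ^ b')" "0 < b'" and d: "notates (3 * 5 ^ e) \<delta>" "d = 3 * 5 ^ e"
      and P: "cmem (fA (ccons 0 i) d q v) l"
      using true_list_leads[OF l(1)] less.prems(2) by simp_all
    note g = good_pow[OF j, of 0]
    have "\<delta> \<noteq> rk i" using g notates_lim_not_suc d by blast
    then have "\<delta> \<le> rk (ccons 0 i)" using less.prems(3) is_suc_less g by (metis le_less)
    then show ?thesis using IHs[of 0 d \<delta> l q v] g less.prems(2) l(1) P by blast
  next
    case (19 i' b' e n c m q' v')
    then have j: "leads i (3 * 5 ^ b')" and d: "notates (3 * 5 ^ e) \<delta>" "d = 3 * 5 ^ e" and q: "q = pr q' n" "v' = v"
      and P: "phi e n c" "cmem (fL (ccons m i) c) l" "cmem (fA (ccons m i) c q' v) l"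
      using true_list_leads[OF l(1)] true_list_phi[OF l(1)] less.prems(2) by simp_all
    obtain c' where c': "phi b' m c'" using notates_phi_total rk_notates[OF j] by fastforce
    note g = good_lim[OF j c']
    obtain \<epsilon> :: 'o where \<epsilon>: "notates c \<epsilon>" using notates_phi_less[OF d(1) P(1)] by blast
    then have "\<epsilon> < rk (ccons m i)" using L_claim[of "ccons m i" c \<epsilon>] g P(2) l(1) by auto
    then have "v = chi (H_set c) q'" using IHs[of m c \<epsilon> l q' v] g \<epsilon> l(1) P(3) by auto
    then show ?thesis using H_set_lim d P(1) q by metis
  next
    case (20 i' b' d' m q' v')
    then have j: "leads i (3 * 5 ^ b')"
      and P: "cmem (fL (ccons m i) d) l" "cmem (fA (ccons m i) d q v) l"
      using true_list_leads[OF l(1)] by simp_all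
    obtain c' where c': "phi b' m c'" using notates_phi_total rk_notates[OF j] by fastforce
    note g = good_lim[OF j c']
    have "\<delta> < rk (ccons m i)" using L_claim[of "ccons m i" d \<delta>] g P(1) l(1) less.prems(2) by auto
    then show ?thesis using IHs[of m d \<delta> l q v] g less.prems(2) l(1) P(2) by auto
  qed auto
  moreover have complete: "derivable r (false_below i) (fA i d q (chi (H_set d) q))" for q
    using less.prems(2)
  proof (cases rule: notates_cases)
    case 1
    then have "chi (H_set d) q = 0" using H_set_1 by (simp add: chi_zero)
    then show ?thesis unfolding 1 by (simp only:) (rule derivable_0, rule just.intros, simp)
  next
    case (2 d')
    obtain \<delta>' where \<delta>': "notates d' \<delta>'" "is_suc \<delta>' \<delta>" using notates_pow less.prems(2) 2 by blast
    from nb show ?thesis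
    proof (cases rule: notates_cases)
      case 1
      then have "is_zero (rk i)" using notates_1 nb by simp
      then have "is_zero \<delta>" using less.prems(3) by (rule is_zero_le)
      then show ?thesis using \<delta>'(2) is_zero_not_less unfolding is_suc_def by blast
    next
      case (2 b')
      have j: "leads i (2 ^ b')" using b 2 by simp
      note g = good_pow[OF j \<open>0 < b'\<close>, of 0]
      have le: "\<delta>' \<le> rk (ccons 0 i)" using is_suc_mono \<delta>'(2) g less.prems(3) by blast
      show ?thesis
      proof (cases "q \<in> H_set (2 ^ d')")
        case True
        then have "derivable r (false_below (ccons 0 i)) (fP (aJ (ccons 0 i) d' q))"
          using Jc[of 0 d' \<delta>' q] g \<delta>'(1) le by blast
        then have "derivable r (false_below i) (fP (aJ (ccons 0 i) d' q))"
          by (rule derivable_mono) (rule false_below_mono)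
        with leads_derivable[OF j] have "derivable r (false_below i) (fA i (2 ^ d') q 1)"
          by (rule derivable_2) (use \<open>0 < b'\<close> \<open>0 < d'\<close> in \<open>auto intro: just.intros(16)[unfolded One_nat_def]\<close>)
        then show ?thesis using True \<open>d = 2 ^ d'\<close> by (simp add: chi_def)
      next
        case False
        then have "\<not> T (aJ (ccons 0 i) d' q)" using JT[of 0 d' \<delta>' q] g \<delta>'(1) le by blast
        moreover have "ok (aJ (ccons 0 i) d' q)" using g by (simp add: ok_def)
        ultimately have "derivable r (false_below i) (fN (aJ (ccons 0 i) d' q))"
          by (intro fN_derivable) (auto simp: false_below_def)
        with leads_derivable[OF j] have "derivable r (false_below i) (fA i (2 ^ d') q 0)"
          by (rule derivable_2) (use \<open>0 < b'\<close> \<open>0 < d'\<close> in \<open>auto intro: just.intros(17)\<close>)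
        then show ?thesis using False \<open>d = 2 ^ d'\<close> by (simp add: chi_def)
      qed
    next
      case (3 e)
      have j: "leads i (3 * 5 ^ e)" using b 3 by simp
      \<comment> \<open>A successor differs from the limit \<open>rk i\<close>, so a member of the
        sequence of \<open>rk i\<close> lies above it.\<close>
      have "\<delta> \<noteq> rk i" using notates_lim_not_suc nb 3 \<delta>'(2) by blast
      then have "\<delta> < rk i" using less.prems(3) by simp
      then obtain m c \<epsilon> where m: "phi e m c" "notates c \<epsilon>" "\<delta> < \<epsilon>"
        using notates_phi_cofinal nb 3 by blast
      note g = good_lim[OF j m(1)]
      have lt: "\<delta> < rk (ccons m i)" using g(3) m(2,3) notates_unique by blast
      have "derivable r (false_upto (ccons m i)) (fL (ccons m i) d)"
        using L_claim[of "ccons m i" d \<delta>] g less.prems(2) lt by auto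
      then have L: "derivable r (false_below i) (fL (ccons m i) d)"
        by (rule derivable_mono) (rule false_upto_below)
      have "derivable r (false_below (ccons m i)) (fA (ccons m i) d q (chi (H_set d) q))"
        using IHc[of m d \<delta> q] g less.prems(2) lt by auto
      then have "derivable r (false_below i) (fA (ccons m i) d q (chi (H_set d) q))"
        by (rule derivable_mono) (rule false_below_mono)
      with leads_derivable[OF j] L show ?thesis
        unfolding \<open>d = 2 ^ d'\<close> by (rule derivable_3) (use \<open>0 < d'\<close> in \<open>auto intro: just.intros(20)\<close>)
    qed
  next
    case (3 e)
    have d: "d = 3 * 5 ^ e" by fact
    from nb show ?thesis
    proof (cases rule: notates_cases)
      case 1
      then have "is_zero (rk i)" using notates_1 nb by simp
      then have "is_zero \<delta>" using less.prems(3) by (rule is_zero_le)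
      then show ?thesis using notates_lim_nonzero less.prems(2) d by blast
    next
      case (2 b')
      have j: "leads i (2 ^ b')" using b 2 by simp
      note g = good_pow[OF j \<open>0 < b'\<close>, of 0]
      have "\<delta> \<noteq> rk i" using g notates_lim_not_suc less.prems(2) d by blast
      then have "\<delta> \<le> rk (ccons 0 i)" using less.prems(3) is_suc_less g by (metis le_less)
      then have "derivable r (false_below (ccons 0 i)) (fA (ccons 0 i) d q (chi (H_set d) q))"
        using IHc[of 0 d \<delta> q] g less.prems(2) by blast
      then have "derivable r (false_below i) (fA (ccons 0 i) d q (chi (H_set d) q))"
        by (rule derivable_mono) (rule false_below_mono)
      with leads_derivable[OF j] show ?thesis
        unfolding d by (rule derivable_2) (use \<open>0 < b'\<close> in \<open>auto intro: just.intros(18)\<close>)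
    next
      case (3 e')
      have j: "leads i (3 * 5 ^ e')" using b 3 by simp
      obtain q' n where q: "q = pr q' n" by (rule prE)
      obtain c where c: "phi e n c" using notates_phi_total less.prems(2) d by blast
      obtain \<epsilon> where \<epsilon>: "notates c \<epsilon>" "\<epsilon> < \<delta>" using notates_phi_less less.prems(2) d c by blast
      then have "\<epsilon> < rk i" using less.prems(3) by simp
      then obtain m c' \<zeta> where m: "phi e' m c'" "notates c' \<zeta>" "\<epsilon> < \<zeta>"
        using notates_phi_cofinal nb 3 by blast
      note g = good_lim[OF j m(1)]
      have lt: "\<epsilon> < rk (ccons m i)" using g(3) m(2,3) notates_unique by blast
      have "derivable r (false_upto (ccons m i)) (fL (ccons m i) c)"
        using L_claim[of "ccons m i" c \<epsilon>] g \<epsilon>(1) lt by auto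
      then have L: "derivable r (false_below i) (fL (ccons m i) c)"
        by (rule derivable_mono) (rule false_upto_below)
      have "derivable r (false_below (ccons m i)) (fA (ccons m i) c q' (chi (H_set c) q'))"
        using IHc[of m c \<epsilon> q'] g \<epsilon>(1) lt by auto
      then have "derivable r (false_below i) (fA (ccons m i) c q' (chi (H_set c) q'))"
        by (rule derivable_mono) (rule false_below_mono)
      with leads_derivable[OF j] phi_derivable[OF c] L
      have "derivable r (false_below i) (fA i (3 * 5 ^ e) (pr q' n) (chi (H_set c) q'))"
        by (rule derivable_4) (auto intro: just.intros(19))
      moreover have "chi (H_set d) q = chi (H_set c) q'" using H_set_lim less.prems(2) d c q by metis
      ultimately show ?thesis using d q by simp
    qed
  qed
  ultimately show ?case by blast
qed

lemma dec_valid: "dec (\<lambda>_. 0) valid"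
  unfolding valid_def by (intro dec_comp2[OF witness(1)] comp)

lemma dec_neg: "dec (\<lambda>_. 0) (\<lambda>y. neg (pfst y) (psnd y))"
  unfolding neg_def fN_def by (intro comp)

lemma dec_inv: "dec (\<lambda>_. 0) (\<lambda>y. inv (pfst y) (psnd y))"
  unfolding inv_def fB_def path_def by (intro comp)

lemma dec_cert: "dec (\<lambda>_. 0) (\<lambda>y. cert (pfst y) (psnd y))"
  unfolding cert_def neg_def fN_def fP_def path_def by (intro comp dec_comp[OF dec_valid])

text \<open>Each value is found by searching for a derivation of it at path 0 whose assumptions are
  all false according to \<open>t\<close>. By completeness the search ends, by soundness the result
  is right.\<close>

lemma true_atoms_compute:
  assumes t: "computable_from g t" "\<And>u. ok u \<Longrightarrow> t u = of_bool (T u)" and a: "notates a \<gamma>"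
  shows "computes_set g (H_set a)"
proof -
  define Q where "Q q Z \<longleftrightarrow> valid Z \<and> (\<forall>v<psnd Z. neg Z v \<longrightarrow> t v = 0)
     \<and> (cmem (fA 0 a q 0) (psnd Z) \<or> cmem (fA 0 a q 1) (psnd Z))" for q Z
  have A: "\<And>l q v. true_list l \<Longrightarrow> cmem (fA 0 a q v) l \<Longrightarrow> v = chi (H_set a) q"
    "\<And>q. derivable r (false_below 0) (fA 0 a q (chi (H_set a) q))"
    using A_claim[OF rk_0(2) a] rk_0(1) by auto
  have "\<exists>Z. Q q Z" for q
  proof -
    obtain l where l: "derivation r l" "cmem (fA 0 a q (chi (H_set a) q)) l"
        "\<And>v. cmem (fN v) l \<Longrightarrow> v \<in> false_below 0"
      using A(2)[of q] unfolding derivable_def by blast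
    obtain w where "valid (pr w l)" using derivation_valid[OF l(1)] by blast
    moreover have "t v = 0" if "cmem (fN v) l" for v
      using l(3)[OF that] t(2)[of v] by (simp add: false_below_def)
    moreover have "cmem (fA 0 a q 0) l \<or> cmem (fA 0 a q 1) l"
      using l(2) by (cases "q \<in> H_set a") (simp_all add: chi_def)
    ultimately show ?thesis by (intro exI[of _ "pr w l"]) (simp add: Q_def neg_def)
  qed
  moreover have "dec g (\<lambda>y. Q (pfst y) (psnd y))"
    unfolding Q_def fA_def
    by (intro comp dec_comp[OF dec_mono[OF dec_valid]] dec_comp2[OF dec_mono[OF dec_neg]] cf_comp[OF t(1)])
  ultimately have L: "computable_from g (\<lambda>q. LEAST Z. Q q Z)" by (intro cf_Least)
  have "chi (H_set a) q = of_bool (cmem (fA 0 a q 1) (psnd (LEAST Z. Q q Z)))" for q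
  proof -
    define Z where "Z = (LEAST Z. Q q Z)"
    have Z: "Q q Z" unfolding Z_def using \<open>\<And>q. \<exists>Z. Q q Z\<close> by (rule LeastI_ex)
    have D: "derivation r (psnd Z)" using Z unfolding Q_def by (blast intro: valid_derivation)
    have "\<not> T v" if "cmem (fN v) (psnd Z)" for v
    proof -
      have "t v = 0" using Z that cmem_fN_less[OF that] unfolding Q_def neg_def by blast
      then show ?thesis using t(2)[OF derivation_ok[OF D that]] by (cases "T v") simp_all
    qed
    then have "true_list (psnd Z)" using D unfolding true_list_def by blast
    from A(1)[OF this] have "cmem (fA 0 a q v) (psnd Z) \<Longrightarrow> v = chi (H_set a) q" for v .
    moreover have "cmem (fA 0 a q 0) (psnd Z) \<or> cmem (fA 0 a q 1) (psnd Z)" using Z unfolding Q_def by blast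
    ultimately have "chi (H_set a) q = of_bool (cmem (fA 0 a q 1) (psnd Z))"
      by (cases "cmem (fA 0 a q 1) (psnd Z)") fastforce+
    then show ?thesis unfolding Z_def .
  qed
  moreover have "computable_from g (\<lambda>q. of_bool (cmem (fA 0 a q 1) (psnd (LEAST Z. Q q Z))))"
    unfolding fA_def by (intro comp L)
  ultimately have "computable_from g (\<lambda>q. chi (H_set a) q)" by (simp only:)
  then show ?thesis by (simp add: computes_set_def)
qed

text \<open>An admissible atom has a path other than 0, hence an ordinal below
  \<open>\<gamma>\<close>, and the second assumption provides its level below
  \<open>\<alpha>\<close>.\<close>

lemma alternating:
  fixes \<alpha> :: 'o
  assumes \<alpha>: "\<not> is_zero \<alpha>" "\<And>\<beta>. \<beta> < \<gamma> \<Longrightarrow> \<exists>\<delta><\<alpha>. succ_le \<beta> \<delta>"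
  shows "alternating valid neg cert inv ok bnd T \<alpha>"
proof
  show "neg Z u \<Longrightarrow> u \<le> Z" for Z u
  proof -
    assume "neg Z u"
    then have "u < psnd Z" unfolding neg_def by (rule cmem_fN_less)
    also have "psnd Z \<le> Z" using le_prod_encode_2[of "psnd Z" "pfst Z"] by simp
    finally show "u \<le> Z" by simp
  qed
  show "\<exists>Z. valid Z \<and> (\<forall>u. \<not> neg Z u)"
  proof -
    obtain w where "valid (pr w 0)" using derivation_valid[of 0] by auto
    then show ?thesis by (intro exI[of _ "pr w 0"]) (simp add: neg_def)
  qed
  show "\<exists>Y. valid Y \<and> (\<forall>u. neg Y u \<longleftrightarrow> neg Z u \<or> neg Z' u) \<and> (\<forall>u. inv Z u \<or> inv Z' u \<longrightarrow> inv Y u)"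
    if Z: "valid Z" "valid Z'" for Z Z'
  proof -
    obtain n where n: "derivation r n" "\<forall>x. cmem x n \<longleftrightarrow> cmem x (psnd Z) \<or> cmem x (psnd Z')"
      using derivation_append[OF valid_derivation[OF Z(1)] valid_derivation[OF Z(2)]] by blast
    obtain w where "valid (pr w n)" using derivation_valid[OF n(1)] by blast
    then show ?thesis using n(2) by (intro exI[of _ "pr w n"]) (simp add: neg_def inv_def)
  qed
  show "\<exists>Z. valid Z \<and> (\<forall>v. neg Z v \<longleftrightarrow> v = u)" if u: "ok u" for u
  proof -
    obtain l where l: "derivation r l" "cmem (fN u) l" "\<forall>v. cmem (fN v) l \<longrightarrow> v \<in> {u}"
      using fN_derivable[OF singletonI u] unfolding derivable_def by blast
    obtain w where "valid (pr w l)" using derivation_valid[OF l(1)] by blast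
    moreover have "neg (pr w l) v \<longleftrightarrow> v = u" for v using l(2,3) unfolding neg_def psnd_pr by blast
    ultimately show ?thesis by blast
  qed
  show "\<exists>Z. valid Z \<and> inv Z u \<and> (\<forall>v. \<not> neg Z v)" if u: "\<not> ok u" for u
  proof -
    obtain b where b: "leads (path u) b" using leads_total by blast
    obtain l where l: "derivation r l" "cmem (fB (path u) b) l" "\<And>v. \<not> cmem (fN v) l"
      using leads_derivable[OF b, of "{}"] unfolding derivable_def by blast
    obtain w where "valid (pr w l)" using derivation_valid[OF l(1)] by blast
    moreover have "path u = 0 \<or> b = 0" using u b unfolding ok_def good_def by blast
    moreover from this have "inv (pr w l) u" using l(2) by (auto simp: inv_def)
    moreover have "\<not> neg (pr w l) v" for v using l(3) by (simp add: neg_def)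
    ultimately show ?thesis by blast
  qed
  show "\<not> ok u" if "valid Z" "inv Z u" for Z u
  proof
    assume "ok u"
    then obtain b where "path u \<noteq> 0" "0 < b" "leads (path u) b" unfolding ok_def good_def by blast
    moreover from this(1) have "cmem (fB (path u) 0) (psnd Z)" using that(2) by (simp add: inv_def)
    then have "leads (path u) 0" by (rule derivation_leads[OF valid_derivation[OF that(1)]])
    ultimately show False using leads_det[of "path u" b 0] by simp
  qed
  show "\<exists>\<epsilon><\<delta>. bnd v \<epsilon>" if "bnd u \<delta>" "cert u Z" "neg Z v" for u \<delta> Z v
  proof -
    have v: "ok v" "ext (path v) (path u)" using cert_below[OF that(2,3)] unfolding below_def by auto
    then have "rk (path v) < rk (path u)" using good_ext unfolding ok_def by blast
    then have "\<exists>\<epsilon><\<delta>. succ_le (rk (path v)) \<epsilon>"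
      using that(1) unfolding bnd_def by (intro succ_le_step[of "rk (path u)"]) simp_all
    then show ?thesis using v(1) by (simp add: bnd_def)
  qed
  show "\<exists>\<delta><\<alpha>. bnd u \<delta>" if "ok u" for u
    using \<alpha>(2)[OF rk_less[of "path u"]] that by (simp add: bnd_def ok_def)
  show "T u \<longleftrightarrow> (\<exists>Z. cert u Z \<and> (\<forall>v. neg Z v \<longrightarrow> \<not> T v))" for u by (rule T_iff)
  show "cert u Z \<Longrightarrow> valid Z" for u Z by (simp add: cert_def)
  show "valid Z \<Longrightarrow> neg Z u \<Longrightarrow> ok u" for Z u
    unfolding neg_def by (rule derivation_ok[OF valid_derivation])
  show "bnd u \<delta> \<Longrightarrow> \<delta> \<le> \<epsilon> \<Longrightarrow> bnd u \<epsilon>" for u \<delta> \<epsilon>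
    unfolding bnd_def using succ_le_mono[of "rk (path u)" \<delta> \<epsilon>] by simp
  show "bnd u \<delta> \<Longrightarrow> \<not> is_zero \<delta>" for u \<delta>
    unfolding bnd_def using succ_le_nonzero[of "rk (path u)" \<delta>] by simp
qed (rule dec_valid dec_neg dec_inv dec_cert \<alpha>(1))+

end

theorem theorem1p2:
  fixes \<alpha> :: "'o::wellorder" and k :: nat
  assumes "computable_ordinal \<alpha>" and "\<not> is_zero \<alpha>" and "k \<ge> 3"
  shows "\<exists>D c. computable_coloring_code k \<alpha> D c \<and>
           (\<forall>p\<in>inf_partitions. homogeneous k c p \<longrightarrow>
              (if infinite {..<\<alpha>} then computes_jump p \<alpha>
               else computes_jump p (Max {..<\<alpha>})))"
proof -
  define \<gamma> where "\<gamma> = (if infinite {..<\<alpha>} then \<alpha> else Max {..<\<alpha>})"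
  have "computable_ordinal \<gamma> \<and> (\<forall>\<beta><\<gamma>. \<exists>\<delta><\<alpha>. succ_le \<beta> \<delta>)"
  proof (cases "infinite {..<\<alpha>}")
    case True
    then show ?thesis using assms(1) succ_le_infinite[OF True] by (simp add: \<gamma>_def)
  next
    case False
    obtain \<beta> where "\<beta> < \<alpha>" using assms(2) unfolding is_zero_def by (auto simp: not_le)
    then have "{..<\<alpha>} \<noteq> {}" by auto
    then have "\<gamma> \<in> {..<\<alpha>}" using False Max_in[of "{..<\<alpha>}"] by (simp add: \<gamma>_def)
    then have "\<gamma> < \<alpha>" by simp
    \<comment> \<open>Every \<open>\<beta> < \<gamma>\<close> can be given the level
      \<open>\<gamma>\<close>, which is below \<open>\<alpha>\<close>.\<close>
    then show ?thesis using computable_ordinal_less[OF assms(1)] unfolding succ_le_def by blast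
  qed
  then obtain r where r: "notates r \<gamma>" and \<gamma>: "\<And>\<beta>. \<beta> < \<gamma> \<Longrightarrow> \<exists>\<delta><\<alpha>. succ_le \<beta> \<delta>"
    unfolding computable_ordinal_def by blast
  interpret jump_system r \<gamma> by unfold_locales (rule r)
  interpret S: alternating valid neg cert inv ok bnd T \<alpha> by (rule alternating[OF assms(2) \<gamma>])
  have "computes_jump p \<gamma>" if p: "p \<in> inf_partitions" "homogeneous k S.colour p" for p
  proof -
    obtain t where "computable_from p t" "\<And>u. ok u \<Longrightarrow> t u = of_bool (T u)"
      using S.homogeneous_computes[OF assms(3) p] by blast
    then show ?thesis unfolding computes_jump_def using true_atoms_compute by blast
  qed
  then have "\<forall>p\<in>inf_partitions. homogeneous k S.colour p \<longrightarrow>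
      (if infinite {..<\<alpha>} then computes_jump p \<alpha> else computes_jump p (Max {..<\<alpha>}))"
    by (cases "infinite {..<\<alpha>}") (simp_all add: \<gamma>_def)
  then show ?thesis using S.colouring_code[OF assms(3)] by blast
qed

end
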